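(* Let $\{\alpha_m\}_{m\in\mathbb N_0}$ be a sequence of real numbers for which $\sum_{m=0}^\infty\alpha_m$ converges absolutely, let $$f(t):=\sum_{m=0}^\infty\alpha_m\varphi(2^mt),\quad t\in[0,1],\qquad\text{and}\qquad s_n^2:=\sum_{m=0}^{n-1}\alpha_m^24^m,\quad n\in\mathbb N.$$ Suppose that there exist $q\in[0,1)$ and a regularly varying function $g$ such that $$\lim_{n\uparrow\infty}\frac{s_n^2}{2^{2qn}g(n)}=1.$$ Let $\{Y_m\}_{m\in\mathbb N}$ be an i.i.d. sequence of symmetric $\{-1,+1\}$-valued Bernoulli random variables, and let $\Phi_q:[0,1)\to[0,\infty)$ be defined by $\Phi_q(0):=0$ and $$\Phi_q(x):=x^{\frac1{1-q}}\,g\Big(\frac{-\log_2x}{1-q}\Big)^{-\frac1{2(1-q)}},\qquad 0<x<1.$$ Then the following hold: (a) The function $f$ is of bounded variation if and only if $\lim_ns_n^2<\infty$, and, in this case, the total variation of $f$ is equal to $\mathbb E[|\widetilde Z|]$, where $\widetilde Z:=\sum_{m=0}^\infty\alpha_m2^mY_{m+1}$. (b) If $s_n^2\to\infty$ and $q=0$, then the $\Phi_0$-variation of $f$ is given by $\langle f\rangle_t^{\Phi_0}=\sqrt{\tfrac2\pi}\cdot t$ for all $t\in[0,1]$. (c) If $q>0$, then the $\Phi_q$-variation of $f$ is given by $$\langle f\rangle_t^{\Phi_q}=\mathbb E\big[|Z|^{\frac1{1-q}}\big]\cdot t\quad\text{for all }t\in[0,1],\qquad\text{where}\quad Z:=\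sqrt{2^{2q}-1}\,\sum_{m=1}^\infty2^{-qm}Y_m.$$
   Context: $\varphi(t):=\min_{z\in\mathbb Z}|z-t|$ is the tent map. A measurable, strictly positive function $g:[0,\infty)\to(0,\infty)$ is called regularly varying (at infinity) with index $\varrho\in\mathbb R$ if $g(\lambda x)/g(x)\to\lambda^\varrho$ as $x\uparrow\infty$ for every $\lambda>0$. All regularly varying functions are assumed to be defined on $[0,\infty)$ and bounded on compact intervals. For a function $\Phi$ with $\Phi(0)=0$, defined on $[0,1)$ with values in $[0,\infty)$, the $\Phi$-variation of a continuous function $f:[0,1]\to\mathbb R$ along the sequence of dyadic partitions is $$\langle f\rangle^\Phi_t:=\lim_{n\uparrow\infty}\sum_{k=0}^{\lfloor t2^n\rfloor}\Phi\big(|f((k+1)2^{-n})-f(k2^{-n})|\big),\qquad 0\le t\le1,$$ provided the limit exists for all $t\in[0,1]$ (a claimed formula for $\langle f\rangle_t^\Phi$ includes existence of the limit for all $t$). For $t=1$ the term $k=2^n$ is omitted. Only $n$ large enough that all increments have absolute value less than $1$ are considered (such $n$ exist by uniform continuity of $f$), so it suffices that $\Phi$ is defined on $[0,1)$. Bounded/total variation is in the usual sense (supremum over all finite partitions of $[0,1]$). A symmetric $\{-1,+1\}$-valued Bernoulli random variable takes each value with probability $\tfrac12$. *)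

theory Defs
  imports "HOL-Probability.Probability"
begin

definition tent :: "real \<Rightarrow> real" where
  "tent t = (INF z::int. \<bar>of_int z - t\<bar>)"

(* The infimum above is attained, so it is the minimum over all integers z. *)
lemma tent_eq_round: "tent t = \<bar>of_int (round t) - t\<bar>"
  unfolding tent_def
  by (rule cInf_eq_minimum) (use round_diff_minimal[of t] in \<open>auto simp: abs_minus_commute\<close>)

definition takagi_fun :: "(nat \<Rightarrow> real) \<Rightarrow> real \<Rightarrow> real" where
  "takagi_fun \<alpha> t = (\<Sum>m. \<alpha> m * tent (2 ^ m * t))"

(* This is s_n^2, not s_n. *)
definition ssq :: "(nat \<Rightarrow> real) \<Rightarrow> nat \<Rightarrow> real" where
  "ssq \<alpha> n = (\<Sum>m<n. (\<alpha> m)\<^sup>2 * 4 ^ m)"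

(* Functions on [0, \<infinity>) are represented by total functions on the reals, whose values at
   negative arguments are unconstrained. Measurability is Lebesgue measurability on [0, \<infinity>);
   in particular every Borel function qualifies. *)
definition regularly_varying :: "(real \<Rightarrow> real) \<Rightarrow> real \<Rightarrow> bool" where
  "regularly_varying g \<rho> \<longleftrightarrow>
     g \<in> borel_measurable (lebesgue_on {0..}) \<and>
     (\<forall>x\<ge>0. g x > 0) \<and>
     (\<forall>l>0. ((\<lambda>x. g (l * x) / g x) \<longlongrightarrow> l powr \<rho>) at_top)"

definition bounded_on_compacts :: "(real \<Rightarrow> real) \<Rightarrow> bool" where
  "bounded_on_compacts g \<longleftrightarrow> (\<forall>a b. 0 \<le> a \<longrightarrow> bounded (g ` {a..b}))"

(* Only arguments x in [0, 1) are meaningful. *)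
definition Phi :: "real \<Rightarrow> (real \<Rightarrow> real) \<Rightarrow> real \<Rightarrow> real" where
  "Phi q g x = (if x = 0 then 0
     else x powr (1 / (1 - q)) * g (- log 2 x / (1 - q)) powr (- 1 / (2 * (1 - q))))"

(* Removing the index 2^n only affects t = 1: for t < 1 the floor is smaller than 2^n. *)
definition dyadic_variation_sum ::
    "(real \<Rightarrow> real) \<Rightarrow> (real \<Rightarrow> real) \<Rightarrow> real \<Rightarrow> nat \<Rightarrow> real" where
  "dyadic_variation_sum \<Psi> f t n =
     (\<Sum>k \<in> {0..nat \<lfloor>t * 2 ^ n\<rfloor>} - {2 ^ n}.
        \<Psi> \<bar>f (real (k + 1) / 2 ^ n) - f (real k / 2 ^ n)\<bar>)"

(* The limit for each t exists and equals V t. For continuous f all increments are smaller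
   than 1 for large n, so values of \<Psi> outside [0, 1) do not influence the limit. *)
definition has_dyadic_variation ::
    "(real \<Rightarrow> real) \<Rightarrow> (real \<Rightarrow> real) \<Rightarrow> (real \<Rightarrow> real) \<Rightarrow> bool" where
  "has_dyadic_variation \<Psi> f V \<longleftrightarrow>
     (\<forall>t\<in>{0..1}. dyadic_variation_sum \<Psi> f t \<longlonglongrightarrow> V t)"

definition variation_sums :: "(real \<Rightarrow> real) \<Rightarrow> real \<Rightarrow> real \<Rightarrow> real set" where
  "variation_sums f a b =
     {(\<Sum>i<n. \<bar>f (p (Suc i)) - f (p i)\<bar>) | (n::nat) (p::nat \<Rightarrow> real).
        p 0 = a \<and> p n = b \<and> (\<forall>i<n. p i < p (Suc i))}"

definition bounded_variation :: "(real \<Rightarrow> real) \<Rightarrow> real \<Rightarrow> real \<Rightarrow> bool" where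
  "bounded_variation f a b \<longleftrightarrow> bdd_above (variation_sums f a b)"

definition total_variation :: "(real \<Rightarrow> real) \<Rightarrow> real \<Rightarrow> real \<Rightarrow> real" where
  "total_variation f a b = Sup (variation_sums f a b)"

definition symmetric_sign :: "'w measure \<Rightarrow> ('w \<Rightarrow> real) \<Rightarrow> bool" where
  "symmetric_sign M X \<longleftrightarrow>
     X \<in> borel_measurable M \<and>
     measure M {\<omega> \<in> space M. X \<omega> = 1} = 1 / 2 \<and>
     measure M {\<omega> \<in> space M. X \<omega> = - 1} = 1 / 2"

definition iid_symmetric_signs :: "'w measure \<Rightarrow> (nat \<Rightarrow> 'w \<Rightarrow> real) \<Rightarrow> bool" where
  "iid_symmetric_signs M Y \<longleftrightarrow>
     prob_space.indep_vars M (\<lambda>_. borel) Y {1..} \<and> (\<forall>m\<ge>1. symmetric_sign M (Y m))"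

definition Ztilde :: "(nat \<Rightarrow> real) \<Rightarrow> (nat \<Rightarrow> 'w \<Rightarrow> real) \<Rightarrow> 'w \<Rightarrow> real" where
  "Ztilde \<alpha> Y \<omega> = (\<Sum>m. \<alpha> m * 2 ^ m * Y (m + 1) \<omega>)"

(* The series over m = 1, 2, ... is shifted to start at 0. *)
definition Zq :: "real \<Rightarrow> (nat \<Rightarrow> 'w \<Rightarrow> real) \<Rightarrow> 'w \<Rightarrow> real" where
  "Zq q Y \<omega> = sqrt (2 powr (2 * q) - 1) * (\<Sum>m. 2 powr (- q * real (m + 1)) * Y (m + 1) \<omega>)"

end

theory Submission
  imports Defs "HOL-Real_Asymp.Real_Asymp"
begin

text \<open>
  Put \<open>a m = \<alpha> m * 2 ^ m\<close>. On a dyadic interval of level \<open>N\<close> the functions \<open>tent (2 ^ m * t)\<close>,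
  \<open>m < N\<close>, are affine with slopes \<open>\<plusminus> 2 ^ m\<close> and the later ones vanish at both end points; over all
  intervals every pattern of signs occurs once. So the increments, multiplied by \<open>2 ^ N\<close>, are the
  values of the random walk \<open>\<Sum>m<N. a m * Y (m + 1)\<close>, and the intervals inside a dyadic interval of
  level \<open>p\<close> correspond to fixing the first \<open>p\<close> signs.

  In (a) the dyadic sums are thus the first absolute moments of the walk, which converge to that of the
  limit if \<open>s\<^sub>n\<close> is bounded and are at least \<open>9 / 16 * s\<^sub>n\<close> by Khintchine's inequality.
  In (b) and (c), the uniform convergence theorem for regularly varying functions shows that \<open>2 ^ N \<Phi>\<^sub>q(2 ^ -N \<bar>y\<bar>)\<close>
  is close to \<open>\<bar>y / s\<^sub>N\<bar> powr (1 / (1 - q))\<close> on the range of the walk, and fixing the first \<open>p\<close> signs does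
  not matter in the limit because \<open>s\<^sub>N\<close> tends to infinity. It remains to find the limit of these moments.
  If \<open>q = 0\<close> the central limit theorem applies, as \<open>s\<^sub>n\<^sub>+\<^sub>1 / s\<^sub>n\<close> tends to \<open>1\<close>.
  If \<open>q > 0\<close> that ratio tends to \<open>2 powr q\<close>, so that the walk is dominated by its last steps; read backwards
  and divided by \<open>s\<^sub>N\<close>, its coefficients converge in \<open>l\<^sup>1\<close> to those of \<open>Z\<close>.
\<close>

section \<open>Random walks with symmetric signs and dyadic increments\<close>

text \<open>Two obstacles shape the proof. First, the argument of \<open>g\<close> in
  \<open>Phi\<close> depends on the size of the increment, so pointwise regular variation is not
  enough: \<open>g\<close> at \<open>(N - log 2 \<bar>y\<bar>) / (1 - q)\<close> must be compared
  with \<open>g N\<close> uniformly over the values \<open>y\<close> of the walk, and this is where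
  the measurability of \<open>g\<close> enters. Secondly, for \<open>q > 0\<close> the exponent
  \<open>1 / (1 - q)\<close> exceeds 1 and the power is not uniformly continuous, so that even a
  bounded shift of the walk could matter. There the walk stays within a fixed multiple of its
  standard deviation, and the power may be truncated. In that case each new step remains of the
  order of the whole walk, so the normalized walks converge in law only. Reversing the order of the
  steps preserves the law and yields convergence for almost every sequence of signs. Dyadic sums are
  finite averages over signs. They are therefore expressed by \<open>walk_avg\<close>, a recursion
  without a probability space, whose start \<open>x\<close> is a variable because every induction
  moves it; probability enters only for the limits.\<close>

fun walk_avg :: "nat \<Rightarrow> (nat \<Rightarrow> real) \<Rightarrow> (real \<Rightarrow> real) \<Rightarrow> real \<Rightarrow> real" where
  "walk_avg 0 a H x = H x"
| "walk_avg (Suc n) a H x =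
     (walk_avg n (\<lambda>m. a (Suc m)) H (x + a 0) + walk_avg n (\<lambda>m. a (Suc m)) H (x - a 0)) / 2"

text \<open>Only points that the walk can reach matter. The asymptotics of \<open>Phi\<close> hold
  on this range alone, so a comparison for all \<open>y\<close> would be out of reach.\<close>

lemma walk_avg_mono:
  assumes "\<And>y. \<bar>y - x\<bar> \<le> (\<Sum>m<n. \<bar>a m\<bar>) \<Longrightarrow> H y \<le> K y"
  shows "walk_avg n a H x \<le> walk_avg n a K x"
  using assms
proof (induction n arbitrary: a x)
  case (Suc n)
  have s: "(\<Sum>m<Suc n. \<bar>a m\<bar>) = \<bar>a 0\<bar> + (\<Sum>m<n. \<bar>a (Suc m)\<bar>)"
    by (rule sum.lessThan_Suc_shift)
  have "walk_avg n (\<lambda>m. a (Suc m)) H (x + a 0) \<le> walk_avg n (\<lambda>m. a (Suc m)) K (x + a 0)"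
    by (rule Suc.IH, rule Suc.prems) (use s in linarith)
  moreover have "walk_avg n (\<lambda>m. a (Suc m)) H (x - a 0) \<le> walk_avg n (\<lambda>m. a (Suc m)) K (x - a 0)"
    by (rule Suc.IH, rule Suc.prems) (use s in linarith)
  ultimately show ?case by simp
qed simp

lemma walk_avg_affine:
  "walk_avg n a (\<lambda>y. c * H y + d) x = c * walk_avg n a H x + d"
  by (induction n arbitrary: a x) (simp_all add: field_simps)

lemma walk_avg_cmult: "walk_avg n a (\<lambda>y. c * H y) x = c * walk_avg n a H x"
  using walk_avg_affine[of n a c H 0 x] by simp

lemma walk_avg_const: "walk_avg n a (\<lambda>y. d) x = d"
  using walk_avg_affine[of n a 0 _ d x] by simp

lemma walk_avg_add:
  "walk_avg n a (\<lambda>y. H y + K y) x = walk_avg n a H x + walk_avg n a K x"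
  by (induction n arbitrary: a x) (simp_all add: field_simps)

lemma walk_avg_scale:
  "walk_avg n (\<lambda>m. c * a m) H (c * x) = walk_avg n a (\<lambda>y. H (c * y)) x"
  by (induction n arbitrary: a x) (simp_all flip: distrib_left right_diff_distrib)

text \<open>The defining recursion removes the first step, whereas a new random sign adds a last
  one; the steps commute.\<close>

lemma walk_avg_snoc:
  "walk_avg (Suc n) a H x = (walk_avg n a H (x + a n) + walk_avg n a H (x - a n)) / 2"
proof (induction n arbitrary: a x)
  case (Suc n)
  have "walk_avg (Suc (Suc n)) a H x =
     (walk_avg (Suc n) (\<lambda>m. a (Suc m)) H (x + a 0) + walk_avg (Suc n) (\<lambda>m. a (Suc m)) H (x - a 0)) / 2"
    by simp
  also have "\<dots> = (walk_avg (Suc n) a H (x + a (Suc n)) + walk_avg (Suc n) a H (x - a (Suc n))) / 2"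
  proof -
    have e: "x - a 0 + a (Suc n) = x + a (Suc n) - a 0" "x + a 0 - a (Suc n) = x - a (Suc n) + a 0"
      "x + a 0 + a (Suc n) = x + a (Suc n) + a 0" "x - a 0 - a (Suc n) = x - a (Suc n) - a 0"
      by simp_all
    show ?thesis
      unfolding Suc.IH[of "\<lambda>m. a (Suc m)"] e by (simp add: field_simps)
  qed
  finally show ?case .
qed simp

text \<open>The law of the walk ignores the order of its steps. Reversal puts the last coefficients,
  which dominate for \<open>q > 0\<close>, first.\<close>

lemma walk_avg_rev: "walk_avg n (\<lambda>m. a (n - Suc m)) H x = walk_avg n a H x"
proof (induction n arbitrary: x)
  case (Suc n)
  show ?case
    by (subst walk_avg_snoc) (simp add: Suc.IH)
qed simp

text \<open>A sign change of \<open>a m\<close> only swaps the two halves of the average.\<close>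

lemma walk_avg_abs: "walk_avg n (\<lambda>m. \<bar>a m\<bar>) H x = walk_avg n a H x"
  by (induction n arbitrary: a x) (auto simp: abs_if add.commute)

lemma walk_avg_square: "walk_avg n a (\<lambda>y. y\<^sup>2) x = x\<^sup>2 + (\<Sum>m<n. (a m)\<^sup>2)"
proof (induction n arbitrary: a x)
  case (Suc n)
  then show ?case
    by (simp add: sum.lessThan_Suc_shift power2_eq_square field_simps del: sum.lessThan_Suc)
qed simp

lemma walk_avg_fourth:
  "walk_avg n a (\<lambda>y. y ^ 4) x \<le>
     x ^ 4 + 6 * x\<^sup>2 * (\<Sum>m<n. (a m)\<^sup>2) + 3 * (\<Sum>m<n. (a m)\<^sup>2)\<^sup>2"
proof (induction n arbitrary: a x)
  case (Suc n)
  define s where "s = (\<Sum>m<n. (a (Suc m))\<^sup>2)"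
  have "walk_avg (Suc n) a (\<lambda>y. y ^ 4) x \<le>
     (((x + a 0) ^ 4 + 6 * (x + a 0)\<^sup>2 * s + 3 * s\<^sup>2) + ((x - a 0) ^ 4 + 6 * (x - a 0)\<^sup>2 * s + 3 * s\<^sup>2)) / 2"
    using Suc.IH[of "\<lambda>m. a (Suc m)" "x + a 0"] Suc.IH[of "\<lambda>m. a (Suc m)" "x - a 0"]
    by (simp add: s_def)
  \<comment> \<open>The slack \<open>2 * (a 0) ^ 4\<close> arises because a sign has fourth moment
    1, while the Gaussian constant is 3.\<close>
  also have "\<dots> = x ^ 4 + 6 * x\<^sup>2 * ((a 0)\<^sup>2 + s) + 3 * ((a 0)\<^sup>2 + s)\<^sup>2 - 2 * (a 0) ^ 4"
    by (simp add: power2_eq_square power4_eq_xxxx field_simps)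
  also have "\<dots> \<le> x ^ 4 + 6 * x\<^sup>2 * ((a 0)\<^sup>2 + s) + 3 * ((a 0)\<^sup>2 + s)\<^sup>2" by simp
  finally show ?case
    by (simp add: s_def sum.lessThan_Suc_shift del: sum.lessThan_Suc)
qed simp

text \<open>By the addition formulas, averaging over one sign cancels the odd part and leaves a
  factor \<open>cos (a m)\<close>. With the sine version this gives the characteristic function of
  the walk.\<close>

lemma walk_avg_cos: "walk_avg n a cos x = cos x * (\<Prod>m<n. cos (a m))"
proof (induction n arbitrary: a x)
  case (Suc n)
  then show ?case
    by (simp add: prod.lessThan_Suc_shift cos_add cos_diff field_simps del: prod.lessThan_Suc)
qed simp

lemma walk_avg_sin: "walk_avg n a sin x = sin x * (\<Prod>m<n. cos (a m))"
proof (induction n arbitrary: a x)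
  case (Suc n)
  then show ?case
    by (simp add: prod.lessThan_Suc_shift sin_add sin_diff field_simps del: prod.lessThan_Suc)
qed simp

text \<open>\<open>\<bar>y\<bar>\<close> is bounded below by an even quartic, whose average is
  controlled by the second and fourth moments: \<open>3 / 4 * s - 3 / 16 * s\<close> is the origin
  of 9/16. The scale \<open>2 * s\<close> is a rational stand-in for \<open>sqrt 3 * s\<close>,
  which would give the constant \<open>1 / sqrt 3\<close>.\<close>

lemma walk_avg_abs_lower:
  "9 / 16 * sqrt (\<Sum>m<n. (a m)\<^sup>2) \<le> walk_avg n a (\<lambda>y. \<bar>y\<bar>) 0"
proof (cases "(\<Sum>m<n. (a m)\<^sup>2) = 0")
  case True
  have "walk_avg n a (\<lambda>y. 0) 0 \<le> walk_avg n a (\<lambda>y. \<bar>y\<bar>) 0"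
    by (rule walk_avg_mono) simp
  then show ?thesis using True by (simp add: walk_avg_const)
next
  case False
  define s where "s = sqrt (\<Sum>m<n. (a m)\<^sup>2)"
  have s2: "s\<^sup>2 = (\<Sum>m<n. (a m)\<^sup>2)" unfolding s_def by (simp add: sum_nonneg)
  have s: "s > 0"
    using False sum_nonneg[of "{..<n}" "\<lambda>m. (a m)\<^sup>2"] unfolding s_def by (simp add: less_le)
  \<comment> \<open>Khintchine's inequality from \<open>0 \<le> (v - 1)\<^sup>2 (v + 2)\<close> with \<open>v = \<bar>y\<bar> / (2 s)\<close>.\<close>
  have pt: "3 / (4 * s) * y\<^sup>2 + (- 1 / (16 * s ^ 3)) * y ^ 4 \<le> \<bar>y\<bar>" for y
  proof -
    define v where "v = \<bar>y\<bar> / (2 * s)"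
    have v: "v \<ge> 0" using s by (simp add: v_def)
    have "0 \<le> s * v * ((v - 1)\<^sup>2 * (v + 2))" using v s by simp
    also have "\<dots> = s * (v ^ 4 - 3 * v\<^sup>2 + 2 * v)"
      by (simp add: power2_eq_square power4_eq_xxxx algebra_simps)
    finally have "3 * s * v\<^sup>2 - s * v ^ 4 \<le> 2 * s * v" by (simp add: algebra_simps)
    moreover have "2 * s * v = \<bar>y\<bar>" using s by (simp add: v_def)
    moreover have "3 * s * v\<^sup>2 = 3 / (4 * s) * y\<^sup>2"
      using s by (simp add: v_def power2_eq_square field_simps)
    moreover have "s * v ^ 4 = 1 / (16 * s ^ 3) * y ^ 4"
      using s by (simp add: v_def power_divide power_mult_distrib field_simps eval_nat_numeral)
    ultimately show ?thesis unfolding minus_divide_left[symmetric] mult_minus_left by linarith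
  qed
  have f: "walk_avg n a (\<lambda>y. y ^ 4) 0 \<le> 3 * s ^ 4"
    using walk_avg_fourth[of n a 0] by (simp add: s2[symmetric] flip: power_mult)
  have "9 / 16 * s = 3 / (4 * s) * s\<^sup>2 - 1 / (16 * s ^ 3) * (3 * s ^ 4)"
    using s by (simp add: power2_eq_square field_simps eval_nat_numeral)
  also have "\<dots> \<le> 3 / (4 * s) * s\<^sup>2 - 1 / (16 * s ^ 3) * walk_avg n a (\<lambda>y. y ^ 4) 0"
    using f s by (intro diff_left_mono mult_left_mono) auto
  also have "\<dots> = walk_avg n a (\<lambda>y. 3 / (4 * s) * y\<^sup>2 + (- 1 / (16 * s ^ 3)) * y ^ 4) 0"
    unfolding walk_avg_add walk_avg_cmult by (simp add: walk_avg_square s2)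
  also have "\<dots> \<le> walk_avg n a (\<lambda>y. \<bar>y\<bar>) 0"
    by (rule walk_avg_mono) (rule pt)
  finally show ?thesis by (simp add: s_def)
qed

text \<open>If the average over the later steps is close to \<open>c\<close> from every reachable
  position \<open>B\<close>, then averaging over the first \<open>p\<close> steps cannot leave that
  interval.\<close>

lemma walk_avg_split:
  assumes "\<And>B. \<bar>B - x\<bar> \<le> (\<Sum>m<p. \<bar>a m\<bar>) \<Longrightarrow> \<bar>walk_avg n (\<lambda>m. a (m + p)) H B - c\<bar> \<le> \<eta>"
  shows "\<bar>walk_avg (p + n) a H x - c\<bar> \<le> \<eta>"
  using assms
proof (induction p arbitrary: a x)
  case (Suc p)
  have s: "(\<Sum>m<Suc p. \<bar>a m\<bar>) = \<bar>a 0\<bar> + (\<Sum>m<p. \<bar>a (Suc m)\<bar>)"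
    by (rule sum.lessThan_Suc_shift)
  have "\<bar>walk_avg (p + n) (\<lambda>m. a (Suc m)) H (x + a 0) - c\<bar> \<le> \<eta>"
    by (rule Suc.IH, use Suc.prems s in force)
  moreover have "\<bar>walk_avg (p + n) (\<lambda>m. a (Suc m)) H (x - a 0) - c\<bar> \<le> \<eta>"
    by (rule Suc.IH, use Suc.prems s in force)
  ultimately show ?case by (simp add: field_simps abs_le_iff)
qed simp

section \<open>The tent map and the self-similarity of Takagi functions\<close>

lemma tent_add_int: "tent (t + of_int i) = tent t"
proof -
  have "round (t + of_int i) = round t + i"
    unfolding round_def by (metis add.assoc add.commute floor_add_int)
  then show ?thesis by (simp add: tent_eq_round)
qed

lemma tent_le: "tent t \<le> \<bar>of_int z - t\<bar>"
  unfolding tent_eq_round by (metis abs_minus_commute round_diff_minimal)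

lemma tent_nonneg: "0 \<le> tent t" by (simp add: tent_eq_round)

lemma tent_le_half: "tent t \<le> 1 / 2"
  unfolding tent_eq_round by (rule of_int_round_abs_le)

lemma tent_left: assumes "0 \<le> t" "t \<le> 1 / 2" shows "tent t = t"
proof (rule antisym)
  show "tent t \<le> t" using tent_le[of t 0] assms by simp
  have "round t \<le> 0 \<or> round t \<ge> 1" by linarith
  then have "of_int (round t) \<le> (0::real) \<or> of_int (round t) \<ge> (1::real)" by auto
  then show "t \<le> tent t" unfolding tent_eq_round using assms by auto
qed

lemma tent_minus: "tent (- t) = tent t"
proof -
  have *: "tent (- t) \<le> tent t" for t
    using tent_le[of "- t" "- round t"] by (simp add: tent_eq_round[of t] abs_minus_commute)
  show ?thesis using *[of t] *[of "- t"] by simp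
qed

lemma tent_right: assumes "1 / 2 \<le> t" "t \<le> 1" shows "tent t = 1 - t"
proof -
  have "tent t = tent (1 - t)" using tent_add_int[of "- t" 1] tent_minus[of t] by (simp add: add.commute)
  then show ?thesis using tent_left[of "1 - t"] assms by simp
qed

lemma tent_lipschitz: "\<bar>tent s - tent t\<bar> \<le> \<bar>s - t\<bar>"
proof -
  have *: "tent s \<le> tent t + \<bar>s - t\<bar>" for s t
    using tent_le[of s "round t"] unfolding tent_eq_round[of t] by linarith
  show ?thesis using *[of s t] *[of t s] by linarith
qed

lemma continuous_on_tent: "continuous_on A tent"
  by (rule lipschitz_on_continuous_on[where L = 1])
     (auto simp: lipschitz_on_def dist_real_def tent_lipschitz)

lemma takagi_term_bound: "norm (\<alpha> m * tent t) \<le> \<bar>\<alpha> m\<bar>"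
proof -
  have "\<bar>tent t\<bar> \<le> 1" using tent_nonneg[of t] tent_le_half[of t] by linarith
  then show ?thesis by (simp add: abs_mult mult_left_le)
qed

lemma takagi_summable:
  assumes "summable (\<lambda>m. \<bar>\<alpha> m\<bar>)"
  shows "summable (\<lambda>m. \<alpha> m * tent (s m))"
  by (rule summable_comparison_test'[OF assms]) (rule takagi_term_bound)

lemma continuous_on_takagi:
  assumes "summable (\<lambda>m. \<bar>\<alpha> m\<bar>)"
  shows "continuous_on A (takagi_fun \<alpha>)"
proof -
  have "uniform_limit A (\<lambda>n t. \<Sum>m<n. \<alpha> m * tent (2 ^ m * t)) (\<lambda>t. \<Sum>m. \<alpha> m * tent (2 ^ m * t)) sequentially"
    by (rule Weierstrass_m_test[OF _ assms]) (rule takagi_term_bound)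
  then have "continuous_on A (\<lambda>t. \<Sum>m. \<alpha> m * tent (2 ^ m * t))"
  proof (rule uniform_limit_theorem[rotated])
    show "\<forall>\<^sub>F n in sequentially. continuous_on A (\<lambda>t. \<Sum>m<n. \<alpha> m * tent (2 ^ m * t))"
      by (intro always_eventually allI continuous_intros
            continuous_on_compose2[OF continuous_on_tent[of UNIV]]) auto
  qed simp
  then show ?thesis by (simp add: takagi_fun_def[abs_def])
qed

text \<open>Doubling the argument shifts the coefficients. With periodicity, both halves of the unit
  interval are thereby reduced to one function with shifted \<open>\<alpha>\<close>, which drives
  the inductions on dyadic levels.\<close>

lemma takagi_split_head:
  assumes "summable (\<lambda>m. \<bar>\<alpha> m\<bar>)"
  shows "takagi_fun \<alpha> s = \<alpha> 0 * tent s + takagi_fun (\<lambda>m. \<alpha> (Suc m)) (2 * s)"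
  using suminf_split_head[OF takagi_summable[OF assms, of "\<lambda>m. 2 ^ m * s"]]
  by (simp add: takagi_fun_def mult.assoc mult.left_commute)

lemma takagi_periodic: "takagi_fun \<alpha> (s + 1) = takagi_fun \<alpha> s"
proof -
  have "tent (2 ^ m * (s + 1)) = tent (2 ^ m * s)" for m
    using tent_add_int[of "2 ^ m * s" "2 ^ m"] by (simp add: distrib_left)
  then show ?thesis by (simp add: takagi_fun_def)
qed

lemma takagi_left_half:
  assumes "summable (\<lambda>m. \<bar>\<alpha> m\<bar>)" "0 \<le> t" "t \<le> 1"
  shows "takagi_fun \<alpha> (t / 2) = \<alpha> 0 * t / 2 + takagi_fun (\<lambda>m. \<alpha> (Suc m)) t"
  using takagi_split_head[OF assms(1), of "t / 2"] tent_left[of "t / 2"] assms by simp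

lemma takagi_right_half:
  assumes "summable (\<lambda>m. \<bar>\<alpha> m\<bar>)" "0 \<le> t" "t \<le> 1"
  shows "takagi_fun \<alpha> ((1 + t) / 2) = \<alpha> 0 * (1 - t) / 2 + takagi_fun (\<lambda>m. \<alpha> (Suc m)) t"
proof -
  have "tent ((1 + t) / 2) = 1 - (1 + t) / 2"
    by (rule tent_right) (use assms in auto)
  also have "\<dots> = (1 - t) / 2" by (simp add: field_simps)
  finally have "tent ((1 + t) / 2) = (1 - t) / 2" .
  moreover have "2 * ((1 + t) / 2) = t + 1" by simp
  ultimately show ?thesis
    using takagi_split_head[OF assms(1), of "(1 + t) / 2"] by (simp only: takagi_periodic)
qed

text \<open>The first \<open>p\<close> terms are affine on the block and \<open>B\<close> is their
  total slope, a value of the walk after \<open>p\<close> steps; the later terms see a scaled copy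
  of the unit interval. Only the size of \<open>B\<close> is recorded, because the limits do not
  depend on its value.\<close>

lemma takagi_on_dyadic_block:
  assumes "summable (\<lambda>m. \<bar>\<alpha> m\<bar>)" "i < 2 ^ p"
  shows "\<exists>A B. \<bar>B\<bar> \<le> (\<Sum>m<p. \<bar>\<alpha> m * 2 ^ m\<bar>) \<and>
     (\<forall>s\<in>{0..1}. takagi_fun \<alpha> ((real i + s) / 2 ^ p) = A + B / 2 ^ p * s + takagi_fun (\<lambda>m. \<alpha> (m + p)) s)"
  using assms
proof (induction p arbitrary: \<alpha> i)
  case 0
  then show ?case by (intro exI[of _ 0]) auto
next
  case (Suc p)
  have sm: "summable (\<lambda>m. \<bar>\<alpha> (Suc m)\<bar>)" using Suc.prems(1) by (subst summable_Suc_iff)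
  have sum: "(\<Sum>m<Suc p. \<bar>\<alpha> m * 2 ^ m\<bar>) = \<bar>\<alpha> 0\<bar> + 2 * (\<Sum>m<p. \<bar>\<alpha> (Suc m) * 2 ^ m\<bar>)"
    by (subst sum.lessThan_Suc_shift) (simp add: sum_distrib_left abs_mult algebra_simps)
  \<comment> \<open>\<open>j\<close> is \<open>i\<close> without its leading binary digit. The digit
    decides the half of the unit interval and the sign of \<open>\<alpha> 0\<close> in the slope;
    the factor 2 of \<open>B\<close> there comes from the doubled argument.\<close>
  define j where "j = (if i < 2 ^ p then i else i - 2 ^ p)"
  have j: "j < 2 ^ p" using Suc.prems(2) by (auto simp: j_def)
  obtain A B where AB: "\<bar>B\<bar> \<le> (\<Sum>m<p. \<bar>\<alpha> (Suc m) * 2 ^ m\<bar>)"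
    "\<And>s. s \<in> {0..1} \<Longrightarrow> takagi_fun (\<lambda>m. \<alpha> (Suc m)) ((real j + s) / 2 ^ p)
         = A + B / 2 ^ p * s + takagi_fun (\<lambda>m. \<alpha> (Suc (m + p))) s"
    using Suc.IH[OF sm j] by blast
  have jb: "0 \<le> (real j + s) / 2 ^ p \<and> (real j + s) / 2 ^ p \<le> 1" if "s \<in> {0..1}" for s
  proof -
    have "real j + 1 \<le> 2 ^ p" using j by (metis Suc_leI of_nat_Suc of_nat_le_iff of_nat_numeral of_nat_power add.commute)
    then show ?thesis using that by (auto simp: divide_le_eq)
  qed
  show ?case
  proof (cases "i < 2 ^ p")
    case True
    then have ij: "i = j" by (simp add: j_def)
    show ?thesis
    proof (intro exI conjI ballI)
      show "\<bar>2 * B + \<alpha> 0\<bar> \<le> (\<Sum>m<Suc p. \<bar>\<alpha> m * 2 ^ m\<bar>)" using AB(1) sum by linarith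
      fix s :: real assume s: "s \<in> {0..1}"
      have "takagi_fun \<alpha> ((real i + s) / 2 ^ Suc p) = takagi_fun \<alpha> ((real j + s) / 2 ^ p / 2)"
        by (simp add: ij mult.commute)
      also have "\<dots> = \<alpha> 0 * ((real j + s) / 2 ^ p) / 2 + (A + B / 2 ^ p * s + takagi_fun (\<lambda>m. \<alpha> (Suc (m + p))) s)"
        using takagi_left_half[OF Suc.prems(1), of "(real j + s) / 2 ^ p"] jb[OF s] AB(2)[OF s] by simp
      also have "\<dots> = (A + \<alpha> 0 * real j / 2 ^ Suc p) + (2 * B + \<alpha> 0) / 2 ^ Suc p * s + takagi_fun (\<lambda>m. \<alpha> (m + Suc p)) s"
        by (simp add: field_simps)
      finally show "takagi_fun \<alpha> ((real i + s) / 2 ^ Suc p) = \<dots>" .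
    qed
  next
    case False
    then have ij: "real i = 2 ^ p + real j" by (simp add: j_def of_nat_diff)
    show ?thesis
    proof (intro exI conjI ballI)
      show "\<bar>2 * B - \<alpha> 0\<bar> \<le> (\<Sum>m<Suc p. \<bar>\<alpha> m * 2 ^ m\<bar>)" using AB(1) sum by linarith
      fix s :: real assume s: "s \<in> {0..1}"
      have "takagi_fun \<alpha> ((real i + s) / 2 ^ Suc p) = takagi_fun \<alpha> ((1 + (real j + s) / 2 ^ p) / 2)"
        by (simp add: ij add_divide_distrib add.assoc mult.commute)
      also have "\<dots> = \<alpha> 0 * (1 - (real j + s) / 2 ^ p) / 2 + (A + B / 2 ^ p * s + takagi_fun (\<lambda>m. \<alpha> (Suc (m + p))) s)"
        using takagi_right_half[OF Suc.prems(1), of "(real j + s) / 2 ^ p"] jb[OF s] AB(2)[OF s] by simp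
      also have "\<dots> = (A + \<alpha> 0 / 2 - \<alpha> 0 * real j / 2 ^ Suc p) + (2 * B - \<alpha> 0) / 2 ^ Suc p * s + takagi_fun (\<lambda>m. \<alpha> (m + Suc p)) s"
        by (simp add: field_simps)
      finally show "takagi_fun \<alpha> ((real i + s) / 2 ^ Suc p) = \<dots>" .
    qed
  qed
qed

lemma sum_lessThan_mult_blocks:
  fixes h :: "nat \<Rightarrow> 'b::comm_monoid_add"
  shows "(\<Sum>k<j * c. h k) = (\<Sum>i<j. \<Sum>k<c. h (i * c + k))"
proof (induction j)
  case (Suc j)
  have "(\<Sum>k<Suc j * c. h k) = (\<Sum>k<j * c + c. h k)" by (simp add: add.commute)
  also have "(\<Sum>k<d + c. h k) = (\<Sum>k<d. h k) + (\<Sum>k<c. h (d + k))" for d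
    by (induction c) (simp_all add: add.assoc)
  finally show ?case using Suc by simp
qed simp

text \<open>Each half of the interval contributes the increments of the shifted function plus a
  constant with the sign of that half. The offset \<open>b\<close> collects these constants, which
  is why it belongs to the statement.\<close>

lemma sum_takagi_increments:
  assumes "summable (\<lambda>m. \<bar>\<alpha> m\<bar>)"
  shows "(\<Sum>k<2 ^ n. H (b / 2 ^ n + (takagi_fun \<alpha> (real (k + 1) / 2 ^ n) - takagi_fun \<alpha> (real k / 2 ^ n))))
     = 2 ^ n * walk_avg n (\<lambda>m. \<alpha> m * 2 ^ m) (\<lambda>y. H (y / 2 ^ n)) b"
  using assms
proof (induction n arbitrary: \<alpha> b)
  case 0
  \<comment> \<open>At level 0 the only increment vanishes by periodicity, so that the offset alone
    remains.\<close>
  have "takagi_fun \<alpha> 1 = takagi_fun \<alpha> 0" using takagi_periodic[of \<alpha> 0] by simp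
  then show ?case by simp
next
  case (Suc n)
  have sm: "summable (\<lambda>m. \<bar>\<alpha> (Suc m)\<bar>)" using Suc.prems by (subst summable_Suc_iff)
  define \<Delta> where "\<Delta> k = takagi_fun (\<lambda>m. \<alpha> (Suc m)) (real (k + 1) / 2 ^ n) - takagi_fun (\<lambda>m. \<alpha> (Suc m)) (real k / 2 ^ n)" for k
  define h where "h k = H (b / 2 ^ Suc n + (takagi_fun \<alpha> (real (k + 1) / 2 ^ Suc n) - takagi_fun \<alpha> (real k / 2 ^ Suc n)))" for k
  have rng: "0 \<le> real k / 2 ^ n \<and> real k / 2 ^ n \<le> 1 \<and> 0 \<le> real (k + 1) / 2 ^ n \<and> real (k + 1) / 2 ^ n \<le> 1"
    if "k < 2 ^ n" for k
  proof -
    have "real (k + 1) \<le> 2 ^ n" using that by (metis Suc_eq_plus1 Suc_leI of_nat_le_iff of_nat_numeral of_nat_power)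
    then show ?thesis using that by simp
  qed
  have L: "h k = H ((b + \<alpha> 0) / 2 / 2 ^ n + \<Delta> k)" if "k < 2 ^ n" for k
  proof -
    have "takagi_fun \<alpha> (real k / 2 ^ Suc n) = \<alpha> 0 * (real k / 2 ^ n) / 2 + takagi_fun (\<lambda>m. \<alpha> (Suc m)) (real k / 2 ^ n)"
      using takagi_left_half[OF Suc.prems, of "real k / 2 ^ n"] rng[OF that] by (simp add: mult.commute)
    moreover have "takagi_fun \<alpha> (real (k + 1) / 2 ^ Suc n) = \<alpha> 0 * (real (k + 1) / 2 ^ n) / 2 + takagi_fun (\<lambda>m. \<alpha> (Suc m)) (real (k + 1) / 2 ^ n)"
      using takagi_left_half[OF Suc.prems, of "real (k + 1) / 2 ^ n"] rng[OF that] by (simp add: mult.commute)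
    ultimately show ?thesis unfolding h_def \<Delta>_def
      by (intro arg_cong[where f = H]) (simp add: field_simps)
  qed
  have R: "h (2 ^ n + k) = H ((b - \<alpha> 0) / 2 / 2 ^ n + \<Delta> k)" if "k < 2 ^ n" for k
  proof -
    have e: "real (2 ^ n + l) / 2 ^ Suc n = (1 + real l / 2 ^ n) / 2" for l
      by (simp add: field_simps)
    have "takagi_fun \<alpha> (real (2 ^ n + k) / 2 ^ Suc n) = \<alpha> 0 * (1 - real k / 2 ^ n) / 2 + takagi_fun (\<lambda>m. \<alpha> (Suc m)) (real k / 2 ^ n)"
      unfolding e by (rule takagi_right_half[OF Suc.prems]) (use rng[OF that] in auto)
    moreover have "takagi_fun \<alpha> (real (2 ^ n + (k + 1)) / 2 ^ Suc n) = \<alpha> 0 * (1 - real (k + 1) / 2 ^ n) / 2 + takagi_fun (\<lambda>m. \<alpha> (Suc m)) (real (k + 1) / 2 ^ n)"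
      unfolding e by (rule takagi_right_half[OF Suc.prems]) (use rng[OF that] in auto)
    ultimately show ?thesis unfolding h_def \<Delta>_def add.assoc
      by (intro arg_cong[where f = H]) (simp add: field_simps)
  qed
  \<comment> \<open>The walk of the shifted function carries \<open>2 ^ m\<close> where the original
    one has \<open>2 ^ Suc m\<close>; scaling by 2 makes up for this and for the finer mesh at
    once.\<close>
  have sc: "walk_avg n (\<lambda>m. \<alpha> (Suc m) * 2 ^ m) (\<lambda>y. H (y / 2 ^ n)) (c / 2)
      = walk_avg n (\<lambda>m. \<alpha> (Suc m) * 2 ^ Suc m) (\<lambda>y. H (y / 2 ^ Suc n)) c" for c
    using walk_avg_scale[of n 2 "\<lambda>m. \<alpha> (Suc m) * 2 ^ m" "\<lambda>y. H (y / 2 ^ Suc n)" "c / 2"]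
    by (simp add: mult.left_commute)
  have "(\<Sum>k<2 ^ Suc n. h k) = (\<Sum>k<2 ^ n. h k) + (\<Sum>k<2 ^ n. h (2 ^ n + k))"
    using sum_lessThan_mult_blocks[of h 2 "2 ^ n"] by (simp add: numeral_2_eq_2)
  also have "\<dots> = (\<Sum>k<2 ^ n. H ((b + \<alpha> 0) / 2 / 2 ^ n + \<Delta> k)) + (\<Sum>k<2 ^ n. H ((b - \<alpha> 0) / 2 / 2 ^ n + \<Delta> k))"
    by (intro arg_cong2[where f = "(+)"] sum.cong) (use L R in auto)
  also have "\<dots> = 2 ^ Suc n * walk_avg (Suc n) (\<lambda>m. \<alpha> m * 2 ^ m) (\<lambda>y. H (y / 2 ^ Suc n)) b"
    unfolding \<Delta>_def Suc.IH[OF sm] sc by (simp add: distrib_left)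
  finally show ?case by (simp add: h_def)
qed

text \<open>\<open>B\<close> is chosen before \<open>n\<close> and \<open>H\<close>: it belongs to
  the block alone, so the mesh can be refined inside a fixed block while the start of the walk stays
  the same.\<close>

lemma sum_takagi_block_increments:
  assumes "summable (\<lambda>m. \<bar>\<alpha> m\<bar>)" "i < 2 ^ p"
  shows "\<exists>B. \<bar>B\<bar> \<le> (\<Sum>m<p. \<bar>\<alpha> m * 2 ^ m\<bar>) \<and> (\<forall>n H.
     (\<Sum>k<2 ^ n. H (takagi_fun \<alpha> (real (i * 2 ^ n + k + 1) / 2 ^ (p + n)) - takagi_fun \<alpha> (real (i * 2 ^ n + k) / 2 ^ (p + n))))
     = 2 ^ n * walk_avg n (\<lambda>m. \<alpha> (m + p) * 2 ^ (m + p)) (\<lambda>y. H (y / 2 ^ (p + n))) B)"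
proof -
  obtain A B where AB: "\<bar>B\<bar> \<le> (\<Sum>m<p. \<bar>\<alpha> m * 2 ^ m\<bar>)"
    "\<And>s. s \<in> {0..1} \<Longrightarrow> takagi_fun \<alpha> ((real i + s) / 2 ^ p) = A + B / 2 ^ p * s + takagi_fun (\<lambda>m. \<alpha> (m + p)) s"
    using takagi_on_dyadic_block[OF assms] by blast
  have sm: "summable (\<lambda>m. \<bar>\<alpha> (m + p)\<bar>)" using assms(1) by (subst summable_iff_shift)
  show ?thesis
  proof (intro exI[of _ B] conjI allI AB(1))
    fix n and H :: "real \<Rightarrow> real"
    define \<beta> where "\<beta> = (\<lambda>m. \<alpha> (m + p))"
    have e: "takagi_fun \<alpha> (real (i * 2 ^ n + l) / 2 ^ (p + n)) = A + B / 2 ^ p * (real l / 2 ^ n) + takagi_fun \<beta> (real l / 2 ^ n)"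
      if "l \<le> 2 ^ n" for l
    proof -
      have "real l \<le> 2 ^ n" using that by (metis of_nat_le_iff of_nat_numeral of_nat_power)
      then have "real l / 2 ^ n \<in> {0..1}" by simp
      moreover have "real (i * 2 ^ n + l) / 2 ^ (p + n) = (real i + real l / 2 ^ n) / 2 ^ p"
        by (simp add: power_add field_simps)
      ultimately show ?thesis using AB(2) by (simp add: \<beta>_def)
    qed
    have "(\<Sum>k<2 ^ n. H (takagi_fun \<alpha> (real (i * 2 ^ n + k + 1) / 2 ^ (p + n)) - takagi_fun \<alpha> (real (i * 2 ^ n + k) / 2 ^ (p + n))))
      = (\<Sum>k<2 ^ n. H (B / 2 ^ p / 2 ^ n + (takagi_fun \<beta> (real (k + 1) / 2 ^ n) - takagi_fun \<beta> (real k / 2 ^ n))))"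
    proof (intro sum.cong refl arg_cong[where f = H])
      fix k :: nat assume "k \<in> {..<2 ^ n}"
      then show "takagi_fun \<alpha> (real (i * 2 ^ n + k + 1) / 2 ^ (p + n)) - takagi_fun \<alpha> (real (i * 2 ^ n + k) / 2 ^ (p + n))
        = B / 2 ^ p / 2 ^ n + (takagi_fun \<beta> (real (k + 1) / 2 ^ n) - takagi_fun \<beta> (real k / 2 ^ n))"
        using e[of k] e[of "k + 1"] by (simp add: add.assoc field_simps)
    qed
    also have "\<dots> = 2 ^ n * walk_avg n (\<lambda>m. \<beta> m * 2 ^ m) (\<lambda>y. H (y / 2 ^ n)) (B / 2 ^ p)"
      by (rule sum_takagi_increments) (use sm in \<open>simp add: \<beta>_def\<close>)
    also have "walk_avg n (\<lambda>m. \<beta> m * 2 ^ m) (\<lambda>y. H (y / 2 ^ n)) (B / 2 ^ p)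
      = walk_avg n (\<lambda>m. \<alpha> (m + p) * 2 ^ (m + p)) (\<lambda>y. H (y / 2 ^ (p + n))) B"
      using walk_avg_scale[of n "2 ^ p" "\<lambda>m. \<beta> m * 2 ^ m" "\<lambda>y. H (y / 2 ^ (p + n))" "B / 2 ^ p"]
      by (simp add: \<beta>_def power_add mult_ac)
    finally show "(\<Sum>k<2 ^ n. H (takagi_fun \<alpha> (real (i * 2 ^ n + k + 1) / 2 ^ (p + n)) - takagi_fun \<alpha> (real (i * 2 ^ n + k) / 2 ^ (p + n))))
     = 2 ^ n * walk_avg n (\<lambda>m. \<alpha> (m + p) * 2 ^ (m + p)) (\<lambda>y. H (y / 2 ^ (p + n))) B" .
  qed
qed

section \<open>Walks on a probability space\<close>

locale rademacher = prob_space M for M :: "'w measure" +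
  fixes Y :: "nat \<Rightarrow> 'w \<Rightarrow> real"
  assumes signs: "iid_symmetric_signs M Y"
begin

lemma indep_Y: "indep_vars (\<lambda>_. borel) Y {1..}"
  using signs by (simp add: iid_symmetric_signs_def)

lemma sign_Y: "symmetric_sign M (Y (Suc m))"
  using signs by (simp add: iid_symmetric_signs_def)

lemma measurable_Y [measurable]: "Y (Suc m) \<in> borel_measurable M"
  using sign_Y by (simp add: symmetric_sign_def)

lemma prob_Y: "prob {\<omega> \<in> space M. Y (Suc m) \<omega> = 1} = 1 / 2" "prob {\<omega> \<in> space M. Y (Suc m) \<omega> = - 1} = 1 / 2"
  using sign_Y by (simp_all add: symmetric_sign_def)

lemma AE_Y: "AE \<omega> in M. \<forall>m. Y (Suc m) \<omega> = 1 \<or> Y (Suc m) \<omega> = - 1"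
proof (subst AE_all_countable, rule allI)
  fix m
  have "prob ({\<omega> \<in> space M. Y (Suc m) \<omega> = 1} \<union> {\<omega> \<in> space M. Y (Suc m) \<omega> = - 1}) =
      prob {\<omega> \<in> space M. Y (Suc m) \<omega> = 1} + prob {\<omega> \<in> space M. Y (Suc m) \<omega> = - 1}"
    by (rule finite_measure_Union) auto
  also have "\<dots> = 1" by (simp only: prob_Y)
  also have "{\<omega> \<in> space M. Y (Suc m) \<omega> = 1} \<union> {\<omega> \<in> space M. Y (Suc m) \<omega> = - 1}
     = {\<omega> \<in> space M. Y (Suc m) \<omega> = 1 \<or> Y (Suc m) \<omega> = - 1}" by auto
  finally show "AE \<omega> in M. Y (Suc m) \<omega> = 1 \<or> Y (Suc m) \<omega> = - 1"
    by (intro AE_I_eq_1) (auto simp: emeasure_eq_measure)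
qed

lemma indep_past:
  assumes "G \<in> borel_measurable (PiM {1..n} (\<lambda>_. borel))"
  shows "indep_var borel (Y (Suc n)) borel (\<lambda>\<omega>. G (restrict (\<lambda>i. Y i \<omega>) {1..n}))"
proof -
  have "indep_var borel ((\<lambda>f. f (Suc n)) \<circ> (\<lambda>\<omega>. restrict (\<lambda>i. Y i \<omega>) {Suc n}))
     borel (G \<circ> (\<lambda>\<omega>. restrict (\<lambda>i. Y i \<omega>) {1..n}))"
    by (rule indep_var_compose[OF indep_var_restrict[OF indep_Y]]) (use assms in auto)
  then show ?thesis by (simp add: comp_def)
qed

text \<open>Conditioning on the newest sign. \<open>F\<close> takes both the sign and the past
  position, so that the rule serves the free walk and also the stopped one, whose increment depends
  on the past.\<close>

lemma expectation_sign_step: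
  fixes X :: "'w \<Rightarrow> real" and F :: "real \<Rightarrow> real \<Rightarrow> real"
  assumes ind: "indep_var borel (Y (Suc n)) borel X"
    and F [measurable]: "F 1 \<in> borel_measurable borel" "F (- 1) \<in> borel_measurable borel"
      "(\<lambda>\<omega>. F (Y (Suc n) \<omega>) (X \<omega>)) \<in> borel_measurable M"
    and int: "integrable M (\<lambda>\<omega>. F 1 (X \<omega>))" "integrable M (\<lambda>\<omega>. F (- 1) (X \<omega>))"
  shows "integrable M (\<lambda>\<omega>. F (Y (Suc n) \<omega>) (X \<omega>))"
    and "(\<integral>\<omega>. F (Y (Suc n) \<omega>) (X \<omega>) \<partial>M) = ((\<integral>\<omega>. F 1 (X \<omega>) \<partial>M) + (\<integral>\<omega>. F (- 1) (X \<omega>) \<partial>M)) / 2"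
proof -
  have part: "integrable M (\<lambda>\<omega>. indicator {s} (Y (Suc n) \<omega>) * F s (X \<omega>))"
    "(\<integral>\<omega>. indicator {s} (Y (Suc n) \<omega>) * F s (X \<omega>) \<partial>M) = 1 / 2 * (\<integral>\<omega>. F s (X \<omega>) \<partial>M)"
    if s: "s = 1 \<or> s = - 1" for s
  proof -
    have [measurable]: "F s \<in> borel_measurable borel" using s F by auto
    have i: "indep_var borel (\<lambda>\<omega>. indicator {s} (Y (Suc n) \<omega>) :: real) borel (\<lambda>\<omega>. F s (X \<omega>))"
      using indep_var_compose[OF ind, of "indicator {s}" borel "F s" borel] by (simp add: comp_def)
    have i1: "integrable M (\<lambda>\<omega>. indicator {s} (Y (Suc n) \<omega>) :: real)"
      by (rule integrable_const_bound[where B = 1]) auto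
    have i2: "integrable M (\<lambda>\<omega>. F s (X \<omega>))" using s int by auto
    have "(\<integral>\<omega>. indicator {s} (Y (Suc n) \<omega>) \<partial>M) = (\<integral>\<omega>. indicator {\<omega>\<in>space M. Y (Suc n) \<omega> = s} \<omega> \<partial>M :: real)"
      by (intro Bochner_Integration.integral_cong) (auto simp: indicator_def)
    also have "\<dots> = 1 / 2" using s prob_Y[of n] by auto
    finally have e: "(\<integral>\<omega>. indicator {s} (Y (Suc n) \<omega>) \<partial>M) = (1 / 2 :: real)" .
    show "integrable M (\<lambda>\<omega>. indicator {s} (Y (Suc n) \<omega>) * F s (X \<omega>))"
      by (rule indep_var_integrable[OF i i1 i2])
    show "(\<integral>\<omega>. indicator {s} (Y (Suc n) \<omega>) * F s (X \<omega>) \<partial>M) = 1 / 2 * (\<integral>\<omega>. F s (X \<omega>) \<partial>M)"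
      unfolding indep_var_lebesgue_integral[OF i i1 i2] e ..
  qed
  \<comment> \<open>Almost surely the integrand is this sum of products of an indicator of the sign
    and a function of the past; independence applies to each product.\<close>
  define G where "G \<omega> = indicator {1} (Y (Suc n) \<omega>) * F 1 (X \<omega>) + indicator {- 1} (Y (Suc n) \<omega>) * F (- 1) (X \<omega>)" for \<omega>
  have G: "integrable M G" "integral\<^sup>L M G = ((\<integral>\<omega>. F 1 (X \<omega>) \<partial>M) + (\<integral>\<omega>. F (- 1) (X \<omega>) \<partial>M)) / 2"
    unfolding G_def using part[of 1] part[of "- 1"] by (simp_all)
  have ae: "AE \<omega> in M. F (Y (Suc n) \<omega>) (X \<omega>) = G \<omega>"
    using AE_Y by eventually_elim (auto simp: G_def dest: spec[of _ n])
  have [measurable]: "G \<in> borel_measurable M" using G(1) by auto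
  show "integrable M (\<lambda>\<omega>. F (Y (Suc n) \<omega>) (X \<omega>))"
    using G(1) by (subst integrable_cong_AE[OF _ _ ae]) auto
  show "(\<integral>\<omega>. F (Y (Suc n) \<omega>) (X \<omega>) \<partial>M) = ((\<integral>\<omega>. F 1 (X \<omega>) \<partial>M) + (\<integral>\<omega>. F (- 1) (X \<omega>) \<partial>M)) / 2"
    unfolding G(2)[symmetric] by (rule integral_cong_AE[OF _ _ ae]) auto
qed

text \<open>The bridge from sign averages to expectations. Integrability holds for every measurable
  \<open>H\<close>, since the walk takes finitely many values almost surely.\<close>

lemma expectation_walk:
  assumes H [measurable]: "H \<in> borel_measurable borel"
  shows "integrable M (\<lambda>\<omega>. H (x + (\<Sum>m<n. a m * Y (Suc m) \<omega>)))"
    and "(\<integral>\<omega>. H (x + (\<Sum>m<n. a m * Y (Suc m) \<omega>)) \<partial>M) = walk_avg n a H x"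
proof -
  have "integrable M (\<lambda>\<omega>. H (x + (\<Sum>m<n. a m * Y (Suc m) \<omega>))) \<and>
     (\<integral>\<omega>. H (x + (\<Sum>m<n. a m * Y (Suc m) \<omega>)) \<partial>M) = walk_avg n a H x"
  proof (induction n arbitrary: x)
    case 0
    show ?case by (simp add: prob_space)
  next
    case (Suc n)
    define G :: "(nat \<Rightarrow> real) \<Rightarrow> real" where "G y = (\<Sum>m<n. a m * y (Suc m))" for y
    define X where "X \<omega> = G (restrict (\<lambda>i. Y i \<omega>) {1..n})" for \<omega>
    have G: "G \<in> borel_measurable (PiM {1..n} (\<lambda>_. borel))"
      unfolding G_def by (intro borel_measurable_sum borel_measurable_times measurable_component_singleton) auto
    have X: "X \<omega> = (\<Sum>m<n. a m * Y (Suc m) \<omega>)" for \<omega>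
      by (auto simp: X_def G_def intro!: sum.cong)
    have ind: "indep_var borel (Y (Suc n)) borel X"
      unfolding X_def by (rule indep_past[OF G])
    have [measurable]: "X \<in> borel_measurable M" unfolding X[abs_def] by measurable
    define F where "F y z = H (x + a n * y + z)" for y z :: real
    have F: "F y \<in> borel_measurable borel" "(\<lambda>\<omega>. F (Y (Suc n) \<omega>) (X \<omega>)) \<in> borel_measurable M" for y
      unfolding F_def by measurable
    have i: "integrable M (\<lambda>\<omega>. F y (X \<omega>))" "(\<integral>\<omega>. F y (X \<omega>) \<partial>M) = walk_avg n a H (x + a n * y)" for y
      using Suc.IH[of "x + a n * y"] by (simp_all add: F_def X)
    note st = expectation_sign_step[OF ind F(1) F(1) F(2) i(1) i(1)]
    have e: "H (x + (\<Sum>m<Suc n. a m * Y (Suc m) \<omega>)) = F (Y (Suc n) \<omega>) (X \<omega>)" for \<omega>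
      by (simp add: F_def X add_ac)
    show ?case unfolding e using st by (simp add: i(2) walk_avg_snoc del: walk_avg.simps)
  qed
  then show "integrable M (\<lambda>\<omega>. H (x + (\<Sum>m<n. a m * Y (Suc m) \<omega>)))"
    and "(\<integral>\<omega>. H (x + (\<Sum>m<n. a m * Y (Suc m) \<omega>)) \<partial>M) = walk_avg n a H x" by auto
qed

end

section \<open>Almost sure and mean convergence of random sign series\<close>

text \<open>Kolmogorov's maximal inequality for the walk is Chebyshev's inequality for the
  walk frozen upon leaving the interval \<open>(-l, l)\<close>.\<close>

primrec stopped_walk :: "(nat \<Rightarrow> real) \<Rightarrow> real \<Rightarrow> nat \<Rightarrow> (nat \<Rightarrow> real) \<Rightarrow> real" where
  "stopped_walk a l 0 y = 0"
| "stopped_walk a l (Suc n) y =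
     stopped_walk a l n y + (if \<bar>stopped_walk a l n y\<bar> < l then a n * y (Suc n) else 0)"

lemma stopped_walk_exceeds:
  assumes "l > 0" "\<bar>\<Sum>m<k. a m * y (Suc m)\<bar> \<ge> l" "k \<le> n"
  shows "\<bar>stopped_walk a l n y\<bar> \<ge> l"
proof -
  \<comment> \<open>Invariant: either some partial sum has reached \<open>l\<close> and the walk is
    frozen outside, or none has and nothing has been frozen yet.\<close>
  have "(\<exists>k\<le>n. \<bar>\<Sum>m<k. a m * y (Suc m)\<bar> \<ge> l \<and> l \<le> \<bar>stopped_walk a l n y\<bar>) \<or>
     ((\<forall>k\<le>n. \<bar>\<Sum>m<k. a m * y (Suc m)\<bar> < l) \<and> stopped_walk a l n y = (\<Sum>m<n. a m * y (Suc m)))"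
  proof (induction n)
    case (Suc n)
    then show ?case
    proof (elim disjE exE conjE)
      fix k assume "k \<le> n" "l \<le> \<bar>\<Sum>m<k. a m * y (Suc m)\<bar>" "l \<le> \<bar>stopped_walk a l n y\<bar>"
      then show ?thesis by (intro disjI1 exI[of _ k]) auto
    next
      assume b: "\<forall>k\<le>n. \<bar>\<Sum>m<k. a m * y (Suc m)\<bar> < l" and e: "stopped_walk a l n y = (\<Sum>m<n. a m * y (Suc m))"
      then have s: "stopped_walk a l (Suc n) y = (\<Sum>m<Suc n. a m * y (Suc m))" by simp
      show ?thesis
      proof (cases "\<bar>\<Sum>m<Suc n. a m * y (Suc m)\<bar> < l")
        case True
        then show ?thesis using b s by (auto simp: le_Suc_eq simp del: sum.lessThan_Suc stopped_walk.simps)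
      next
        case False
        then show ?thesis using s by (intro disjI1 exI[of _ "Suc n"]) (auto simp del: sum.lessThan_Suc stopped_walk.simps)
      qed
    qed
  qed (use assms in auto)
  then show ?thesis using assms(2,3) by (meson not_le)
qed

lemma measurable_stopped_walk:
  "stopped_walk a l n \<in> borel_measurable (PiM {1..N} (\<lambda>_. borel))" if "n \<le> N"
  using that
proof (induction n)
  case (Suc n)
  then have [measurable]: "stopped_walk a l n \<in> borel_measurable (PiM {1..N} (\<lambda>_. borel))" by simp
  have [measurable]: "(\<lambda>y. y (Suc n)) \<in> borel_measurable (PiM {1..N} (\<lambda>_. borel::real measure))"
    by (rule measurable_component_singleton) (use Suc.prems in auto)
  have "(\<lambda>y. stopped_walk a l n y + (if \<bar>stopped_walk a l n y\<bar> < l then a n * y (Suc n) else 0))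
     \<in> borel_measurable (PiM {1..N} (\<lambda>_. borel))"
    by measurable
  then show ?case by (simp add: stopped_walk.simps(2)[abs_def])
qed (simp add: stopped_walk.simps(1)[abs_def])

lemma stopped_walk_restrict:
  "n \<le> N \<Longrightarrow> stopped_walk a l n (restrict y {1..N}) = stopped_walk a l n y"
  by (induction n) auto

context rademacher begin

lemma measurable_stopped_walk_Y [measurable]:
  "(\<lambda>\<omega>. stopped_walk a l n (\<lambda>i. Y i \<omega>)) \<in> borel_measurable M"
  by (induction n) (auto simp del: abs_real_def)

text \<open>Whether the walk is frozen depends on the past only, so the cross term averages out over
  the next sign, and a step adds \<open>(a n)\<^sup>2\<close> or 0 to the conditional second
  moment.\<close>

lemma expectation_stopped_walk:
  "integrable M (\<lambda>\<omega>. (stopped_walk a l n (\<lambda>i. Y i \<omega>))\<^sup>2) \<and>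
   (\<integral>\<omega>. (stopped_walk a l n (\<lambda>i. Y i \<omega>))\<^sup>2 \<partial>M) \<le> (\<Sum>m<n. (a m)\<^sup>2)"
proof (induction n)
  case (Suc n)
  define X where "X \<omega> = stopped_walk a l n (\<lambda>i. Y i \<omega>)" for \<omega>
  have X: "X \<omega> = stopped_walk a l n (restrict (\<lambda>i. Y i \<omega>) {1..n})" for \<omega>
    using stopped_walk_restrict[of n n] by (simp add: X_def)
  have ind: "indep_var borel (Y (Suc n)) borel X"
    unfolding X by (rule indep_past) (rule measurable_stopped_walk, simp)
  have [measurable]: "X \<in> borel_measurable M" unfolding X_def by measurable
  define F where "F y x = (x + (if \<bar>x\<bar> < l then a n * y else 0))\<^sup>2" for y x :: real
  have F: "F y \<in> borel_measurable borel" "(\<lambda>\<omega>. F (Y (Suc n) \<omega>) (X \<omega>)) \<in> borel_measurable M" for y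
    unfolding F_def by measurable
  have X2: "integrable M (\<lambda>\<omega>. (X \<omega>)\<^sup>2)" "(\<integral>\<omega>. (X \<omega>)\<^sup>2 \<partial>M) \<le> (\<Sum>m<n. (a m)\<^sup>2)"
    using Suc.IH by (simp_all add: X_def)
  \<comment> \<open>A crude bound, for integrability alone; the exact second moment comes from
    averaging the two signs.\<close>
  have bnd: "F y x \<le> 2 * x\<^sup>2 + 2 * (a n * y)\<^sup>2" for x y
    using sum_squares_bound[of x "a n * y"] by (auto simp: F_def power2_sum)
  have i: "integrable M (\<lambda>\<omega>. F y (X \<omega>))" for y
  proof (rule Bochner_Integration.integrable_bound)
    show "integrable M (\<lambda>\<omega>. 2 * (X \<omega>)\<^sup>2 + 2 * (a n * y)\<^sup>2)" using X2(1) by simp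
    show "AE \<omega> in M. norm (F y (X \<omega>)) \<le> norm (2 * (X \<omega>)\<^sup>2 + 2 * (a n * y)\<^sup>2)"
    proof (intro AE_I2)
      fix \<omega>
      have "0 \<le> F y (X \<omega>)" by (simp add: F_def)
      then show "norm (F y (X \<omega>)) \<le> norm (2 * (X \<omega>)\<^sup>2 + 2 * (a n * y)\<^sup>2)"
        using bnd[of y "X \<omega>"] by simp
    qed
    show "(\<lambda>\<omega>. F y (X \<omega>)) \<in> borel_measurable M" using F(1)[of y] by measurable
  qed
  note st = expectation_sign_step[OF ind F(1) F(1) F(2) i i]
  have "((\<integral>\<omega>. F 1 (X \<omega>) \<partial>M) + (\<integral>\<omega>. F (- 1) (X \<omega>) \<partial>M)) / 2 = (\<integral>\<omega>. (F 1 (X \<omega>) + F (- 1) (X \<omega>)) / 2 \<partial>M)"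
    using i by simp
  also have "\<dots> \<le> (\<integral>\<omega>. (X \<omega>)\<^sup>2 + (a n)\<^sup>2 \<partial>M)"
  proof (rule integral_mono)
    show "integrable M (\<lambda>\<omega>. (F 1 (X \<omega>) + F (- 1) (X \<omega>)) / 2)" using i by simp
    show "integrable M (\<lambda>\<omega>. (X \<omega>)\<^sup>2 + (a n)\<^sup>2)" using X2 by simp
    show "(F 1 (X \<omega>) + F (- 1) (X \<omega>)) / 2 \<le> (X \<omega>)\<^sup>2 + (a n)\<^sup>2" for \<omega>
      by (auto simp: F_def power2_eq_square algebra_simps)
  qed
  also have "\<dots> = (\<integral>\<omega>. (X \<omega>)\<^sup>2 \<partial>M) + (a n)\<^sup>2" using X2(1) by (simp add: prob_space)
  also have "\<dots> \<le> (\<Sum>m<Suc n. (a m)\<^sup>2)" using X2(2) by simp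
  finally have "((\<integral>\<omega>. F 1 (X \<omega>) \<partial>M) + (\<integral>\<omega>. F (- 1) (X \<omega>) \<partial>M)) / 2 \<le> (\<Sum>m<Suc n. (a m)\<^sup>2)" .
  moreover have "(stopped_walk a l (Suc n) (\<lambda>i. Y i \<omega>))\<^sup>2 = F (Y (Suc n) \<omega>) (X \<omega>)" for \<omega>
    by (simp add: F_def X_def)
  ultimately show ?case using st by (simp del: stopped_walk.simps sum.lessThan_Suc)
qed simp

lemma kolmogorov_maximal:
  assumes l: "l > 0" and "summable (\<lambda>m. (a m)\<^sup>2)"
  shows "prob {\<omega>\<in>space M. \<exists>k. l \<le> \<bar>\<Sum>m<k. a m * Y (Suc m) \<omega>\<bar>} \<le> (\<Sum>m. (a m)\<^sup>2) / l\<^sup>2"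
proof -
  define A where "A n = {\<omega>\<in>space M. \<exists>k\<le>n. l \<le> \<bar>\<Sum>m<k. a m * Y (Suc m) \<omega>\<bar>}" for n
  have [measurable]: "A n \<in> sets M" for n unfolding A_def by measurable
  have le: "prob (A n) \<le> (\<Sum>m. (a m)\<^sup>2) / l\<^sup>2" for n
  proof -
    define W where "W \<omega> = stopped_walk a l n (\<lambda>i. Y i \<omega>)" for \<omega>
    have [measurable]: "W \<in> borel_measurable M" unfolding W_def by measurable
    have W: "integrable M (\<lambda>\<omega>. (W \<omega>)\<^sup>2)" "(\<integral>\<omega>. (W \<omega>)\<^sup>2 \<partial>M) \<le> (\<Sum>m<n. (a m)\<^sup>2)"
      using expectation_stopped_walk by (auto simp: W_def)
    have "prob (A n) \<le> prob {\<omega>\<in>space M. l\<^sup>2 \<le> (W \<omega>)\<^sup>2}"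
    proof (rule finite_measure_mono)
      show "A n \<subseteq> {\<omega>\<in>space M. l\<^sup>2 \<le> (W \<omega>)\<^sup>2}"
        using stopped_walk_exceeds[OF l, of a _ _ n] l by (force simp: A_def W_def abs_le_square_iff[symmetric])
    qed measurable
    also have "\<dots> \<le> (\<integral>\<omega>. (W \<omega>)\<^sup>2 \<partial>M) / l\<^sup>2"
      by (rule integral_Markov_inequality_measure[OF W(1), of "{}"]) (use l in auto)
    also have "\<dots> \<le> (\<Sum>m. (a m)\<^sup>2) / l\<^sup>2"
      by (intro divide_right_mono order_trans[OF W(2)] sum_le_suminf assms) auto
    finally show ?thesis .
  qed
  \<comment> \<open>The bound is uniform in the horizon \<open>n\<close>, so continuity from below
    extends it to infinitely many partial sums.\<close>
  have "(\<lambda>n. prob (A n)) \<longlonglongrightarrow> prob (\<Union>n. A n)"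
    by (rule finite_Lim_measure_incseq) (auto simp: incseq_def A_def intro: order_trans)
  then have "prob (\<Union>n. A n) \<le> (\<Sum>m. (a m)\<^sup>2) / l\<^sup>2"
    by (rule LIMSEQ_le_const2) (use le in auto)
  moreover have "(\<Union>n. A n) = {\<omega>\<in>space M. \<exists>k. l \<le> \<bar>\<Sum>m<k. a m * Y (Suc m) \<omega>\<bar>}"
    by (auto simp: A_def)
  ultimately show ?thesis by simp
qed

text \<open>The maximal inequality for the tail after \<open>N\<close> bounds the probability that
  oscillations of size \<open>l\<close> never cease by a tail of a convergent series. This
  probability is therefore zero, and the partial sums are almost surely Cauchy.\<close>

lemma AE_summable_signs:
  assumes sm: "summable (\<lambda>m. (a m)\<^sup>2)"
  shows "AE \<omega> in M. summable (\<lambda>m. a m * Y (Suc m) \<omega>)"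
proof -
  define S where "S \<omega> k = (\<Sum>m<k. a m * Y (Suc m) \<omega>)" for \<omega> k
  have [measurable]: "(\<lambda>\<omega>. S \<omega> k) \<in> borel_measurable M" for k unfolding S_def by measurable
  have key: "AE \<omega> in M. \<exists>N. \<forall>k\<ge>N. \<bar>S \<omega> k - S \<omega> N\<bar> < l" if l: "l > 0" for l :: real
  proof -
    define B where "B = {\<omega>\<in>space M. \<forall>N. \<exists>k\<ge>N. l \<le> \<bar>S \<omega> k - S \<omega> N\<bar>}"
    have [measurable]: "B \<in> sets M" unfolding B_def by measurable
    have "prob B \<le> (\<Sum>m. (a (m + N))\<^sup>2) / l\<^sup>2" for N
    proof -
      \<comment> \<open>Zeroing the coefficients before \<open>N\<close> turns the partial sums into
        those of the tail and keeps the indices of the signs.\<close>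
      define b where "b m = (if m < N then 0 else a m)" for m
      have bs: "summable (\<lambda>m. (b m)\<^sup>2)"
        by (rule summable_comparison_test'[OF sm]) (auto simp: b_def)
      have "(\<Sum>m. (b m)\<^sup>2) = (\<Sum>m. (b (m + N))\<^sup>2) + (\<Sum>m<N. (b m)\<^sup>2)"
        by (rule suminf_split_initial_segment[OF bs])
      also have "\<dots> = (\<Sum>m. (a (m + N))\<^sup>2)" by (simp add: b_def)
      finally have be: "(\<Sum>m. (b m)\<^sup>2) = (\<Sum>m. (a (m + N))\<^sup>2)" .
      have bd: "(\<Sum>m<k. b m * Y (Suc m) \<omega>) = S \<omega> k - S \<omega> N" if "k \<ge> N" for k \<omega>
      proof -
        have "(\<Sum>m<k. b m * Y (Suc m) \<omega>) = (\<Sum>m\<in>{N..<k}. a m * Y (Suc m) \<omega>)"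
          by (rule sum.mono_neutral_cong_right) (auto simp: b_def)
        also have "\<dots> = S \<omega> k - S \<omega> N"
          using that by (simp add: S_def lessThan_atLeast0 sum_diff_nat_ivl)
        finally show ?thesis .
      qed
      have "prob B \<le> prob {\<omega>\<in>space M. \<exists>k. l \<le> \<bar>\<Sum>m<k. b m * Y (Suc m) \<omega>\<bar>}"
      proof (rule finite_measure_mono)
        show "B \<subseteq> {\<omega>\<in>space M. \<exists>k. l \<le> \<bar>\<Sum>m<k. b m * Y (Suc m) \<omega>\<bar>}"
        proof
          fix \<omega> assume "\<omega> \<in> B"
          then obtain k where "\<omega> \<in> space M" "k \<ge> N" "l \<le> \<bar>S \<omega> k - S \<omega> N\<bar>" by (auto simp: B_def)
          then show "\<omega> \<in> {\<omega>\<in>space M. \<exists>k. l \<le> \<bar>\<Sum>m<k. b m * Y (Suc m) \<omega>\<bar>}"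
            using bd[of k \<omega>] by (auto intro!: exI[of _ k])
        qed
      qed measurable
      also have "\<dots> \<le> (\<Sum>m. (b m)\<^sup>2) / l\<^sup>2" by (rule kolmogorov_maximal[OF l bs])
      finally show ?thesis by (simp add: be)
    qed
    moreover have "(\<lambda>N. (\<Sum>m. (a (m + N))\<^sup>2) / l\<^sup>2) \<longlonglongrightarrow> 0 / l\<^sup>2"
      by (intro tendsto_divide suminf_exist_split2[OF sm] tendsto_const) (use l in auto)
    ultimately have "prob B \<le> 0 / l\<^sup>2"
      by (intro LIMSEQ_le_const) auto
    then have "prob B = 0" by (simp add: measure_le_0_iff)
    then have "AE \<omega> in M. \<omega> \<notin> B"
      by (intro AE_not_in null_setsI) (auto simp: emeasure_eq_measure)
    then show ?thesis
      using AE_space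
    proof eventually_elim
      case (elim \<omega>)
      then obtain N where "\<And>k. k \<ge> N \<Longrightarrow> \<not> l \<le> \<bar>S \<omega> k - S \<omega> N\<bar>" unfolding B_def by blast
      then show ?case by (intro exI[of _ N]) (auto simp: not_le)
    qed
  qed
  \<comment> \<open>Countably many thresholds \<open>1 / Suc i\<close> suffice, and for these
    \<open>AE\<close> commutes with the universal quantifier.\<close>
  have "AE \<omega> in M. \<forall>i. \<exists>N. \<forall>k\<ge>N. \<bar>S \<omega> k - S \<omega> N\<bar> < 1 / real (Suc i)"
    by (subst AE_all_countable) (auto intro!: key)
  then show ?thesis
  proof eventually_elim
    case (elim \<omega>)
    have "Cauchy (S \<omega>)"
    proof (rule metric_CauchyI)
      fix e :: real assume "e > 0"
      then obtain i where i: "1 / real (Suc i) < e / 2"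
        using nat_approx_posE[of "e / 2"] by auto
      obtain N where N: "\<And>k. k \<ge> N \<Longrightarrow> \<bar>S \<omega> k - S \<omega> N\<bar> < 1 / real (Suc i)" using elim by blast
      show "\<exists>N. \<forall>m\<ge>N. \<forall>n\<ge>N. dist (S \<omega> m) (S \<omega> n) < e"
      proof (intro exI allI impI)
        fix m n assume "m \<ge> N" "n \<ge> N"
        then show "dist (S \<omega> m) (S \<omega> n) < e"
          using N[of m] N[of n] i unfolding dist_real_def by linarith
      qed
    qed
    then show ?case by (simp add: summable_iff_convergent S_def[abs_def] Cauchy_convergent_iff)
  qed
qed

text \<open>The partial sums converge in mean square and hence in mean; almost sure convergence and
  Fatou's lemma identify the limit with the pointwise series.\<close>

lemma expectation_series_signs:
  assumes sm: "summable (\<lambda>m. (a m)\<^sup>2)"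
  shows "integrable M (\<lambda>\<omega>. \<bar>\<Sum>m. a m * Y (Suc m) \<omega>\<bar>)"
    and "(\<lambda>n. walk_avg n a (\<lambda>y. \<bar>y\<bar>) 0) \<longlonglongrightarrow> (\<integral>\<omega>. \<bar>\<Sum>m. a m * Y (Suc m) \<omega>\<bar> \<partial>M)"
proof -
  define S where "S \<omega> k = (\<Sum>m<k. a m * Y (Suc m) \<omega>)" for \<omega> k
  define Z where "Z \<omega> = (\<Sum>m. a m * Y (Suc m) \<omega>)" for \<omega>
  define T where "T n = (\<Sum>m. (a (m + n))\<^sup>2)" for n
  have [measurable]: "(\<lambda>\<omega>. S \<omega> k) \<in> borel_measurable M" for k unfolding S_def by measurable
  have [measurable]: "Z \<in> borel_measurable M" unfolding Z_def by measurable
  have T0: "T \<longlonglongrightarrow> 0" unfolding T_def by (rule suminf_exist_split2[OF sm])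
  have Tn: "T n \<ge> 0" for n unfolding T_def
    by (rule suminf_nonneg) (use sm in \<open>auto simp: summable_iff_shift[of "\<lambda>m. (a m)\<^sup>2"]\<close>)
  have SS: "(\<integral>\<^sup>+\<omega>. ennreal ((S \<omega> k - S \<omega> n)\<^sup>2) \<partial>M) \<le> ennreal (T n)" if "k \<ge> n" for k n
  proof -
    define b where "b m = (if m < n then 0 else a m)" for m
    have bd: "(\<Sum>m<k. b m * Y (Suc m) \<omega>) = S \<omega> k - S \<omega> n" for \<omega>
    proof -
      have "(\<Sum>m<k. b m * Y (Suc m) \<omega>) = (\<Sum>m\<in>{n..<k}. a m * Y (Suc m) \<omega>)"
        by (rule sum.mono_neutral_cong_right) (auto simp: b_def)
      also have "\<dots> = S \<omega> k - S \<omega> n"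
        using that by (simp add: S_def lessThan_atLeast0 sum_diff_nat_ivl)
      finally show ?thesis .
    qed
    have w: "integrable M (\<lambda>\<omega>. (S \<omega> k - S \<omega> n)\<^sup>2)" "(\<integral>\<omega>. (S \<omega> k - S \<omega> n)\<^sup>2 \<partial>M) = (\<Sum>m<k. (b m)\<^sup>2)"
      using expectation_walk[of "\<lambda>y. y\<^sup>2" 0 b k] by (simp_all add: bd walk_avg_square)
    have "(\<Sum>m<k. (b m)\<^sup>2) = (\<Sum>m\<in>{n..<k}. (a m)\<^sup>2)"
      by (rule sum.mono_neutral_cong_right) (auto simp: b_def)
    also have "\<dots> = (\<Sum>m<k - n. (a (m + n))\<^sup>2)"
      using sum.shift_bounds_nat_ivl[of "\<lambda>m. (a m)\<^sup>2" 0 n "k - n"] that by (simp add: lessThan_atLeast0)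
    also have "\<dots> \<le> T n" unfolding T_def
      by (rule sum_le_suminf) (use sm in \<open>auto simp: summable_iff_shift[of "\<lambda>m. (a m)\<^sup>2"]\<close>)
    finally have "(\<Sum>m<k. (b m)\<^sup>2) \<le> T n" .
    then show ?thesis
      by (subst nn_integral_eq_integral[OF w(1)]) (auto simp: w(2) intro: ennreal_leI)
  qed
  \<comment> \<open>Fatou's lemma in \<open>k\<close> carries the bound on the differences of
    partial sums over to the limit \<open>Z\<close>.\<close>
  have ZS: "(\<integral>\<^sup>+\<omega>. ennreal ((Z \<omega> - S \<omega> n)\<^sup>2) \<partial>M) \<le> ennreal (T n)" for n
  proof -
    have "AE \<omega> in M. ennreal ((Z \<omega> - S \<omega> n)\<^sup>2) = liminf (\<lambda>k. ennreal ((S \<omega> k - S \<omega> n)\<^sup>2))"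
      using AE_summable_signs[OF sm]
    proof eventually_elim
      case (elim \<omega>)
      then have "S \<omega> \<longlonglongrightarrow> Z \<omega>" unfolding S_def Z_def by (rule summable_LIMSEQ)
      then have "(\<lambda>k. ennreal ((S \<omega> k - S \<omega> n)\<^sup>2)) \<longlonglongrightarrow> ennreal ((Z \<omega> - S \<omega> n)\<^sup>2)"
        by (intro tendsto_intros)
      then show ?case by (intro lim_imp_Liminf[symmetric]) auto
    qed
    then have "(\<integral>\<^sup>+\<omega>. ennreal ((Z \<omega> - S \<omega> n)\<^sup>2) \<partial>M) = (\<integral>\<^sup>+\<omega>. liminf (\<lambda>k. ennreal ((S \<omega> k - S \<omega> n)\<^sup>2)) \<partial>M)"
      by (rule nn_integral_cong_AE)
    also have "\<dots> \<le> liminf (\<lambda>k. \<integral>\<^sup>+\<omega>. ennreal ((S \<omega> k - S \<omega> n)\<^sup>2) \<partial>M)"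
      by (rule nn_integral_liminf) measurable
    also have "\<dots> \<le> ennreal (T n)"
    proof (rule Liminf_le)
      show "\<forall>\<^sub>F k in sequentially. (\<integral>\<^sup>+\<omega>. ennreal ((S \<omega> k - S \<omega> n)\<^sup>2) \<partial>M) \<le> ennreal (T n)"
        using eventually_ge_at_top[of n] by eventually_elim (rule SS)
    qed simp
    finally show ?thesis .
  qed
  have D2: "integrable M (\<lambda>\<omega>. (Z \<omega> - S \<omega> n)\<^sup>2)" for n
    by (rule integrableI_bounded) (use ZS[of n] in \<open>auto simp: le_less_trans[OF _ ennreal_less_top]\<close>)
  have D2e: "(\<integral>\<omega>. (Z \<omega> - S \<omega> n)\<^sup>2 \<partial>M) \<le> T n" for n
    using ZS[of n] by (subst (asm) nn_integral_eq_integral[OF D2]) (auto simp: Tn)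
  \<comment> \<open>Takes the place of the Cauchy-Schwarz inequality: \<open>\<eta>\<close> will be
    tuned to the size of the mean square.\<close>
  have ab: "\<bar>x\<bar> \<le> \<eta> + x\<^sup>2 / \<eta>" if "\<eta> > 0" for x \<eta> :: real
  proof (cases "\<bar>x\<bar> \<le> \<eta>")
    case True
    then show ?thesis using that by (smt (verit) divide_nonneg_pos zero_le_power2)
  next
    case False
    then have "\<eta> * \<bar>x\<bar> \<le> \<bar>x\<bar> * \<bar>x\<bar>" by (intro mult_right_mono) auto
    then have "\<bar>x\<bar> \<le> x\<^sup>2 / \<eta>" using that by (simp add: le_divide_eq mult.commute power2_eq_square)
    then show ?thesis using that by linarith
  qed
  have D1: "integrable M (\<lambda>\<omega>. Z \<omega> - S \<omega> n)" for n
  proof (rule Bochner_Integration.integrable_bound)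
    show "integrable M (\<lambda>\<omega>. 1 + (Z \<omega> - S \<omega> n)\<^sup>2)" using D2 by simp
    show "AE \<omega> in M. norm (Z \<omega> - S \<omega> n) \<le> norm (1 + (Z \<omega> - S \<omega> n)\<^sup>2)"
      using ab[of 1] by (auto intro!: AE_I2 simp: abs_of_nonneg[OF add_nonneg_nonneg])
  qed measurable
  have S1: "integrable M (\<lambda>\<omega>. S \<omega> n)" for n
    using expectation_walk(1)[of "\<lambda>y. y" 0 a n] by (simp add: S_def)
  have Z1: "integrable M Z" using D1[of 0] by (simp add: S_def)
  show "integrable M (\<lambda>\<omega>. \<bar>\<Sum>m. a m * Y (Suc m) \<omega>\<bar>)" using integrable_abs[OF Z1] by (simp only: Z_def)
  have "(\<lambda>n. \<integral>\<omega>. \<bar>S \<omega> n\<bar> \<partial>M) \<longlonglongrightarrow> (\<integral>\<omega>. \<bar>Z \<omega>\<bar> \<partial>M)"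
  proof (rule LIMSEQ_I)
    fix e :: real assume e: "e > 0"
    \<comment> \<open>The error will be at most
      \<open>\<eta> + \<eta>\<^sup>2 / \<eta> = 2 / 3 * e\<close>.\<close>
    define \<eta> where "\<eta> = e / 3"
    have \<eta>: "\<eta> > 0" using e by (simp add: \<eta>_def)
    have "\<forall>\<^sub>F n in sequentially. T n < \<eta>\<^sup>2"
      using T0 \<eta> by (intro order_tendstoD) auto
    then obtain N where N: "\<And>n. n \<ge> N \<Longrightarrow> T n < \<eta>\<^sup>2" by (auto simp: eventually_sequentially)
    have "norm ((\<integral>\<omega>. \<bar>S \<omega> n\<bar> \<partial>M) - (\<integral>\<omega>. \<bar>Z \<omega>\<bar> \<partial>M)) < e" if "n \<ge> N" for n
    proof -
      have "norm ((\<integral>\<omega>. \<bar>S \<omega> n\<bar> \<partial>M) - (\<integral>\<omega>. \<bar>Z \<omega>\<bar> \<partial>M)) = norm (\<integral>\<omega>. \<bar>S \<omega> n\<bar> - \<bar>Z \<omega>\<bar> \<partial>M)"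
        using S1 Z1 by simp
      also have "\<dots> \<le> (\<integral>\<omega>. norm (\<bar>S \<omega> n\<bar> - \<bar>Z \<omega>\<bar>) \<partial>M)" by (rule integral_norm_bound)
      also have "\<dots> \<le> (\<integral>\<omega>. \<eta> + (Z \<omega> - S \<omega> n)\<^sup>2 / \<eta> \<partial>M)"
      proof (rule integral_mono)
        show "integrable M (\<lambda>\<omega>. norm (\<bar>S \<omega> n\<bar> - \<bar>Z \<omega>\<bar>))" using S1 Z1 by simp
        show "integrable M (\<lambda>\<omega>. \<eta> + (Z \<omega> - S \<omega> n)\<^sup>2 / \<eta>)" using D2 by simp
        show "norm (\<bar>S \<omega> n\<bar> - \<bar>Z \<omega>\<bar>) \<le> \<eta> + (Z \<omega> - S \<omega> n)\<^sup>2 / \<eta>" for \<omega>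
          using ab[OF \<eta>, of "Z \<omega> - S \<omega> n"] unfolding real_norm_def by linarith
      qed
      also have "\<dots> = \<eta> + (\<integral>\<omega>. (Z \<omega> - S \<omega> n)\<^sup>2 \<partial>M) / \<eta>" using D2 by (simp add: prob_space)
      also have "\<dots> \<le> \<eta> + \<eta>\<^sup>2 / \<eta>"
        using D2e[of n] N[OF that] \<eta> by (intro add_left_mono divide_right_mono) auto
      also have "\<dots> < e" using \<eta> by (simp add: power2_eq_square \<eta>_def)
      finally show ?thesis .
    qed
    then show "\<exists>N. \<forall>n\<ge>N. norm ((\<integral>\<omega>. \<bar>S \<omega> n\<bar> \<partial>M) - (\<integral>\<omega>. \<bar>Z \<omega>\<bar> \<partial>M)) < e" by blast
  qed
  moreover have "(\<integral>\<omega>. \<bar>S \<omega> n\<bar> \<partial>M) = walk_avg n a (\<lambda>y. \<bar>y\<bar>) 0" for n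
    using expectation_walk(2)[of "\<lambda>y. \<bar>y\<bar>" 0 a n] by (simp add: S_def)
  ultimately show "(\<lambda>n. walk_avg n a (\<lambda>y. \<bar>y\<bar>) 0) \<longlonglongrightarrow> (\<integral>\<omega>. \<bar>\<Sum>m. a m * Y (Suc m) \<omega>\<bar> \<partial>M)"
    by (simp add: Z_def)
qed

end

section \<open>Regularly varying functions\<close>

text \<open>The logarithm of the slowly varying factor \<open>g x / x powr \<rho>\<close>.\<close>

definition log_defect :: "(real \<Rightarrow> real) \<Rightarrow> real \<Rightarrow> real \<Rightarrow> real" where
  "log_defect g \<rho> x = ln (g x) - \<rho> * ln x"

lemma log_defect_pointwise:
  assumes "regularly_varying g \<rho>" "l > 0"
  shows "((\<lambda>x. log_defect g \<rho> (l * x) - log_defect g \<rho> x) \<longlongrightarrow> 0) at_top"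
proof -
  have pos: "g x > 0" if "x \<ge> 0" for x using assms(1) that by (simp add: regularly_varying_def)
  have "((\<lambda>x. g (l * x) / g x) \<longlongrightarrow> l powr \<rho>) at_top"
    using assms by (simp add: regularly_varying_def)
  then have "((\<lambda>x. ln (g (l * x) / g x) - \<rho> * ln l) \<longlongrightarrow> ln (l powr \<rho>) - \<rho> * ln l) at_top"
    using assms(2) by (intro tendsto_intros) auto
  moreover have "\<forall>\<^sub>F x in at_top. ln (g (l * x) / g x) - \<rho> * ln l = log_defect g \<rho> (l * x) - log_defect g \<rho> x"
    using eventually_gt_at_top[of 0]
  proof eventually_elim
    case (elim x)
    have "g (l * x) > 0" "g x > 0" using elim assms(2) by (auto intro: pos)
    then show ?case
      using elim assms(2) by (simp add: log_defect_def ln_div ln_mult algebra_simps)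
  qed
  ultimately show ?thesis using assms(2) by (simp add: tendsto_cong ln_powr)
qed

text \<open>\<open>g\<close> is measurable on the half-line only, hence the extension by zero;
  dilations preserve Lebesgue measurability. The range \<open>{1..3}\<close> leaves room for a
  dilation by up to 2 in the covering argument.\<close>

lemma log_defect_measurable:
  assumes "regularly_varying g \<rho>" "x > 0"
  shows "{l\<in>{1..3}. e \<le> \<bar>log_defect g \<rho> (l * x) - c\<bar>} \<in> sets lebesgue"
proof -
  define h where "h t = (if t \<in> {0..} then g t else 0)" for t
  have [measurable]: "h \<in> borel_measurable lebesgue"
    using assms(1) borel_measurable_if[of "{0..}" g] by (simp add: regularly_varying_def h_def[abs_def])
  have [measurable]: "(\<lambda>l. x * l) \<in> lebesgue \<rightarrow>\<^sub>M (lebesgue :: real measure)"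
    using lebesgue_measurable_scaling[of x, where 'a = real] by (simp add: scaleR_conv_of_real[abs_def] real_scaleR_def[abs_def])
  have [measurable]: "(\<lambda>l. h (x * l)) \<in> borel_measurable lebesgue"
    by measurable
  have [measurable]: "(\<lambda>l::real. l) \<in> borel_measurable lebesgue"
    by (rule measurable_completion) simp
  have "{l\<in>space lebesgue. l \<in> {1..3} \<and> e \<le> \<bar>ln (h (x * l)) - \<rho> * ln (l * x) - c\<bar>} \<in> sets lebesgue"
    by measurable
  also have "{l\<in>space lebesgue. l \<in> {1..3} \<and> e \<le> \<bar>ln (h (x * l)) - \<rho> * ln (l * x) - c\<bar>}
     = {l\<in>{1..3}. e \<le> \<bar>log_defect g \<rho> (l * x) - c\<bar>}"
    using assms(2) by (auto simp: h_def log_defect_def mult.commute)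
  finally show ?thesis .
qed

text \<open>Steinhaus-type argument: the exceptional sets for \<open>x\<close> and \<open>s x\<close> are both small,
  so some common multiple \<open>l x = (l / s) (s x)\<close> avoids them.\<close>

lemma log_defect_uniform:
  assumes rv: "regularly_varying g \<rho>" and e: "e > 0"
  shows "\<exists>X>0. \<forall>x\<ge>X. \<forall>s\<in>{1..2}. \<bar>log_defect g \<rho> (s * x) - log_defect g \<rho> x\<bar> < e"
proof -
  define G where "G = log_defect g \<rho>"
  define E where "E x = {l\<in>{1..3::real}. e / 2 \<le> \<bar>G (l * x) - G x\<bar>}" for x
  have Em: "E x \<in> sets lebesgue" if "x > 0" for x
    unfolding E_def G_def by (rule log_defect_measurable[OF rv that])
  have El: "E x \<in> lmeasurable" if "x > 0" for x
  proof (rule bounded_set_imp_lmeasurable[OF _ Em[OF that]])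
    show "bounded (E x)" by (rule bounded_subset[of "{1..3}"]) (auto simp: E_def)
  qed
  \<comment> \<open>Each fixed \<open>l\<close> eventually leaves \<open>E x\<close> by regular
    variation; dominated convergence turns this into measures of \<open>E x\<close> that tend to
    0.\<close>
  define f where "f x l = (if x > 0 then indicator (E x) l else 0 :: real)" for x l
  have "((\<lambda>x. integral\<^sup>L lebesgue (f x)) \<longlongrightarrow> integral\<^sup>L lebesgue (\<lambda>l::real. 0 :: real)) at_top"
  proof (rule integral_dominated_convergence_at_top[where w = "indicator {1..3}"])
    show "f x \<in> borel_measurable lebesgue" for x
      using Em[of x] by (cases "x > 0") (auto simp: f_def[abs_def])
    show "AE l in lebesgue. ((\<lambda>x. f x l) \<longlongrightarrow> 0) at_top"
    proof (rule AE_I2)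
      fix l :: real
      have "\<forall>\<^sub>F x in at_top. f x l = 0"
      proof (cases "l \<in> {1..3}")
        case True
        then have "((\<lambda>x. G (l * x) - G x) \<longlongrightarrow> 0) at_top"
          unfolding G_def by (intro log_defect_pointwise[OF rv]) auto
        then have "\<forall>\<^sub>F x in at_top. dist (G (l * x) - G x) 0 < e / 2"
          using e by (intro tendstoD) auto
        then show ?thesis by eventually_elim (auto simp: f_def E_def)
      qed (auto simp: f_def E_def)
      then show "((\<lambda>x. f x l) \<longlongrightarrow> 0) at_top" by (rule tendsto_eventually)
    qed
    show "\<forall>\<^sub>F x in at_top. AE l in lebesgue. norm (f x l) \<le> indicator {1..3} l"
      by (intro always_eventually allI AE_I2) (auto simp: f_def E_def indicator_def)
  qed (auto simp: integrable_completion)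
  then have "((\<lambda>x. integral\<^sup>L lebesgue (f x)) \<longlongrightarrow> 0) at_top" by simp
  \<comment> \<open>With the bound 1/3 at both points, the second set stretched by
    \<open>s \<le> 2\<close> has measure below 2/3, so the two cannot cover \<open>{s..3}\<close>,
    whose length is at least 1.\<close>
  then have "\<forall>\<^sub>F x in at_top. dist (integral\<^sup>L lebesgue (f x)) 0 < 1 / 3"
    by (intro tendstoD) auto
  then have "\<forall>\<^sub>F x in at_top. x > 0 \<and> measure lebesgue (E x) < 1 / 3"
    using eventually_gt_at_top[of 0]
    by eventually_elim (use Em in \<open>auto simp: f_def[abs_def]\<close>)
  then obtain X where X: "\<And>x. x \<ge> X \<Longrightarrow> x > 0 \<and> measure lebesgue (E x) < 1 / 3"
    by (auto simp: eventually_at_top_linorder)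
  show ?thesis
  proof (intro exI[of _ X] conjI allI impI ballI)
    show "X > 0" using X by blast
    fix x s :: real assume x: "x \<ge> X" and s: "s \<in> {1..2}"
    have x0: "x > 0" using X x by blast
    have sx: "s * x \<ge> X" using x x0 s by (auto intro: order_trans[OF x] simp: mult_le_cancel_right1)
    define F where "F = (\<lambda>l. s *\<^sub>R l) ` E (s * x)"
    have "F = (\<lambda>l. (1 / s) *\<^sub>R l) -` E (s * x) \<inter> space lebesgue"
      using s by (auto simp: F_def image_iff intro!: bexI[of _ "l / s" for l])
    also have "\<dots> \<in> sets lebesgue"
      by (rule measurable_sets[OF lebesgue_measurable_scaling]) (use Em X sx in auto)
    finally have Fm: "F \<in> sets lebesgue" .
    have "F \<in> lmeasurable"
    proof (rule bounded_set_imp_lmeasurable[OF _ Fm])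
      show "bounded F" unfolding F_def by (rule bounded_scaling, rule bounded_subset[of "{1..3}"]) (auto simp: E_def)
    qed
    have "F = (\<lambda>l. s *\<^sub>R l + 0) ` E (s * x)" by (simp add: F_def)
    then have "measure lebesgue F = s * measure lebesgue (E (s * x))"
      using measure_lebesgue_affine[of s 0 "E (s * x)"] s by simp
    also have "\<dots> \<le> 2 * measure lebesgue (E (s * x))" using s by (intro mult_right_mono) auto
    also have "\<dots> < 2 / 3" using X[OF sx] by simp
    finally have Fs: "measure lebesgue F < 2 / 3" .
    have "\<exists>l\<in>{s..3}. l \<notin> E x \<and> l \<notin> F"
    proof (rule ccontr)
      assume "\<not> ?thesis"
      then have "{s..3} \<subseteq> E x \<union> F" by auto
      then have "measure lebesgue {s..3} \<le> measure lebesgue (E x \<union> F)"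
        using El[OF x0] \<open>F \<in> lmeasurable\<close> by (intro measure_mono_fmeasurable) auto
      also have "\<dots> \<le> measure lebesgue (E x) + measure lebesgue F"
        using Em[OF x0] Fm by (rule measure_Un_le)
      also have "\<dots> < 1" using X[OF x] Fs by simp
      finally show False using s by simp
    qed
    then obtain l where l: "l \<in> {s..3}" "l \<notin> E x" "l \<notin> F" by blast
    have "\<bar>G (l * x) - G x\<bar> < e / 2" using l s by (auto simp: E_def)
    moreover have "l / s \<notin> E (s * x)" using l(3) s by (auto simp: F_def image_iff)
    then have "\<bar>G (l * x) - G (s * x)\<bar> < e / 2"
      using l(1) s by (auto simp: E_def field_simps)
    ultimately show "\<bar>log_defect g \<rho> (s * x) - log_defect g \<rho> x\<bar> < e"
      unfolding G_def by linarith
  qed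
qed

text \<open>The factor \<open>x powr \<rho>\<close> is added back to the slowly varying part; on a
  relative neighbourhood of size \<open>\<delta>\<close> either logarithm changes by at most
  \<open>e / 2\<close>. Quotients below 1 are treated by exchanging \<open>x\<close> and
  \<open>u\<close>.\<close>

lemma rv_log_locally_constant:
  assumes rv: "regularly_varying g \<rho>" and e: "e > 0"
  shows "\<exists>\<delta>>0. \<exists>X>0. \<delta> \<le> 1 / 2 \<and> (\<forall>x\<ge>X. \<forall>u. \<bar>u - x\<bar> \<le> \<delta> * x \<longrightarrow> \<bar>ln (g u) - ln (g x)\<bar> \<le> e)"
proof -
  obtain X where X: "X > 0" "\<And>x s. x \<ge> X \<Longrightarrow> s \<in> {1..2} \<Longrightarrow> \<bar>log_defect g \<rho> (s * x) - log_defect g \<rho> x\<bar> < e / 2"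
    using log_defect_uniform[OF rv, of "e / 2"] e by auto
  \<comment> \<open>\<open>\<bar>\<rho>\<bar> + 1\<close> avoids a division by zero; the factor 4
    pays for the bound \<open>2 * \<delta>\<close> on the change of \<open>ln\<close> and for the
    share \<open>e / 2\<close>.\<close>
  define \<delta> where "\<delta> = min (1 / 2) (e / (4 * (\<bar>\<rho>\<bar> + 1)))"
  have d: "\<delta> > 0" "\<delta> \<le> 1 / 2"
    unfolding \<delta>_def using e by (simp, intro min.cobounded1)
  have "\<bar>\<rho>\<bar> * (2 * \<delta>) \<le> (\<bar>\<rho>\<bar> + 1) * (2 * (e / (4 * (\<bar>\<rho>\<bar> + 1))))"
    using e d by (intro mult_mono) (auto simp: \<delta>_def)
  also have "\<dots> = e / 2" by (simp add: field_simps)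
  finally have rd: "\<bar>\<rho>\<bar> * (2 * \<delta>) \<le> e / 2" .
  show ?thesis
  \<comment> \<open>The threshold is \<open>2 * X\<close>, since \<open>u\<close> may be as small as
    \<open>x / 2\<close> and must not fall below \<open>X\<close>.\<close>
  proof (rule exI[of _ \<delta>], intro conjI d(1), rule exI[of _ "2 * X"], intro conjI d(2) allI impI)
    fix x u assume x: "2 * X \<le> x" and u: "\<bar>u - x\<bar> \<le> \<delta> * x"
    have x0: "x > 0" using x X(1) by linarith
    have "\<delta> * x \<le> 1 / 2 * x" using d x0 by (intro mult_right_mono) auto
    then have u2: "u \<ge> x / 2" "u \<le> 2 * x" using u by linarith+
    then have u0: "u > 0" and uX: "u \<ge> X" using x0 x by auto
    have dd: "\<bar>log_defect g \<rho> u - log_defect g \<rho> x\<bar> < e / 2"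
    proof (cases "u \<ge> x")
      case True
      then show ?thesis using X(2)[of x "u / x"] x X(1) x0 u2 by (simp add: field_simps)
    next
      case False
      then show ?thesis using X(2)[of u "x / u"] uX u0 u2 by (simp add: field_simps abs_minus_commute)
    qed
    have "ln (u / x) \<le> u / x - 1" using u0 x0 by (intro ln_le_minus_one) auto
    also have "\<dots> \<le> \<delta>" using u x0 by (auto simp: field_simps abs_le_iff)
    finally have l1: "ln u - ln x \<le> 2 * \<delta>" using u0 x0 d by (simp add: ln_div)
    have "ln (x / u) \<le> x / u - 1" using u0 x0 by (intro ln_le_minus_one) auto
    also have "\<dots> = (x - u) / u" using u0 by (simp add: field_simps)
    also have "\<dots> \<le> \<delta> * x / (x / 2)" using u u2 u0 x0 d by (intro frac_le) auto
    also have "\<dots> = 2 * \<delta>" using x0 by simp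
    finally have l2: "ln x - ln u \<le> 2 * \<delta>" using u0 x0 by (simp add: ln_div)
    have "\<bar>\<rho> * (ln u - ln x)\<bar> \<le> \<bar>\<rho>\<bar> * (2 * \<delta>)"
      unfolding abs_mult using l1 l2 by (intro mult_left_mono) auto
    then show "\<bar>ln (g u) - ln (g x)\<bar> \<le> e"
      using dd rd unfolding log_defect_def right_diff_distrib by linarith
  qed (use X in auto)
qed

text \<open>From \<open>1 / \<delta>\<close> on, a unit step is a relative step of at most
  \<open>\<delta>\<close>, so the logarithm of \<open>g\<close> changes at rate at most
  \<open>e / 2\<close>; the other half of \<open>e\<close> absorbs the constants. Thus
  \<open>g\<close> is negligible against every exponential.\<close>

lemma rv_log_sublinear:
  assumes rv: "regularly_varying g \<rho>" and e: "e > 0"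
  shows "\<forall>\<^sub>F x in at_top. \<bar>ln (g x)\<bar> \<le> e * x"
proof -
  obtain \<delta> X where d: "\<delta> > 0" "X > 0"
    "\<And>x u. x \<ge> X \<Longrightarrow> \<bar>u - x\<bar> \<le> \<delta> * x \<Longrightarrow> \<bar>ln (g u) - ln (g x)\<bar> \<le> e / 2"
    using rv_log_locally_constant[OF rv, of "e / 2"] e by auto
  define X1 where "X1 = max X (1 / \<delta>)"
  have st: "\<bar>ln (g u) - ln (g x)\<bar> \<le> e / 2" if "x \<ge> X1" "\<bar>u - x\<bar> \<le> 1" for x u
  proof (rule d(3))
    have "1 / \<delta> \<le> x" using that by (simp add: X1_def)
    then show "\<bar>u - x\<bar> \<le> \<delta> * x" using that d(1) by (simp add: field_simps)
  qed (use that in \<open>simp add: X1_def\<close>)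
  define C where "C = \<bar>ln (g X1)\<bar>"
  have it: "\<bar>ln (g (X1 + real n))\<bar> \<le> C + real n * (e / 2)" for n
  proof (induction n)
    case (Suc n)
    have "\<bar>ln (g (X1 + real (Suc n))) - ln (g (X1 + real n))\<bar> \<le> e / 2" by (rule st) auto
    moreover have "real (Suc n) * (e / 2) = real n * (e / 2) + e / 2" by (simp add: distrib_right add_divide_distrib)
    ultimately show ?case using Suc by linarith
  qed (simp add: C_def)
  have X1: "X1 > 0" using d by (simp add: X1_def)
  have bd: "\<bar>ln (g x)\<bar> \<le> C + e / 2 + x * (e / 2)" if "x \<ge> X1" for x
  proof -
    define n where "n = nat \<lfloor>x - X1\<rfloor>"
    have n: "real n \<le> x - X1" "x - X1 < real n + 1" using that by (auto simp: n_def of_nat_nat)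
    have "\<bar>ln (g x) - ln (g (X1 + real n))\<bar> \<le> e / 2" using n by (intro st) auto
    moreover have "real n * (e / 2) \<le> x * (e / 2)" using n X1 e by (intro mult_right_mono) auto
    ultimately show ?thesis using it[of n] by linarith
  qed
  show ?thesis
    using eventually_ge_at_top[of X1] eventually_ge_at_top[of "(C + e / 2) / (e / 2)"]
  proof eventually_elim
    case (elim x)
    then have "C + e / 2 \<le> x * (e / 2)" using e by (simp add: field_simps)
    then show ?case using bd[OF elim(1)] by (simp add: field_simps)
  qed
qed

section \<open>Asymptotics of \<open>Phi\<close> on the range of the walk\<close>

lemma Phi_nonneg: "Phi q g x \<ge> 0" by (simp add: Phi_def)

text \<open>With \<open>u = (N - log\<^sub>2 \<bar>y\<bar>) / (1 - q)\<close> both sides equal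
  \<open>2 powr (N - u)\<close> times a power of \<open>g u\<close> and \<open>g N\<close>, respectively; \<open>u \<ge> (1 + \<delta>) N\<close> makes both
  negligible and \<open>u \<le> (1 - \<delta>) N\<close> is excluded by the growth of \<open>R\<close>.\<close>

lemma Phi_asymptotic:
  assumes rv: "regularly_varying g \<rho>" and q: "0 \<le> q" "q < 1"
    and R: "\<And>\<kappa>. \<kappa> > 0 \<Longrightarrow> \<forall>\<^sub>F N in sequentially. R N \<le> 2 powr ((q + \<kappa>) * real N)"
    and e: "e > 0"
  shows "\<forall>\<^sub>F N in sequentially. \<forall>y. \<bar>y\<bar> \<le> R N \<longrightarrow>
     \<bar>2 ^ N * Phi q g (\<bar>y\<bar> / 2 ^ N) - \<bar>y / (2 powr (q * real N) * sqrt (g (real N)))\<bar> powr (1 / (1 - q))\<bar>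
       \<le> e * (1 + \<bar>y / (2 powr (q * real N) * sqrt (g (real N)))\<bar> powr (1 / (1 - q)))"
proof -
  have pos: "g x > 0" if "x \<ge> 0" for x using rv that by (simp add: regularly_varying_def)
  define r where "r = 1 / (1 - q)"
  have r: "r > 0" "r * (1 - q) = 1" using q by (auto simp: r_def)
  have "isCont exp (0::real)" by simp
  then obtain \<eta> where \<eta>: "\<eta> > 0" "\<And>z::real. \<bar>z\<bar> < \<eta> \<Longrightarrow> \<bar>exp z - 1\<bar> < e"
    using e unfolding isCont_def LIM_eq by (auto simp: LIM_eq) (metis abs_zero e exp_zero diff_self)
  obtain \<delta> X where d: "\<delta> > 0" "\<delta> \<le> 1 / 2" "X > 0"
    "\<And>x u. x \<ge> X \<Longrightarrow> \<bar>u - x\<bar> \<le> \<delta> * x \<Longrightarrow> \<bar>ln (g u) - ln (g x)\<bar> \<le> \<eta> / r"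
    using rv_log_locally_constant[OF rv, of "\<eta> / r"] \<eta>(1) r by auto
  \<comment> \<open>Beyond \<open>(1 + \<delta>) * n\<close> the factor \<open>g\<close> may consume
    the fraction \<open>\<theta>\<close> of the decay \<open>2 powr (- u)\<close>: what is left
    still beats \<open>2 powr n\<close> by the margin \<open>\<delta> / 2 * n\<close> in the
    exponent. \<open>\<kappa>\<close> is the growth rate of \<open>ln (g u)\<close> that consumes
    just this fraction.\<close>
  define \<theta> where "\<theta> = \<delta> / (2 * (1 + \<delta>))"
  have \<theta>: "\<theta> > 0" "\<theta> < 1" "(1 - \<theta>) * (1 + \<delta>) = 1 + \<delta> / 2"
    using d by (auto simp: \<theta>_def field_simps)
  define \<kappa> where "\<kappa> = 2 / r * (ln 2 * \<theta>)"
  have \<kappa>: "\<kappa> > 0" "r / 2 * \<kappa> = ln 2 * \<theta>" using \<theta> r by (auto simp: \<kappa>_def)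
  obtain X2 where X2: "\<And>x. x \<ge> X2 \<Longrightarrow> \<bar>ln (g x)\<bar> \<le> \<kappa> * x"
    using rv_log_sublinear[OF rv \<kappa>(1)] by (auto simp: eventually_at_top_linorder)
  have "(\<lambda>N. exp (- (ln 2 * \<delta> / 2) * real N)) \<longlonglongrightarrow> 0"
    using d by real_asymp
  then have ev1: "\<forall>\<^sub>F N in sequentially. exp (- (ln 2 * \<delta> / 2) * real N) < e"
    using e by (rule order_tendstoD)
  \<comment> \<open>The excess \<open>(1 - q) * \<delta> / 2\<close> over \<open>q\<close> becomes
    \<open>\<delta> / 2\<close> after multiplication by \<open>r\<close>, whence
    \<open>u \<ge> n - \<delta> / 2 * n\<close>.\<close>
  have ev2: "\<forall>\<^sub>F N in sequentially. R N \<le> 2 powr ((q + (1 - q) * \<delta> / 2) * real N)"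
    by (rule R) (use d q in auto)
  have ev3: "\<forall>\<^sub>F N in sequentially. real N \<ge> max 1 (max X X2)"
    by (intro eventually_nat_real) (rule eventually_ge_at_top)
  show ?thesis
    using ev1 ev2 ev3
  proof eventually_elim
    case (elim N)
    define n where "n = real N"
    have n: "n \<ge> 1" "n \<ge> X" "n \<ge> X2" using elim(3) by (auto simp: n_def)
    have gn: "g n > 0" using n by (intro pos) auto
    show ?case
    proof (intro allI impI)
      fix y assume y: "\<bar>y\<bar> \<le> R N"
      define A where "A = 2 ^ N * Phi q g (\<bar>y\<bar> / 2 ^ N)"
      define P where "P = \<bar>y / (2 powr (q * n) * sqrt (g n))\<bar> powr r"
      have P0: "P \<ge> 0" by (simp add: P_def)
      have A0: "A \<ge> 0" by (simp add: A_def Phi_nonneg)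
      have "\<bar>A - P\<bar> \<le> e * (1 + P)"
      proof (cases "y = 0")
        case True
        then show ?thesis using e by (simp add: A_def P_def Phi_def)
      next
        case False
        define l where "l = ln \<bar>y\<bar> / ln 2"
        define u where "u = r * (n - l)"
        have ly: "ln \<bar>y\<bar> = ln 2 * l" by (simp add: l_def)
        have rl: "r * l = r * n - u" by (simp add: u_def algebra_simps)
        have "\<bar>y\<bar> \<le> 2 powr ((q + (1 - q) * \<delta> / 2) * n)" using y elim(2) by (simp add: n_def)
        then have "ln \<bar>y\<bar> \<le> ln (2 powr ((q + (1 - q) * \<delta> / 2) * n))" using False by (subst ln_le_cancel_iff) auto
        then have "ln 2 * l \<le> ln 2 * ((q + (1 - q) * \<delta> / 2) * n)" by (simp add: ly ln_powr mult_ac)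
        then have "l \<le> (q + (1 - q) * \<delta> / 2) * n" by simp
        then have "r * (n - l) \<ge> r * (n - (q + (1 - q) * \<delta> / 2) * n)"
          using r by (intro mult_left_mono) auto
        also have "r * (n - (q + (1 - q) * \<delta> / 2) * n) = (r * (1 - q)) * (n - \<delta> / 2 * n)"
          by (simp add: algebra_simps)
        finally have un: "u \<ge> n - \<delta> / 2 * n" by (simp add: r u_def)
        have "\<delta> / 2 * n \<le> \<delta> * n" using d n by (intro mult_right_mono) auto
        then have un': "u \<ge> n - \<delta> * n" using un by linarith
        have "\<delta> * n \<le> 1 / 2 * n" using d n by (intro mult_right_mono) auto
        \<comment> \<open>\<open>u > 0\<close> says that the increment
          \<open>\<bar>y\<bar> / 2 ^ N\<close> is below 1, so that \<open>g\<close> is evaluated on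
          its domain.\<close>
        then have u0: "u > 0" using un' n by linarith
        then have gu: "g u > 0" by (intro pos) auto
        have lx: "ln (\<bar>y\<bar> / 2 ^ N) = ln 2 * (l - n)"
          using False by (simp add: ln_div ln_realpow ly n_def algebra_simps)
        have "- log 2 (\<bar>y\<bar> / 2 ^ N) / (1 - q) = u"
          unfolding log_def lx by (simp add: u_def r_def)
        then have "A = 2 ^ N * ((\<bar>y\<bar> / 2 ^ N) powr r * g u powr (- r / 2))"
          using False by (simp add: A_def Phi_def r_def mult.commute)
        moreover have "(2::real) ^ N = exp (ln 2 * n)" by (simp add: n_def exp_of_nat_mult mult.commute)
        moreover have "(\<bar>y\<bar> / 2 ^ N) powr r = exp (- (ln 2 * u))"
          using False by (simp add: powr_def lx u_def algebra_simps)
        moreover have "g u powr (- r / 2) = exp (- (r / 2) * ln (g u))" using gu by (simp add: powr_def)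
        ultimately have A: "A = exp (ln 2 * (n - u) - r / 2 * ln (g u))"
          by (simp only: mult_exp_exp) (simp add: algebra_simps)
        have "ln \<bar>y / (2 powr (q * n) * sqrt (g n))\<bar> = ln 2 * l - (q * n * ln 2 + ln (g n) / 2)"
          using False gn by (simp add: abs_mult ln_div ln_mult ly ln_powr ln_sqrt)
        then have "P = exp (r * (ln 2 * l - (q * n * ln 2 + ln (g n) / 2)))"
          using False gn by (simp add: P_def powr_def)
        also have "r * (ln 2 * l - (q * n * ln 2 + ln (g n) / 2)) = ln 2 * (r * l) - r * q * n * ln 2 - r / 2 * ln (g n)"
          by (simp add: algebra_simps)
        also have "\<dots> = ln 2 * ((r * (1 - q)) * n - u) - r / 2 * ln (g n)"
          unfolding rl by (simp add: algebra_simps)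
        finally have P: "P = exp (ln 2 * (n - u) - r / 2 * ln (g n))" by (simp add: r)
        \<comment> \<open>Close to \<open>n\<close> the error is relative, \<open>P * e\<close>;
          farther out \<open>A\<close> and \<open>P\<close> are both below \<open>e\<close>. Hence
          the form \<open>e * (1 + P)\<close> of the bound.\<close>
        show ?thesis
        proof (cases "u \<le> n + \<delta> * n")
          case True
          have "\<bar>ln (g u) - ln (g n)\<bar> \<le> \<eta> / r" using True un' n by (intro d(4)) auto
          then have "r / 2 * \<bar>ln (g u) - ln (g n)\<bar> \<le> r / 2 * (\<eta> / r)" using r by (intro mult_left_mono) auto
          also have "\<dots> < \<eta>" using r \<eta> by simp
          finally have "\<bar>- (r / 2 * (ln (g u) - ln (g n)))\<bar> < \<eta>" using r by (simp add: abs_mult)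
          from \<eta>(2)[OF this] have "P * \<bar>exp (- (r / 2 * (ln (g u) - ln (g n)))) - 1\<bar> \<le> P * e"
            using P0 by (intro mult_left_mono) auto
          moreover have "A - P = P * (exp (- (r / 2 * (ln (g u) - ln (g n)))) - 1)"
            unfolding A P by (simp add: algebra_simps flip: exp_add)
          ultimately have "\<bar>A - P\<bar> \<le> P * e" using P0 by (simp add: abs_mult)
          then show ?thesis using e by (simp add: algebra_simps)
        next
          case False
          then have ub: "u > (1 + \<delta>) * n" by (simp add: algebra_simps)
          then have un2: "u \<ge> n" using d n by (smt (verit) mult_le_cancel_right1)
          have small: "exp (ln 2 * (n - u) - r / 2 * ln (g v)) < e" if v: "v = u \<or> v = n" for v
          proof -
            have "- ln (g v) \<le> \<kappa> * v" using X2[of v] v n un2 by auto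
            also have "\<dots> \<le> \<kappa> * u" using v un2 \<kappa> by (intro mult_left_mono) auto
            finally have "r / 2 * (- ln (g v)) \<le> r / 2 * (\<kappa> * u)" using r by (intro mult_left_mono) auto
            also have "\<dots> = ln 2 * \<theta> * u" by (simp add: \<kappa>(2)[symmetric])
            finally have "ln 2 * (n - u) - r / 2 * ln (g v) \<le> ln 2 * n - ln 2 * ((1 - \<theta>) * u)"
              by (simp add: algebra_simps)
            also have "\<dots> \<le> ln 2 * n - ln 2 * ((1 - \<theta>) * ((1 + \<delta>) * n))"
              using ub \<theta> by (intro diff_left_mono mult_left_mono) auto
            also have "\<dots> = - (ln 2 * \<delta> / 2) * n"
              by (simp only: mult.assoc[symmetric, of "1 - \<theta>"] \<theta>(3)) (simp add: algebra_simps)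
            finally have "exp (ln 2 * (n - u) - r / 2 * ln (g v)) \<le> exp (- (ln 2 * \<delta> / 2) * n)" by simp
            then show ?thesis using elim(1) unfolding n_def by (rule le_less_trans)
          qed
          have "A < e" "P < e" using small[of u] small[of n] by (auto simp: A P)
          then have "\<bar>A - P\<bar> \<le> e" using A0 P0 by linarith
          also have "e \<le> e * (1 + P)" using e P0 by simp
          finally show ?thesis .
        qed
      qed
      then show "\<bar>2 ^ N * Phi q g (\<bar>y\<bar> / 2 ^ N) - \<bar>y / (2 powr (q * real N) * sqrt (g (real N)))\<bar> powr (1 / (1 - q))\<bar>
       \<le> e * (1 + \<bar>y / (2 powr (q * real N) * sqrt (g (real N)))\<bar> powr (1 / (1 - q)))"
        by (simp add: A_def P_def n_def r_def)
    qed
  qed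
qed

section \<open>From walks to the variation along dyadic partitions\<close>

text \<open>Two walks that use the same signs keep the distance \<open>d\<close> of their starting
  points.\<close>

lemma walk_avg_close:
  assumes "\<And>x y. x - y = d \<Longrightarrow> \<bar>F x - F y\<bar> \<le> \<eta>" "x - y = d"
  shows "\<bar>walk_avg n a F x - walk_avg n a F y\<bar> \<le> \<eta>"
  using assms(2)
proof (induction n arbitrary: a x y)
  case (Suc n)
  have "\<bar>walk_avg n (\<lambda>m. a (Suc m)) F (x + a 0) - walk_avg n (\<lambda>m. a (Suc m)) F (y + a 0)\<bar> \<le> \<eta>"
    "\<bar>walk_avg n (\<lambda>m. a (Suc m)) F (x - a 0) - walk_avg n (\<lambda>m. a (Suc m)) F (y - a 0)\<bar> \<le> \<eta>"
    using Suc.prems by (auto intro!: Suc.IH)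
  then show ?case by (simp add: field_simps abs_le_iff)
qed (use assms in auto)

text \<open>Two choices of the first \<open>p\<close> signs displace the walk by at most
  \<open>2 * C\<close>, which is negligible against \<open>\<sigma>\<close>. The displacement acts
  at all positions of the walk at once, hence the uniform continuity of
  \<open>\<psi>\<close>.\<close>

lemma walk_avg_tail_limit:
  fixes \<psi> :: "real \<Rightarrow> real"
  assumes \<sigma>: "filterlim \<sigma> at_top sequentially"
    and \<psi>: "uniformly_continuous_on UNIV \<psi>"
    and L: "(\<lambda>N. walk_avg N a (\<lambda>y. \<psi> (y / \<sigma> N)) 0) \<longlonglongrightarrow> V"
    and B: "\<bar>B\<bar> \<le> (\<Sum>m<p. \<bar>a m\<bar>)"
  shows "(\<lambda>n. walk_avg n (\<lambda>m. a (m + p)) (\<lambda>y. \<psi> (y / \<sigma> (p + n))) B) \<longlonglongrightarrow> V"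
proof -
  define C where "C = (\<Sum>m<p. \<bar>a m\<bar>)"
  have \<sigma>': "filterlim (\<lambda>n. \<sigma> (p + n)) at_top sequentially"
    by (rule filterlim_compose[OF \<sigma>]) real_asymp
  have "(\<lambda>n. walk_avg (p + n) a (\<lambda>y. \<psi> (y / \<sigma> (p + n))) 0
     - walk_avg n (\<lambda>m. a (m + p)) (\<lambda>y. \<psi> (y / \<sigma> (p + n))) B) \<longlonglongrightarrow> 0"
  proof (rule tendstoI)
    fix e :: real assume e: "e > 0"
    obtain d where d: "d > 0" "\<And>x y. dist x y < d \<Longrightarrow> dist (\<psi> x) (\<psi> y) < e / 2"
      using uniformly_continuous_onE[OF \<psi>, of "e / 2"] e by (metis UNIV_I half_gt_zero dist_commute)
    have "((\<lambda>n. 2 * C / \<sigma> (p + n)) \<longlongrightarrow> 0) sequentially"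
      by (rule real_tendsto_divide_at_top[OF tendsto_const \<sigma>'])
    then have "\<forall>\<^sub>F n in sequentially. 2 * C / \<sigma> (p + n) < d"
      using d(1) by (rule order_tendstoD)
    moreover have "\<forall>\<^sub>F n in sequentially. \<sigma> (p + n) > 0"
      using \<sigma>' by (rule filterlim_at_top_dense[THEN iffD1, rule_format])
    ultimately show "\<forall>\<^sub>F n in sequentially. dist (walk_avg (p + n) a (\<lambda>y. \<psi> (y / \<sigma> (p + n))) 0
     - walk_avg n (\<lambda>m. a (m + p)) (\<lambda>y. \<psi> (y / \<sigma> (p + n))) B) 0 < e"
    proof eventually_elim
      case (elim n)
      define F where "F = (\<lambda>y. \<psi> (y / \<sigma> (p + n)))"
      have "\<bar>walk_avg (p + n) a F 0 - walk_avg n (\<lambda>m. a (m + p)) F B\<bar> \<le> e / 2"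
      proof (rule walk_avg_split)
        fix B' assume B': "\<bar>B' - 0\<bar> \<le> (\<Sum>m<p. \<bar>a m\<bar>)"
        show "\<bar>walk_avg n (\<lambda>m. a (m + p)) F B' - walk_avg n (\<lambda>m. a (m + p)) F B\<bar> \<le> e / 2"
        proof (rule walk_avg_close[OF _ refl])
          fix x y assume xy: "x - y = B' - B"
          have "\<bar>x - y\<bar> \<le> 2 * C" using B B' xy unfolding C_def by linarith
          then have "\<bar>x - y\<bar> / \<sigma> (p + n) \<le> 2 * C / \<sigma> (p + n)" using elim by (intro divide_right_mono) auto
          then have "dist (x / \<sigma> (p + n)) (y / \<sigma> (p + n)) < d"
            using elim by (simp add: dist_real_def flip: diff_divide_distrib)
          then show "\<bar>F x - F y\<bar> \<le> e / 2" using d(2) by (simp add: F_def dist_real_def less_imp_le)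
        qed
      qed
      then show ?case using e by (simp add: F_def)
    qed
  qed
  moreover have "(\<lambda>n. walk_avg (p + n) a (\<lambda>y. \<psi> (y / \<sigma> (p + n))) 0) \<longlonglongrightarrow> V"
    using LIMSEQ_ignore_initial_segment[OF L, of p] by (simp add: add.commute)
  ultimately show ?thesis using tendsto_diff by fastforce
qed

text \<open>Every dyadic block of level \<open>p\<close> contributes \<open>V / 2 ^ p\<close> in the
  limit, whatever its position. As \<open>\<Psi>\<close> is nonnegative, the sum up to
  \<open>t\<close> lies between two unions of blocks that differ by at most one block, and
  \<open>p\<close> is arbitrary. \<open>\<psi>\<close> is kept apart from \<open>\<Psi>\<close> so
  that it can be a truncated power.\<close>

lemma dyadic_variation_limit:
  fixes \<psi> \<Psi> :: "real \<Rightarrow> real" and \<alpha> :: "nat \<Rightarrow> real"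
  defines "a \<equiv> \<lambda>m. \<alpha> m * 2 ^ m"
  assumes sm: "summable (\<lambda>m. \<bar>\<alpha> m\<bar>)"
    and \<sigma>: "filterlim \<sigma> at_top sequentially"
    and \<psi>: "uniformly_continuous_on UNIV \<psi>" "\<And>x. \<psi> x \<ge> 0"
    and L: "(\<lambda>N. walk_avg N a (\<lambda>y. \<psi> (y / \<sigma> N)) 0) \<longlonglongrightarrow> V"
    and \<Psi>: "\<And>x. \<Psi> x \<ge> 0"
    and approx: "\<And>e. e > 0 \<Longrightarrow> \<forall>\<^sub>F N in sequentially. \<forall>y. \<bar>y\<bar> \<le> (\<Sum>m<N. \<bar>a m\<bar>) \<longrightarrow>
       \<bar>2 ^ N * \<Psi> (\<bar>y\<bar> / 2 ^ N) - \<psi> (y / \<sigma> N)\<bar> \<le> e * (1 + \<psi> (y / \<sigma> N))"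
  shows "has_dyadic_variation \<Psi> (takagi_fun \<alpha>) (\<lambda>t. V * t)"
proof -
  define h where "h N k = \<Psi> \<bar>takagi_fun \<alpha> (real (k + 1) / 2 ^ N) - takagi_fun \<alpha> (real k / 2 ^ N)\<bar>" for N k
  have V0: "V \<ge> 0"
  proof (rule LIMSEQ_le_const[OF L], intro exI allI impI)
    fix N
    have "walk_avg N a (\<lambda>y. 0) 0 \<le> walk_avg N a (\<lambda>y. \<psi> (y / \<sigma> N)) 0" by (rule walk_avg_mono) (rule \<psi>)
    then show "0 \<le> walk_avg N a (\<lambda>y. \<psi> (y / \<sigma> N)) 0" by (simp add: walk_avg_const)
  qed
  have block: "(\<lambda>n. \<Sum>k<2 ^ n. h (p + n) (i * 2 ^ n + k)) \<longlonglongrightarrow> V / 2 ^ p" if i: "i < 2 ^ p" for p i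
  proof -
    obtain B where B: "\<bar>B\<bar> \<le> (\<Sum>m<p. \<bar>a m\<bar>)"
      and Bs: "\<And>n H. (\<Sum>k<2 ^ n. H (takagi_fun \<alpha> (real (i * 2 ^ n + k + 1) / 2 ^ (p + n)) - takagi_fun \<alpha> (real (i * 2 ^ n + k) / 2 ^ (p + n))))
     = 2 ^ n * walk_avg n (\<lambda>m. a (m + p)) (\<lambda>y. H (y / 2 ^ (p + n))) B"
      using sum_takagi_block_increments[OF sm i] unfolding a_def by blast
    define F where "F n y = \<psi> (y / \<sigma> (p + n))" for n y
    define K where "K n y = 2 ^ (p + n) * \<Psi> (\<bar>y\<bar> / 2 ^ (p + n))" for n y
    define w where "w n H = walk_avg n (\<lambda>m. a (m + p)) H B" for n H
    have lF: "(\<lambda>n. w n (F n)) \<longlonglongrightarrow> V"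
      unfolding w_def F_def by (rule walk_avg_tail_limit[OF \<sigma> \<psi>(1) L B])
    have "(\<lambda>n. w n (K n) - w n (F n)) \<longlonglongrightarrow> 0"
    proof (rule tendstoI)
      fix e :: real assume e: "e > 0"
      \<comment> \<open>The error is at most \<open>e' * (1 + w n (F n))\<close>, where the average
        is eventually below \<open>V + 1\<close>.\<close>
      define e' where "e' = e / (2 * (2 + V))"
      have e': "e' > 0" using e V0 by (simp add: e'_def)
      have "\<forall>\<^sub>F n in sequentially. \<forall>y. \<bar>y\<bar> \<le> (\<Sum>m<p + n. \<bar>a m\<bar>) \<longrightarrow> \<bar>K n y - F n y\<bar> \<le> e' * (1 + F n y)"
        using sequentially_offset[OF approx[OF e'], of p] unfolding K_def F_def by (simp only: add.commute)
      moreover have "\<forall>\<^sub>F n in sequentially. w n (F n) < V + 1"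
        using lF by (rule order_tendstoD) simp
      ultimately show "\<forall>\<^sub>F n in sequentially. dist (w n (K n) - w n (F n)) 0 < e"
      proof eventually_elim
        case (elim n)
        have KF: "\<bar>K n y - F n y\<bar> \<le> e' * (1 + F n y)" if y: "\<bar>y - B\<bar> \<le> (\<Sum>m<n. \<bar>a (m + p)\<bar>)" for y
        proof -
          have "(\<Sum>m<p + n. \<bar>a m\<bar>) = (\<Sum>m<p. \<bar>a m\<bar>) + (\<Sum>m<n. \<bar>a (m + p)\<bar>)"
            by (induction n) (simp_all add: add.commute)
          then have "\<bar>y\<bar> \<le> (\<Sum>m<p + n. \<bar>a m\<bar>)" using y B by linarith
          then show ?thesis using elim(1) by blast
        qed
        have "w n (K n) \<le> w n (\<lambda>y. (1 + e') * F n y + e')"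
          unfolding w_def
        proof (rule walk_avg_mono)
          fix y assume "\<bar>y - B\<bar> \<le> (\<Sum>m<n. \<bar>a (m + p)\<bar>)"
          from KF[OF this] show "K n y \<le> (1 + e') * F n y + e'" by (simp add: algebra_simps abs_le_iff)
        qed
        then have u: "w n (K n) \<le> (1 + e') * w n (F n) + e'" unfolding w_def walk_avg_affine .
        have "w n (\<lambda>y. (1 - e') * F n y + (- e')) \<le> w n (K n)"
          unfolding w_def
        proof (rule walk_avg_mono)
          fix y assume "\<bar>y - B\<bar> \<le> (\<Sum>m<n. \<bar>a (m + p)\<bar>)"
          from KF[OF this] show "(1 - e') * F n y + (- e') \<le> K n y" by (simp add: algebra_simps abs_le_iff)
        qed
        then have l: "(1 - e') * w n (F n) + (- e') \<le> w n (K n)" unfolding w_def walk_avg_affine .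
        have "\<bar>w n (K n) - w n (F n)\<bar> \<le> e' * (1 + w n (F n))" using u l by (simp add: algebra_simps abs_le_iff)
        also have "\<dots> \<le> e' * (2 + V)" using elim(2) e' by (intro mult_left_mono) auto
        also have "\<dots> = e / 2" using V0 unfolding e'_def by (subst nonzero_eq_divide_eq) (auto simp: mult_ac)
        finally show ?case using e by simp
      qed
    qed
    from tendsto_add[OF this lF] have "(\<lambda>n. w n (K n)) \<longlonglongrightarrow> V" by simp
    then have "(\<lambda>n. w n (K n) / 2 ^ p) \<longlonglongrightarrow> V / 2 ^ p" by (intro tendsto_intros) auto
    moreover have "w n (K n) / 2 ^ p = (\<Sum>k<2 ^ n. h (p + n) (i * 2 ^ n + k))" for n
      using Bs[where H = "\<lambda>x. \<Psi> \<bar>x\<bar>" and n = n]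
      unfolding w_def K_def walk_avg_cmult h_def by (simp add: power_add)
    ultimately show ?thesis by simp
  qed
  have prefix: "(\<lambda>n. \<Sum>k<j * 2 ^ n. h (p + n) k) \<longlonglongrightarrow> real j * (V / 2 ^ p)" if "j \<le> 2 ^ p" for p j
  proof -
    have "(\<lambda>n. \<Sum>i<j. \<Sum>k<2 ^ n. h (p + n) (i * 2 ^ n + k)) \<longlonglongrightarrow> (\<Sum>i<j. V / 2 ^ p)"
      by (intro tendsto_sum block) (use that in auto)
    then show ?thesis by (simp add: sum_lessThan_mult_blocks)
  qed
  show ?thesis
    unfolding has_dyadic_variation_def
  proof (intro ballI)
    fix t :: real assume t: "t \<in> {0..1}"
    show "dyadic_variation_sum \<Psi> (takagi_fun \<alpha>) t \<longlonglongrightarrow> V * t"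
    proof (rule tendstoI)
      fix e :: real assume e: "e > 0"
      have "(\<lambda>p. V / 2 ^ p) \<longlonglongrightarrow> 0" by real_asymp
      then have "\<forall>\<^sub>F p in sequentially. V / 2 ^ p < e / 2" by (rule order_tendstoD) (use e in simp)
      then obtain p where p: "V / 2 ^ p < e / 2" by (auto simp: eventually_sequentially)
      define j where "j = nat \<lfloor>t * 2 ^ p\<rfloor>"
      \<comment> \<open>The sum includes the index \<open>\<lfloor>t * 2 ^ N\<rfloor>\<close>, so
        one block beyond \<open>j\<close> is needed; the cap \<open>2 ^ p\<close> corresponds to the
        omitted index at \<open>t = 1\<close>.\<close>
      define j' where "j' = min (j + 1) (2 ^ p)"
      have j: "real j \<le> t * 2 ^ p" "t * 2 ^ p < real j + 1"
        using t unfolding j_def by (auto simp: of_nat_nat)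
      have "t * 2 ^ p \<le> 1 * 2 ^ p" using t by (intro mult_right_mono) auto
      then have "real j \<le> 2 ^ p" using j by linarith
      then have jp: "j \<le> 2 ^ p" by (metis of_nat_le_iff of_nat_numeral of_nat_power)
      have S: "(\<Sum>k<j * 2 ^ n. h (p + n) k) \<le> dyadic_variation_sum \<Psi> (takagi_fun \<alpha>) t (p + n) \<and>
         dyadic_variation_sum \<Psi> (takagi_fun \<alpha>) t (p + n) \<le> (\<Sum>k<j' * 2 ^ n. h (p + n) k)" for n
      proof -
        define m where "m = nat \<lfloor>t * 2 ^ (p + n)\<rfloor>"
        define I where "I = {0..m} - {2 ^ (p + n)}"
        have m: "real m \<le> t * 2 ^ (p + n)" "t * 2 ^ (p + n) < real m + 1"
          using t unfolding m_def by (auto simp: of_nat_nat)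
        then have m': "real m \<le> t * 2 ^ p * 2 ^ n" "t * 2 ^ p * 2 ^ n < real m + 1"
          by (simp_all add: power_add mult.assoc)
        have "real j * 2 ^ n \<le> t * 2 ^ p * 2 ^ n" using j by (intro mult_right_mono) auto
        then have "real j * 2 ^ n < real m + 1" using m' by linarith
        then have "real (j * 2 ^ n) < real (m + 1)" by simp
        then have lo: "j * 2 ^ n \<le> m" by (simp only: of_nat_less_iff)
        have "t * 2 ^ p * 2 ^ n < (real j + 1) * 2 ^ n" using j by (intro mult_strict_right_mono) auto
        then have "real m < (real j + 1) * 2 ^ n" using m' by linarith
        then have "real m < real ((j + 1) * 2 ^ n)" by (simp add: distrib_right)
        then have hi: "m < (j + 1) * 2 ^ n" by (simp only: of_nat_less_iff)
        have "t * 2 ^ (p + n) \<le> 1 * 2 ^ (p + n)" using t by (intro mult_right_mono) auto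
        then have "real m \<le> 2 ^ (p + n)" using m by linarith
        then have mp: "m \<le> 2 ^ (p + n)" by (metis of_nat_le_iff of_nat_numeral of_nat_power)
        have D: "dyadic_variation_sum \<Psi> (takagi_fun \<alpha>) t (p + n) = sum (h (p + n)) I"
          by (simp add: dyadic_variation_sum_def I_def m_def h_def)
        have "j * 2 ^ n \<le> 2 ^ p * 2 ^ n" using jp by simp
        then have "{..<j * 2 ^ n} \<subseteq> I" using lo by (auto simp: I_def power_add)
        moreover have "I \<subseteq> {..<j' * 2 ^ n}"
          using hi mp by (auto simp: I_def j'_def power_add min_def)
        ultimately show ?thesis unfolding D
          by (intro conjI sum_mono2) (auto simp: I_def h_def \<Psi>)
      qed
      have "t * 2 ^ p - 1 < real j" using j by linarith
      then have "(t * 2 ^ p - 1) * (V / 2 ^ p) \<le> real j * (V / 2 ^ p)" using V0 by (intro mult_right_mono) auto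
      moreover have "(t * 2 ^ p - 1) * (V / 2 ^ p) = V * t - V / 2 ^ p" by (simp add: field_simps)
      ultimately have lo: "V * t - e / 2 < real j * (V / 2 ^ p)" using p by linarith
      have "real j' \<le> t * 2 ^ p + 1" using j by (simp add: j'_def)
      then have "real j' * (V / 2 ^ p) \<le> (t * 2 ^ p + 1) * (V / 2 ^ p)" using V0 by (intro mult_right_mono) auto
      moreover have "(t * 2 ^ p + 1) * (V / 2 ^ p) = V * t + V / 2 ^ p" by (simp add: field_simps)
      ultimately have hi: "real j' * (V / 2 ^ p) < V * t + e / 2" using p by linarith
      have "\<forall>\<^sub>F n in sequentially. V * t - e / 2 < (\<Sum>k<j * 2 ^ n. h (p + n) k)"
        using prefix[OF jp] lo by (rule order_tendstoD)
      moreover have "\<forall>\<^sub>F n in sequentially. (\<Sum>k<j' * 2 ^ n. h (p + n) k) < V * t + e / 2"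
        using prefix[of j' p] hi by (rule order_tendstoD) (simp add: j'_def)
      ultimately have "\<forall>\<^sub>F n in sequentially. dist (dyadic_variation_sum \<Psi> (takagi_fun \<alpha>) t (p + n)) (V * t) < e"
      proof eventually_elim
        case (elim n)
        then show ?case using S[of n] e by (simp add: dist_real_def abs_less_iff)
      qed
      then show "\<forall>\<^sub>F N in sequentially. dist (dyadic_variation_sum \<Psi> (takagi_fun \<alpha>) t N) (V * t) < e"
        using eventually_sequentially_seg[of "\<lambda>N. dist (dyadic_variation_sum \<Psi> (takagi_fun \<alpha>) t N) (V * t) < e" p]
        by (simp add: add.commute)
    qed
  qed
qed

section \<open>A central limit theorem\<close>

text \<open>Both functions agree with \<open>1 - x\<^sup>2 / 2\<close> up to fourth order, with
  constants 1/24 and 1/4 valid for all \<open>x\<close>. The expansion of \<open>iexp\<close> goes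
  to degree three, because the cubic term is imaginary and the remainder then has order
  four.\<close>

lemma cos_minus_gauss_bound: "\<bar>cos x - exp (- x\<^sup>2 / 2)\<bar> \<le> x ^ 4" for x :: real
proof -
  have "(\<Sum>k\<le>3. (\<i> * complex_of_real x) ^ k / fact k) = complex_of_real (1 - x\<^sup>2 / 2) + \<i> * complex_of_real (x - x ^ 3 / 6)"
    by (simp add: numeral_3_eq_3 power2_eq_square power3_eq_cube fact_numeral complex_eq_iff field_simps)
  moreover have "cmod (iexp x - (\<Sum>k\<le>3. (\<i> * complex_of_real x) ^ k / fact k)) \<le> \<bar>x\<bar> ^ Suc 3 / fact (Suc 3)"
    by (rule iexp_approx1)
  ultimately have "cmod (iexp x - (complex_of_real (1 - x\<^sup>2 / 2) + \<i> * complex_of_real (x - x ^ 3 / 6))) \<le> x ^ 4 / 24"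
    by (simp add: fact_numeral power_even_abs)
  then have "\<bar>Re (iexp x - (complex_of_real (1 - x\<^sup>2 / 2) + \<i> * complex_of_real (x - x ^ 3 / 6)))\<bar> \<le> x ^ 4 / 24"
    by (meson abs_Re_le_cmod order_trans)
  then have c: "\<bar>cos x - (1 - x\<^sup>2 / 2)\<bar> \<le> x ^ 4 / 24"
    by (simp add: cis_conv_exp[symmetric] mult.commute)
  define u where "u = x\<^sup>2 / 2"
  have u: "u \<ge> 0" "u\<^sup>2 = x ^ 4 / 4" by (simp_all add: u_def power_divide flip: power_mult)
  have "exp (- u) \<ge> 1 - u" using exp_ge_add_one_self[of "- u"] by simp
  moreover have "exp (- u) \<le> 1 - u + u\<^sup>2"
  proof -
    \<comment> \<open>The factorization of \<open>1 + u ^ 3\<close> and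
      \<open>1 + u \<le> exp u\<close> give the upper bound on the whole half-line
      \<open>u \<ge> 0\<close>.\<close>
    have "1 \<le> 1 + u ^ 3" using u by simp
    also have "\<dots> = (1 - u + u\<^sup>2) * (1 + u)" by (simp add: power2_eq_square power3_eq_cube algebra_simps)
    also have "\<dots> \<le> (1 - u + u\<^sup>2) * exp u"
    proof (rule mult_left_mono)
      have "0 \<le> (1 - u / 2)\<^sup>2 + 3 / 4 * u\<^sup>2" by simp
      then show "0 \<le> 1 - u + u\<^sup>2" by (simp add: power2_eq_square algebra_simps)
    qed (simp add: add.commute)
    finally show ?thesis by (simp add: exp_minus field_simps)
  qed
  ultimately have "\<bar>exp (- u) - (1 - u)\<bar> \<le> x ^ 4 / 4" using u by auto
  moreover have "exp (- u) = exp (- x\<^sup>2 / 2)" "x ^ 4 \<ge> 0" by (simp_all add: u_def)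
  ultimately show ?thesis using c unfolding u_def by linarith
qed

text \<open>The truncation error costs a second moment divided by \<open>K\<close>; this extends
  weak convergence from bounded functions to the first absolute moment.\<close>

lemma abs_le_truncated:
  fixes x K :: real
  assumes "K > 0"
  shows "min \<bar>x\<bar> K \<le> \<bar>x\<bar>" "\<bar>x\<bar> \<le> min \<bar>x\<bar> K + x\<^sup>2 / K"
proof -
  show "\<bar>x\<bar> \<le> min \<bar>x\<bar> K + x\<^sup>2 / K"
  proof (cases "\<bar>x\<bar> \<le> K")
    case False
    then have "K * \<bar>x\<bar> \<le> \<bar>x\<bar> * \<bar>x\<bar>" by (intro mult_right_mono) auto
    then have "\<bar>x\<bar> \<le> x\<^sup>2 / K" using assms by (simp add: le_divide_eq mult.commute power2_eq_square)
    then show ?thesis using assms by simp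
  qed (use assms in simp)
qed simp

context rademacher begin

lemma char_walk:
  "char (distr M borel (\<lambda>\<omega>. \<Sum>m<n. b m * Y (Suc m) \<omega>)) t = complex_of_real (\<Prod>m<n. cos (t * b m))"
proof -
  define X where "X \<omega> = (\<Sum>m<n. b m * Y (Suc m) \<omega>)" for \<omega>
  have [measurable]: "X \<in> borel_measurable M" unfolding X_def by measurable
  have sc: "walk_avg n b (\<lambda>y. H (t * y)) 0 = walk_avg n (\<lambda>m. t * b m) H 0" for H
    using walk_avg_scale[of n t b H 0] by simp
  have ci: "integrable M (\<lambda>\<omega>. cos (t * X \<omega>))" "(\<integral>\<omega>. cos (t * X \<omega>) \<partial>M) = (\<Prod>m<n. cos (t * b m))"
    using expectation_walk[of "\<lambda>y. cos (t * y)" 0 b n] sc[of cos] by (simp_all add: X_def walk_avg_cos)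
  have si: "integrable M (\<lambda>\<omega>. sin (t * X \<omega>))" "(\<integral>\<omega>. sin (t * X \<omega>) \<partial>M) = 0"
    using expectation_walk[of "\<lambda>y. sin (t * y)" 0 b n] sc[of sin] by (simp_all add: X_def walk_avg_sin)
  have "char (distr M borel X) t = (\<integral>\<omega>. iexp (t * X \<omega>) \<partial>M)"
    unfolding char_def by (subst integral_distr) auto
  also have "\<dots> = (\<integral>\<omega>. complex_of_real (cos (t * X \<omega>)) + \<i> * complex_of_real (sin (t * X \<omega>)) \<partial>M)"
    by (intro Bochner_Integration.integral_cong refl) (simp add: exp_Euler flip: cos_of_real sin_of_real)
  also have "\<dots> = complex_of_real (\<Prod>m<n. cos (t * b m))"
    using ci si by (simp del: of_real_prod)
  finally show ?thesis by (simp add: X_def[abs_def])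
qed

text \<open>The normalized coefficients are uniformly small and their squares add up to 1, so the
  characteristic functions tend to the Gaussian one; unit second moments then carry weak convergence
  over to the first absolute moment.\<close>

lemma walk_abs_clt:
  assumes s: "filterlim (\<lambda>N. \<Sum>m<N. (a m)\<^sup>2) at_top sequentially"
    and small: "(\<lambda>N. (a N)\<^sup>2 / (\<Sum>m<N. (a m)\<^sup>2)) \<longlonglongrightarrow> 0"
  shows "(\<lambda>N. walk_avg N a (\<lambda>y. \<bar>y / sqrt (\<Sum>m<N. (a m)\<^sup>2)\<bar>) 0) \<longlonglongrightarrow> sqrt (2 / pi)"
proof -
  define v where "v N = (\<Sum>m<N. (a m)\<^sup>2)" for N
  define b where "b N m = a m / sqrt (v N)" for N m
  define X where "X N \<omega> = (\<Sum>m<N. b N m * Y (Suc m) \<omega>)" for N \<omega>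
  have [measurable]: "X N \<in> borel_measurable M" for N unfolding X_def by measurable
  have v0: "v N \<ge> 0" for N by (simp add: v_def sum_nonneg)
  have vmono: "v m \<le> v N" if "m \<le> N" for m N
    unfolding v_def by (rule sum_mono2) (use that in auto)
  have vpos: "\<forall>\<^sub>F N in sequentially. v N > 0"
    using s unfolding v_def by (rule filterlim_at_top_dense[THEN iffD1, rule_format])
  have sumb: "(\<Sum>m<N. (b N m)\<^sup>2) = 1" if "v N > 0" for N
    using that v0[of N] by (simp add: b_def power_divide v_def flip: sum_divide_distrib)
  \<comment> \<open>Late coefficients are small by \<open>small\<close> and the monotonicity of
    \<open>v\<close>, the finitely many early ones because \<open>v N\<close> tends to
    infinity.\<close>
  have lind: "\<forall>\<^sub>F N in sequentially. \<forall>m<N. (b N m)\<^sup>2 \<le> \<epsilon>" if \<epsilon>: "\<epsilon> > 0" for \<epsilon>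
  proof -
    have "\<forall>\<^sub>F N in sequentially. (a N)\<^sup>2 / v N < \<epsilon> \<and> v N > 0"
      using order_tendstoD(2)[OF small \<epsilon>] vpos by (auto simp: v_def elim: eventually_elim2)
    then obtain m0 where m0: "\<And>m. m \<ge> m0 \<Longrightarrow> (a m)\<^sup>2 / v m < \<epsilon> \<and> v m > 0"
      by (auto simp: eventually_sequentially)
    have "\<forall>\<^sub>F N in sequentially. v N > v m0 / \<epsilon>"
      using s unfolding v_def[symmetric] by (rule filterlim_at_top_dense[THEN iffD1, rule_format])
    then show ?thesis using vpos
    proof eventually_elim
      case (elim N)
      show ?case
      proof (intro allI impI)
        fix m assume m: "m < N"
        have "(a m)\<^sup>2 \<le> \<epsilon> * v N"
        proof (cases "m \<ge> m0")
          case True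
          then have "(a m)\<^sup>2 \<le> \<epsilon> * v m" using m0[of m] by (auto simp: pos_divide_less_eq less_imp_le)
          also have "\<dots> \<le> \<epsilon> * v N" using vmono[of m N] m \<epsilon> by simp
          finally show ?thesis .
        next
          case False
          then have "(a m)\<^sup>2 \<le> v m0" unfolding v_def by (intro member_le_sum) auto
          also have "\<dots> \<le> \<epsilon> * v N" using elim(1) \<epsilon> by (simp add: field_simps)
          finally show ?thesis .
        qed
        then show "(b N m)\<^sup>2 \<le> \<epsilon>" using elim(2) by (simp add: b_def power_divide field_simps)
      qed
    qed
  qed
  define \<mu> where "\<mu> N = distr M borel (X N)" for N
  have "weak_conv_m \<mu> std_normal_distribution"
  proof (rule levy_continuity)
    show "real_distribution (\<mu> N)" for N unfolding \<mu>_def by (rule real_distribution_distr) measurable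
    show "real_distribution std_normal_distribution" by (rule real_dist_normal_dist)
    fix t :: real
    have "(\<lambda>N. (\<Prod>m<N. cos (t * b N m)) - exp (- t\<^sup>2 / 2)) \<longlonglongrightarrow> 0"
    proof (rule tendstoI)
      fix e :: real assume e: "e > 0"
      \<comment> \<open>The total error will be at most \<open>t ^ 4 * \<epsilon>\<close>; the added
        1 admits \<open>t = 0\<close>.\<close>
      define \<epsilon> where "\<epsilon> = e / 2 / (t ^ 4 + 1)"
      have t4: "t ^ 4 \<ge> 0" by simp
      have \<epsilon>: "\<epsilon> > 0" using e t4 by (simp add: \<epsilon>_def add_nonneg_pos)
      show "\<forall>\<^sub>F N in sequentially. dist ((\<Prod>m<N. cos (t * b N m)) - exp (- t\<^sup>2 / 2)) 0 < e"
        using lind[OF \<epsilon>] vpos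
      proof eventually_elim
        case (elim N)
        have "(\<Prod>m<N. exp (- (t * b N m)\<^sup>2 / 2)) = exp (- t\<^sup>2 / 2 * (\<Sum>m<N. (b N m)\<^sup>2))"
          by (simp add: exp_sum[symmetric] sum_distrib_left power_mult_distrib)
        then have g: "(\<Prod>m<N. exp (- (t * b N m)\<^sup>2 / 2)) = exp (- t\<^sup>2 / 2)" by (simp add: sumb[OF elim(2)])
        \<comment> \<open>Products of factors bounded by 1 differ by at most the sum of the
          differences of their factors.\<close>
        have "norm ((\<Prod>m<N. cos (t * b N m)) - (\<Prod>m<N. exp (- (t * b N m)\<^sup>2 / 2)))
            \<le> (\<Sum>m<N. norm (cos (t * b N m) - exp (- (t * b N m)\<^sup>2 / 2)))"
          by (rule norm_prod_diff) auto
        also have "\<dots> \<le> (\<Sum>m<N. t ^ 4 * (\<epsilon> * (b N m)\<^sup>2))"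
        proof (rule sum_mono)
          fix m assume m: "m \<in> {..<N}"
          have "norm (cos (t * b N m) - exp (- (t * b N m)\<^sup>2 / 2)) \<le> (t * b N m) ^ 4"
            using cos_minus_gauss_bound by simp
          also have "\<dots> = t ^ 4 * ((b N m)\<^sup>2 * (b N m)\<^sup>2)" by (simp add: power_mult_distrib flip: power_add)
          also have "\<dots> \<le> t ^ 4 * (\<epsilon> * (b N m)\<^sup>2)" using elim(1) m by (intro mult_left_mono mult_right_mono) auto
          finally show "norm (cos (t * b N m) - exp (- (t * b N m)\<^sup>2 / 2)) \<le> t ^ 4 * (\<epsilon> * (b N m)\<^sup>2)" .
        qed
        also have "\<dots> = t ^ 4 * \<epsilon>" by (simp add: sumb[OF elim(2)] flip: sum_distrib_left)
        also have "\<dots> \<le> (t ^ 4 + 1) * \<epsilon>" using \<epsilon> by (intro mult_right_mono) auto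
        also have "\<dots> = e / 2"
        proof -
          have "t ^ 4 + 1 \<noteq> 0" using t4 by linarith
          then have "\<epsilon> * (t ^ 4 + 1) = e / 2"
            using nonzero_eq_divide_eq[of "t ^ 4 + 1" \<epsilon> "e / 2"] \<epsilon>_def by blast
          then show ?thesis by (metis mult.commute)
        qed
        finally show ?case using e unfolding g by simp
      qed
    qed
    then have "(\<lambda>N. \<Prod>m<N. cos (t * b N m)) \<longlonglongrightarrow> exp (- t\<^sup>2 / 2)"
      by (rule LIM_zero_cancel)
    then show "(\<lambda>N. char (\<mu> N) t) \<longlonglongrightarrow> char std_normal_distribution t"
      unfolding \<mu>_def X_def char_walk char_std_normal_distribution by (rule tendsto_of_real)
  qed
  then have trunc: "(\<lambda>N. \<integral>\<omega>. min \<bar>X N \<omega>\<bar> K \<partial>M) \<longlonglongrightarrow> (\<integral>x. min \<bar>x\<bar> K \<partial>std_normal_distribution)"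
    if "K > 0" for K
  proof -
    have "(\<lambda>N. integral\<^sup>L (\<mu> N) (\<lambda>x. min \<bar>x\<bar> K)) \<longlonglongrightarrow> integral\<^sup>L std_normal_distribution (\<lambda>x. min \<bar>x\<bar> K)"
    proof (rule weak_conv_imp_integral_bdd_continuous_conv[where B = K])
      show "real_distribution (\<mu> N)" for N unfolding \<mu>_def by (rule real_distribution_distr) measurable
      show "real_distribution std_normal_distribution" by (rule real_dist_normal_dist)
      show "weak_conv_m \<mu> std_normal_distribution" by fact
    qed (use that in \<open>auto intro!: continuous_intros\<close>)
    moreover have "integral\<^sup>L (\<mu> N) (\<lambda>x. min \<bar>x\<bar> K) = (\<integral>\<omega>. min \<bar>X N \<omega>\<bar> K \<partial>M)" for N
      unfolding \<mu>_def by (rule integral_distr) auto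
    ultimately show ?thesis by simp
  qed
  interpret N: real_distribution std_normal_distribution by (rule real_dist_normal_dist)
  have n1: "integrable std_normal_distribution (\<lambda>x. \<bar>x\<bar>)" "(\<integral>x. \<bar>x\<bar> \<partial>std_normal_distribution) = sqrt (2 / pi)"
    using integrable_std_normal_distribution_moment[of 1] std_normal_distribution_odd_moments_abs[of 0]
    by (simp_all add: integrable_abs)
  have n2: "integrable std_normal_distribution (\<lambda>x. x\<^sup>2)" "(\<integral>x. x\<^sup>2 \<partial>std_normal_distribution) = 1"
    using std_normal_distribution_even_moments[of 1] by (simp_all add: fact_numeral)
  have nt: "\<bar>sqrt (2 / pi) - (\<integral>x. min \<bar>x\<bar> K \<partial>std_normal_distribution)\<bar> \<le> 1 / K" if K: "K > 0" for K
  proof -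
    have i: "integrable std_normal_distribution (\<lambda>x. min \<bar>x\<bar> K)"
      by (rule N.integrable_const_bound[where B = K]) (use K in auto)
    have "(\<integral>x. min \<bar>x\<bar> K \<partial>std_normal_distribution) \<le> (\<integral>x. \<bar>x\<bar> \<partial>std_normal_distribution)"
      by (intro integral_mono i n1) auto
    moreover have "(\<integral>x. \<bar>x\<bar> \<partial>std_normal_distribution) \<le> (\<integral>x. min \<bar>x\<bar> K + x\<^sup>2 / K \<partial>std_normal_distribution)"
      by (intro integral_mono n1 abs_le_truncated K) (use i n2 in auto)
    moreover have "(\<integral>x. min \<bar>x\<bar> K + x\<^sup>2 / K \<partial>std_normal_distribution) = (\<integral>x. min \<bar>x\<bar> K \<partial>std_normal_distribution) + 1 / K"
      using i n2 by simp
    ultimately show ?thesis by (simp add: n1(2))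
  qed
  have Xt: "\<bar>(\<integral>\<omega>. \<bar>X N \<omega>\<bar> \<partial>M) - (\<integral>\<omega>. min \<bar>X N \<omega>\<bar> K \<partial>M)\<bar> \<le> 1 / K" if K: "K > 0" and vN: "v N > 0" for K N
  proof -
    have i: "integrable M (\<lambda>\<omega>. min \<bar>X N \<omega>\<bar> K)"
      by (rule integrable_const_bound[where B = K]) (use K in auto)
    have i1: "integrable M (\<lambda>\<omega>. \<bar>X N \<omega>\<bar>)"
      using expectation_walk(1)[of "\<lambda>y. \<bar>y\<bar>" 0 "b N" N] by (simp add: X_def)
    have i2: "integrable M (\<lambda>\<omega>. (X N \<omega>)\<^sup>2)" "(\<integral>\<omega>. (X N \<omega>)\<^sup>2 \<partial>M) = 1"
      using expectation_walk[of "\<lambda>y. y\<^sup>2" 0 "b N" N] by (simp_all add: X_def walk_avg_square sumb[OF vN])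
    have "(\<integral>\<omega>. min \<bar>X N \<omega>\<bar> K \<partial>M) \<le> (\<integral>\<omega>. \<bar>X N \<omega>\<bar> \<partial>M)"
      by (intro integral_mono i i1) auto
    moreover have "(\<integral>\<omega>. \<bar>X N \<omega>\<bar> \<partial>M) \<le> (\<integral>\<omega>. min \<bar>X N \<omega>\<bar> K + (X N \<omega>)\<^sup>2 / K \<partial>M)"
      by (intro integral_mono i1 abs_le_truncated K) (use i i2 in auto)
    moreover have "(\<integral>\<omega>. min \<bar>X N \<omega>\<bar> K + (X N \<omega>)\<^sup>2 / K \<partial>M) = (\<integral>\<omega>. min \<bar>X N \<omega>\<bar> K \<partial>M) + 1 / K"
      using i i2 by simp
    ultimately show ?thesis by simp
  qed
  have "(\<lambda>N. \<integral>\<omega>. \<bar>X N \<omega>\<bar> \<partial>M) \<longlonglongrightarrow> sqrt (2 / pi)"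
  proof (rule tendstoI)
    fix e :: real assume e: "e > 0"
    \<comment> \<open>Two truncation errors of at most \<open>1 / K = e / 4\<close> and one of weak
      convergence stay below \<open>e\<close>.\<close>
    define K where "K = 4 / e"
    have K: "K > 0" "1 / K = e / 4" using e by (auto simp: K_def)
    have "\<forall>\<^sub>F N in sequentially. dist (\<integral>\<omega>. min \<bar>X N \<omega>\<bar> K \<partial>M) (\<integral>x. min \<bar>x\<bar> K \<partial>std_normal_distribution) < e / 4"
      using trunc[OF K(1)] by (rule tendstoD) (use e in simp)
    then show "\<forall>\<^sub>F N in sequentially. dist (\<integral>\<omega>. \<bar>X N \<omega>\<bar> \<partial>M) (sqrt (2 / pi)) < e"
      using vpos
    proof eventually_elim
      case (elim N)
      then show ?case using nt[OF K(1)] Xt[OF K(1) elim(2)] e unfolding K(2) dist_real_def by linarith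
    qed
  qed
  moreover have "(\<integral>\<omega>. \<bar>X N \<omega>\<bar> \<partial>M) = walk_avg N a (\<lambda>y. \<bar>y / sqrt (v N)\<bar>) 0" for N
    using expectation_walk(2)[of "\<lambda>y. \<bar>y\<bar>" 0 "b N" N] walk_avg_scale[of N "1 / sqrt (v N)" a "\<lambda>y. \<bar>y\<bar>" 0]
    by (simp add: X_def b_def[abs_def])
  ultimately show ?thesis by (simp add: v_def)
qed

end

section \<open>Geometrically growing coefficients\<close>

lemma rv_ratio_Suc:
  assumes rv: "regularly_varying g \<rho>"
  shows "(\<lambda>N. g (real (Suc N)) / g (real N)) \<longlonglongrightarrow> 1"
proof -
  have pos: "g (real N) > 0" for N using rv by (simp add: regularly_varying_def)
  have "(\<lambda>N. ln (g (real (Suc N))) - ln (g (real N))) \<longlonglongrightarrow> 0"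
  proof (rule LIMSEQ_I)
    fix e :: real assume e: "e > 0"
    obtain \<delta> X where d: "\<delta> > 0"
      "\<And>x u. x \<ge> X \<Longrightarrow> \<bar>u - x\<bar> \<le> \<delta> * x \<Longrightarrow> \<bar>ln (g u) - ln (g x)\<bar> \<le> e / 2"
      using rv_log_locally_constant[OF rv, of "e / 2"] e by auto
    obtain N0 where N0: "real N0 \<ge> max X (1 / \<delta>)" using real_arch_simple by blast
    show "\<exists>N0. \<forall>N\<ge>N0. norm (ln (g (real (Suc N))) - ln (g (real N)) - 0) < e"
    proof (intro exI[of _ N0] allI impI)
      fix N assume "N \<ge> N0"
      then have N: "real N \<ge> X" "real N \<ge> 1 / \<delta>" using N0 by linarith+
      then have "\<bar>real (Suc N) - real N\<bar> \<le> \<delta> * real N" using d(1) by (simp add: field_simps)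
      from d(2)[OF N(1) this] show "norm (ln (g (real (Suc N))) - ln (g (real N)) - 0) < e" using e by simp
    qed
  qed
  then have "(\<lambda>N. exp (ln (g (real (Suc N))) - ln (g (real N)))) \<longlonglongrightarrow> exp 0"
    by (rule tendsto_exp)
  then show ?thesis using pos by (simp add: exp_diff del: of_nat_Suc)
qed

text \<open>The exponential factor alone determines the ratio, since consecutive values of
  \<open>g\<close> are asymptotically equal.\<close>

lemma normalizer_ratio_Suc:
  assumes rv: "regularly_varying g \<rho>"
    and v: "(\<lambda>N. v N / (2 powr (2 * q * real N) * g (real N))) \<longlonglongrightarrow> 1"
  shows "(\<lambda>N. v (Suc N) / v N) \<longlonglongrightarrow> 2 powr (2 * q)" and "\<forall>\<^sub>F N in sequentially. v N > 0"
proof -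
  have pos: "g (real N) > 0" for N using rv by (simp add: regularly_varying_def)
  define s where "s N = 2 powr (2 * q * real N) * g (real N)" for N
  have s: "s N > 0" for N using pos by (simp add: s_def)
  have vs: "(\<lambda>N. v N / s N) \<longlonglongrightarrow> 1" using v by (simp add: s_def)
  have "\<forall>\<^sub>F N in sequentially. v N / s N > 0" using vs by (rule order_tendstoD) simp
  then show vpos: "\<forall>\<^sub>F N in sequentially. v N > 0"
    by eventually_elim (use s in \<open>simp add: zero_less_divide_iff not_less less_imp_le order_less_not_sym\<close>)
  have "(\<lambda>N. 2 powr (2 * q) * (g (real (Suc N)) / g (real N))) \<longlonglongrightarrow> 2 powr (2 * q) * 1"
    by (intro tendsto_intros rv_ratio_Suc[OF rv])
  moreover have "s (Suc N) / s N = 2 powr (2 * q) * (g (real (Suc N)) / g (real N))" for N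
    by (simp add: s_def powr_add[symmetric] algebra_simps) (simp add: powr_add)
  ultimately have ss: "(\<lambda>N. s (Suc N) / s N) \<longlonglongrightarrow> 2 powr (2 * q)" by simp
  have "(\<lambda>N. (v (Suc N) / s (Suc N)) * (s (Suc N) / s N) / (v N / s N)) \<longlonglongrightarrow> 1 * 2 powr (2 * q) / 1"
    by (intro tendsto_intros ss vs LIMSEQ_Suc[OF vs]) auto
  moreover have "(v (Suc N) / s (Suc N)) * (s (Suc N) / s N) / (v N / s N) = v (Suc N) / v N" for N
    using s[of N] s[of "Suc N"] by (simp add: field_simps)
  ultimately show "(\<lambda>N. v (Suc N) / v N) \<longlonglongrightarrow> 2 powr (2 * q)" by (simp only: mult_1 div_by_1)
qed

lemma ratio_iterate:
  fixes x :: "nat \<Rightarrow> real"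
  assumes x: "(\<lambda>n. x (Suc n) / x n) \<longlonglongrightarrow> l" and nz: "\<forall>\<^sub>F n in sequentially. x n \<noteq> 0"
  shows "(\<lambda>n. x (n + j) / x n) \<longlonglongrightarrow> l ^ j"
proof (induction j)
  case 0
  have "\<forall>\<^sub>F n in sequentially. x (n + 0) / x n = 1" using nz by eventually_elim simp
  then show ?case by (simp add: tendsto_eventually)
next
  case (Suc j)
  have "(\<lambda>n. x (Suc (n + j)) / x (n + j) * (x (n + j) / x n)) \<longlonglongrightarrow> l * l ^ j"
    by (intro tendsto_mult Suc LIMSEQ_ignore_initial_segment[OF x])
  moreover have "\<forall>\<^sub>F n in sequentially. x (Suc (n + j)) / x (n + j) * (x (n + j) / x n) = x (n + Suc j) / x n"
    using sequentially_offset[OF nz, of j] by eventually_elim simp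
  ultimately have "(\<lambda>n. x (n + Suc j) / x n) \<longlonglongrightarrow> l * l ^ j" by (rule Lim_transform_eventually)
  then show ?case by simp
qed

lemma walk_avg_cong_coeffs:
  assumes "\<And>m. m < n \<Longrightarrow> a m = b m"
  shows "walk_avg n a H x = walk_avg n b H x"
  using assms
proof (induction n arbitrary: a b x)
  case (Suc n)
  have "walk_avg n (\<lambda>m. a (Suc m)) H y = walk_avg n (\<lambda>m. b (Suc m)) H y" for y
    by (rule Suc.IH) (simp add: Suc.prems)
  then show ?case using Suc.prems[of 0] by simp
qed simp

text \<open>Below \<open>N0\<close> no growth is assumed; monotonicity replaces it at the price of
  the factor \<open>\<mu> ^ N0\<close>. The bound supplies the geometric majorant for the
  coefficients read backwards.\<close>

lemma geometric_growth_backwards: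
  fixes v :: "nat \<Rightarrow> real"
  assumes mono: "\<And>m n. m \<le> n \<Longrightarrow> v m \<le> v n" and v0: "\<And>n. v n \<ge> 0" and \<mu>: "\<mu> \<ge> 1"
    and step: "\<And>n. n \<ge> N0 \<Longrightarrow> \<mu> * v n \<le> v (Suc n)" and N: "N \<ge> N0" "m \<le> N"
  shows "v m * \<mu> ^ (N - m) \<le> \<mu> ^ N0 * v N"
proof -
  have up: "v k * \<mu> ^ (N - k) \<le> v N" if "k \<ge> N0" "k \<le> N" for k
    using that(2)
  proof (induction N rule: dec_induct)
    case (step n)
    have "v k * \<mu> ^ (Suc n - k) = \<mu> * (v k * \<mu> ^ (n - k))" using step by (simp add: Suc_diff_le)
    also have "\<dots> \<le> \<mu> * v n" using step \<mu> by (intro mult_left_mono) auto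
    also have "\<dots> \<le> v (Suc n)" using assms(4)[of n] step that by simp
    finally show ?case .
  qed simp
  show ?thesis
  proof (cases "m \<ge> N0")
    case True
    have "v N \<le> \<mu> ^ N0 * v N" using mult_right_mono[of 1 "\<mu> ^ N0" "v N"] v0 \<mu> by (simp add: one_le_power)
    then show ?thesis using up[OF True N(2)] by linarith
  next
    case False
    then have "N - m = (N0 - m) + (N - N0)" using N by simp
    then have "v m * \<mu> ^ (N - m) = \<mu> ^ (N0 - m) * (v m * \<mu> ^ (N - N0))" by (simp add: power_add)
    also have "\<dots> \<le> \<mu> ^ N0 * (v N0 * \<mu> ^ (N - N0))"
      using \<mu> v0 mono[of m N0] False by (intro mult_mono power_increasing mult_right_mono) auto
    also have "\<dots> \<le> \<mu> ^ N0 * v N" using up[of N0] N \<mu> by (intro mult_left_mono) auto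
    finally show ?thesis .
  qed
qed

context rademacher begin

lemma Zq_eq: "Zq q Y \<omega> = (\<Sum>j. sqrt (2 powr (2 * q) - 1) * 2 powr (- q * real (Suc j)) * Y (Suc j) \<omega>)"
  if "summable (\<lambda>j. 2 powr (- q * real (Suc j)) * Y (Suc j) \<omega>)"
  using suminf_mult[OF that] by (simp add: Zq_def mult.assoc)

lemma geometric_powr: "2 powr (- q * real (Suc j)) = 2 powr (- q) * (2 powr (- q)) ^ j" for q :: real
  by (simp add: powr_realpow[symmetric] powr_powr powr_add[symmetric] algebra_simps)

lemma summable_geometric_powr: "summable (\<lambda>j. 2 powr (- q * real (Suc j)) :: real)" if "q > 0"
  unfolding geometric_powr using that by (intro summable_mult summable_geometric) (simp add: powr_less_one)

lemma AE_summable_Zq: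
  assumes "q > 0"
  shows "AE \<omega> in M. summable (\<lambda>m. 2 powr (- q * real (m + 1)) * Y (m + 1) \<omega>)"
  using AE_Y
proof eventually_elim
  case (elim \<omega>)
  then have "\<bar>Y (Suc m) \<omega>\<bar> = 1" for m by (metis abs_1 abs_minus_cancel)
  then have "norm (2 powr (- q * real (m + 1)) * Y (m + 1) \<omega>) \<le> 2 powr (- q * real (Suc m))" for m
    by (simp add: abs_mult)
  then show ?case by (rule summable_comparison_test'[OF summable_geometric_powr[OF assms]])
qed

text \<open>Let \<open>c N j\<close> be the normalized modulus of the \<open>j\<close>-th
  coefficient from the end. It tends to \<open>d j\<close> under a geometric majorant, so Tannery's
  theorem gives convergence in the summation norm, and the reversed walks converge to
  \<open>Zq\<close> for almost all signs. Truncation at \<open>K\<close> affects neither the limit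
  nor, for large \<open>N\<close>, the walks, and it makes the power bounded and uniformly
  continuous.\<close>

lemma walk_geometric_limit:
  fixes a \<sigma> :: "nat \<Rightarrow> real" and q r :: real
  defines "v \<equiv> \<lambda>N. \<Sum>m<N. (a m)\<^sup>2"
  assumes q: "q > 0" and r: "r > 0" and \<sigma>: "\<And>N. \<sigma> N > 0"
    and v\<sigma>: "(\<lambda>N. v N / (\<sigma> N)\<^sup>2) \<longlonglongrightarrow> 1"
    and ratio: "(\<lambda>N. v (Suc N) / v N) \<longlonglongrightarrow> 2 powr (2 * q)"
    and vpos: "\<forall>\<^sub>F N in sequentially. v N > 0"
  shows "integrable M (\<lambda>\<omega>. \<bar>Zq q Y \<omega>\<bar> powr r)"
    and "\<exists>K>0. (\<forall>\<^sub>F N in sequentially. (\<Sum>m<N. \<bar>a m\<bar>) \<le> K * \<sigma> N) \<and>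
       (\<lambda>N. walk_avg N a (\<lambda>y. min \<bar>y / \<sigma> N\<bar> K powr r) 0) \<longlonglongrightarrow> (\<integral>\<omega>. \<bar>Zq q Y \<omega>\<bar> powr r \<partial>M)"
proof -
  define l where "l = (2::real) powr (2 * q)"
  have l: "l > 1" using q by (simp add: l_def)
  define d where "d j = sqrt (l - 1) * 2 powr (- q * real (Suc j))" for j
  define c where "c N j = (if j < N then \<bar>a (N - Suc j)\<bar> / \<sigma> N else 0)" for N j
  have v0: "v N \<ge> 0" for N by (simp add: v_def sum_nonneg)
  have vmono: "v m \<le> v N" if "m \<le> N" for m N
    unfolding v_def by (rule sum_mono2) (use that in auto)
  have d0: "d j \<ge> 0" for j using l by (simp add: d_def)
  have ds: "summable d" unfolding d_def by (intro summable_mult summable_geometric_powr q)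
  have c0: "c N j \<ge> 0" for N j using \<sigma>[of N] by (simp add: c_def)

  have vnz: "\<forall>\<^sub>F N in sequentially. v N \<noteq> 0" using vpos by eventually_elim simp
  have clim: "(\<lambda>N. c N j) \<longlonglongrightarrow> d j" for j
  proof -
    \<comment> \<open>With \<open>M = n + Suc j\<close> this is
      \<open>(a n)\<^sup>2 / (\<sigma> M)\<^sup>2\<close>, the square of \<open>c M j\<close>,
      written in terms of convergent ratios; its limit \<open>(l - 1) / l ^ Suc j\<close> is the
      square of \<open>d j\<close>.\<close>
    have "(\<lambda>n. (v (Suc n) / v n - 1) * (v (n + Suc j) / (\<sigma> (n + Suc j))\<^sup>2) / (v (n + Suc j) / v n))
        \<longlonglongrightarrow> (l - 1) * 1 / l ^ Suc j"
      using l by (intro tendsto_divide tendsto_mult tendsto_diff tendsto_const ratio[folded l_def]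
        ratio_iterate[OF ratio[folded l_def] vnz] LIMSEQ_ignore_initial_segment[OF v\<sigma>]) auto
    then have "(\<lambda>n. sqrt ((v (Suc n) / v n - 1) * (v (n + Suc j) / (\<sigma> (n + Suc j))\<^sup>2) / (v (n + Suc j) / v n)))
        \<longlonglongrightarrow> sqrt ((l - 1) * 1 / l ^ Suc j)"
      by (rule tendsto_real_sqrt)
    also have "sqrt ((l - 1) * 1 / l ^ Suc j) = d j"
    proof -
      have "1 / l ^ Suc j = (2 powr (- q * real (Suc j)))\<^sup>2"
      proof -
        have "l ^ Suc j = 2 powr (real (Suc j) * (2 * q))"
          unfolding l_def by (rule powr_power) simp
        moreover have "(2 powr (- q * real (Suc j)))\<^sup>2 = 2 powr (real 2 * (- q * real (Suc j)))"
          by (rule powr_power) simp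
        moreover have "real 2 * (- q * real (Suc j)) = - (real (Suc j) * (2 * q))" by simp
        ultimately show ?thesis by (simp only: powr_minus_divide)
      qed
      then have "sqrt (1 / l ^ Suc j) = 2 powr (- q * real (Suc j))"
        by (simp only: real_sqrt_abs) simp
      then show ?thesis unfolding d_def 
        by (simp only: mult_1_right divide_inverse real_sqrt_mult mult_1_left)
    qed
    finally have "(\<lambda>n. sqrt ((v (Suc n) / v n - 1) * (v (n + Suc j) / (\<sigma> (n + Suc j))\<^sup>2) / (v (n + Suc j) / v n))) \<longlonglongrightarrow> d j" .
    moreover have "\<forall>\<^sub>F n in sequentially. sqrt ((v (Suc n) / v n - 1) * (v (n + Suc j) / (\<sigma> (n + Suc j))\<^sup>2) / (v (n + Suc j) / v n)) = c (n + Suc j) j"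
      using vpos
    proof eventually_elim
      case (elim n)
      have "v (n + Suc j) > 0" using elim vmono[of n "n + Suc j"] by linarith
      then have "(v (Suc n) / v n - 1) * (v (n + Suc j) / (\<sigma> (n + Suc j))\<^sup>2) / (v (n + Suc j) / v n) = (v (Suc n) - v n) / (\<sigma> (n + Suc j))\<^sup>2"
        using elim \<sigma>[of "n + Suc j"] by (simp add: field_simps)
      also have "\<dots> = (a n / \<sigma> (n + Suc j))\<^sup>2" by (simp add: v_def power_divide)
      finally show ?case using \<sigma>[of "n + Suc j"] by (simp add: c_def)
    qed
    ultimately have "(\<lambda>n. c (n + Suc j) j) \<longlonglongrightarrow> d j" by (rule Lim_transform_eventually)
    then show ?thesis by (rule LIMSEQ_offset)
  qed

  \<comment> \<open>Any rate strictly between 1 and \<open>l\<close> serves. Likewise 4 is just a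
    bound above the limit 1 of \<open>v N / (\<sigma> N)\<^sup>2\<close>.\<close>
  define \<mu> where "\<mu> = (1 + l) / 2"
  have \<mu>: "\<mu> > 1" "\<mu> < l" using l by (auto simp: \<mu>_def)
  have "\<forall>\<^sub>F N in sequentially. v (Suc N) / v N > \<mu> \<and> v N > 0 \<and> v N / (\<sigma> N)\<^sup>2 < 4"
    using order_tendstoD(1)[OF ratio[folded l_def] \<mu>(2)] vpos order_tendstoD(2)[OF v\<sigma>, of 4]
    by (simp add: eventually_conj)
  then obtain N0 where N0: "\<And>N. N \<ge> N0 \<Longrightarrow> v (Suc N) / v N > \<mu> \<and> v N > 0 \<and> v N / (\<sigma> N)\<^sup>2 < 4"
    by (auto simp: eventually_sequentially)
  have step: "\<mu> * v n \<le> v (Suc n)" if "n \<ge> N0" for n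
    using N0[OF that] by (auto simp: field_simps)
  define C where "C = sqrt (4 * \<mu> ^ N0)"
  define \<theta> where "\<theta> = sqrt (1 / \<mu>)"
  have \<theta>: "0 \<le> \<theta>" "\<theta> < 1" using \<mu> by (auto simp: \<theta>_def)
  have cb: "c N j \<le> C * \<theta> ^ j" if N: "N \<ge> N0" for N j
  proof (cases "j < N")
    case True
    \<comment> \<open>The index \<open>N - Suc j\<close> is the last one in the sum
      \<open>v (N - j)\<close>.\<close>
    have "(a (N - Suc j))\<^sup>2 \<le> v (N - j)"
      unfolding v_def using True by (intro member_le_sum) auto
    also have "\<dots> \<le> \<mu> ^ N0 * v N / \<mu> ^ j"
    proof -
      have "v (N - j) * \<mu> ^ (N - (N - j)) \<le> \<mu> ^ N0 * v N"
        by (rule geometric_growth_backwards[where v = v]) (use vmono v0 step N \<mu> in auto)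
      then show ?thesis using \<mu> True by (simp add: field_simps)
    qed
    also have "\<dots> \<le> \<mu> ^ N0 * (4 * (\<sigma> N)\<^sup>2) / \<mu> ^ j"
    proof -
      have "v N \<le> 4 * (\<sigma> N)\<^sup>2" using N0[OF N] \<sigma>[of N] by (auto simp: field_simps)
      then show ?thesis using \<mu> by (intro divide_right_mono mult_left_mono) auto
    qed
    finally have "(a (N - Suc j))\<^sup>2 / (\<sigma> N)\<^sup>2 \<le> 4 * \<mu> ^ N0 * (1 / \<mu>) ^ j"
      using \<sigma>[of N] by (simp add: field_simps power_one_over)
    then have "sqrt ((a (N - Suc j))\<^sup>2 / (\<sigma> N)\<^sup>2) \<le> sqrt (4 * \<mu> ^ N0 * (1 / \<mu>) ^ j)"
      by (rule real_sqrt_le_mono)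
    moreover have "sqrt ((a (N - Suc j))\<^sup>2 / (\<sigma> N)\<^sup>2) = c N j"
      using True \<sigma>[of N] by (simp add: c_def real_sqrt_divide)
    moreover have "sqrt (4 * \<mu> ^ N0 * (1 / \<mu>) ^ j) = C * \<theta> ^ j"
      by (simp add: C_def \<theta>_def real_sqrt_mult real_sqrt_power)
    ultimately show ?thesis by simp
  next
    case False
    then show ?thesis using \<theta> \<mu> by (simp add: c_def C_def)
  qed
  define D where "D N = (\<Sum>j. \<bar>c N j - d j\<bar>)" for N
  define B where "B j = C * \<theta> ^ j + d j" for j
  have Bs: "summable B" unfolding B_def using \<theta> by (intro summable_add summable_mult summable_geometric ds) auto
  have cdB: "\<bar>c N j - d j\<bar> \<le> B j" if "N \<ge> N0" for N j
    using cb[OF that, of j] c0[of N j] d0[of j] unfolding B_def by linarith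
  have cds: "summable (\<lambda>j. \<bar>c N j - d j\<bar>)" if "N \<ge> N0" for N
    by (rule summable_comparison_test'[OF Bs]) (use cdB[OF that] in auto)
  have "D \<longlonglongrightarrow> (\<Sum>j. 0)"
    unfolding D_def
  proof (rule tannerys_theorem[where M = B, THEN conjunct2, THEN conjunct2])
    show "(\<lambda>N. \<bar>c N j - d j\<bar>) \<longlonglongrightarrow> 0" for j
      by (rule tendsto_rabs_zero) (rule LIM_zero[OF clim])
    show "\<forall>\<^sub>F (j, N) in at_top \<times>\<^sub>F sequentially. norm \<bar>c N j - d j\<bar> \<le> B j"
      unfolding eventually_prod_filter
      by (intro exI[of _ "\<lambda>_. True"] exI[of _ "\<lambda>N. N \<ge> N0"]) (auto simp: cdB)
  qed (auto simp: Bs)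
  then have D0: "D \<longlonglongrightarrow> 0" by simp

  \<comment> \<open>\<open>suminf d\<close> bounds the modulus of \<open>Zq\<close>; the extra 1
    covers the coefficient distance \<open>D N\<close>, which is eventually below 1.\<close>
  define K where "K = suminf d + 1"
  have K: "K > 0" using suminf_nonneg[OF ds d0] by (simp add: K_def)
  define X where "X N \<omega> = (\<Sum>j<N. c N j * Y (Suc j) \<omega>)" for N \<omega>
  define \<psi> where "\<psi> x = min \<bar>x\<bar> K powr r" for x
  have \<psi>m [measurable]: "\<psi> \<in> borel_measurable borel" unfolding \<psi>_def by measurable
  have Xm [measurable]: "X N \<in> borel_measurable M" for N unfolding X_def by measurable
  have Zm [measurable]: "Zq q Y \<in> borel_measurable M" unfolding Zq_def by (measurable; simp)
  have Zae: "AE \<omega> in M. \<bar>Zq q Y \<omega>\<bar> \<le> K \<and> (\<lambda>N. X N \<omega>) \<longlonglongrightarrow> Zq q Y \<omega>"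
    using AE_Y AE_summable_Zq[OF q]
  proof eventually_elim
    case (elim \<omega>)
    have Y1: "\<bar>Y (Suc m) \<omega>\<bar> = 1" for m using elim(1) by (metis abs_1 abs_minus_cancel)
    have Z: "Zq q Y \<omega> = (\<Sum>j. d j * Y (Suc j) \<omega>)"
      using Zq_eq[of q \<omega>] elim(2) by (simp add: d_def l_def)
    have dYs: "summable (\<lambda>j. \<bar>d j * Y (Suc j) \<omega>\<bar>)" using ds d0 by (simp add: abs_mult Y1)
    have "\<bar>Zq q Y \<omega>\<bar> \<le> (\<Sum>j. \<bar>d j * Y (Suc j) \<omega>\<bar>)" unfolding Z by (rule summable_rabs[OF dYs])
    also have "\<dots> = suminf d" using d0 by (simp add: abs_mult Y1)
    finally have b: "\<bar>Zq q Y \<omega>\<bar> \<le> K" by (simp add: K_def)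
    \<comment> \<open>The distance is at most the summation norm of the coefficient differences,
      whatever the signs are.\<close>
    have "\<forall>\<^sub>F N in sequentially. \<bar>X N \<omega> - Zq q Y \<omega>\<bar> \<le> D N"
      using eventually_ge_at_top[of N0]
    proof eventually_elim
      case (elim N)
      have cs: "(\<lambda>j. c N j * Y (Suc j) \<omega>) sums X N \<omega>"
        unfolding X_def by (rule sums_finite) (auto simp: c_def)
      have "(\<lambda>j. d j * Y (Suc j) \<omega>) sums Zq q Y \<omega>"
        unfolding Z by (rule summable_sums) (rule summable_rabs_cancel[OF dYs])
      from sums_diff[OF cs this] have e: "X N \<omega> - Zq q Y \<omega> = (\<Sum>j. (c N j - d j) * Y (Suc j) \<omega>)"
        by (simp add: sums_iff left_diff_distrib)
      have "summable (\<lambda>j. \<bar>(c N j - d j) * Y (Suc j) \<omega>\<bar>)" using cds[OF elim] by (simp add: abs_mult Y1)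
      from summable_rabs[OF this] show ?case unfolding e D_def by (simp add: abs_mult Y1)
    qed
    then have "(\<lambda>N. X N \<omega> - Zq q Y \<omega>) \<longlonglongrightarrow> 0"
      by (intro Lim_null_comparison[OF _ D0]) simp
    then show ?case using b by (auto intro: LIM_zero_cancel)
  qed
  have \<psi>K: "\<bar>\<psi> x\<bar> \<le> K powr r" for x using K r by (simp add: \<psi>_def powr_mono2)
  have "AE \<omega> in M. \<psi> (Zq q Y \<omega>) = \<bar>Zq q Y \<omega>\<bar> powr r"
    using Zae by eventually_elim (simp add: \<psi>_def min_def)
  note Zcong = integrable_cong_AE[OF _ _ this] integral_cong_AE[OF _ _ this]
  have "integrable M (\<lambda>\<omega>. \<psi> (Zq q Y \<omega>))"
    by (rule integrable_const_bound[where B = "K powr r"]) (use \<psi>K in auto)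
  then show "integrable M (\<lambda>\<omega>. \<bar>Zq q Y \<omega>\<bar> powr r)" using Zcong(1) by simp
  have \<psi>c: "isCont \<psi> x" for x
    unfolding \<psi>_def using r K by (intro continuous_intros) auto
  have "(\<lambda>N. \<integral>\<omega>. \<psi> (X N \<omega>) \<partial>M) \<longlonglongrightarrow> (\<integral>\<omega>. \<psi> (Zq q Y \<omega>) \<partial>M)"
  proof (rule integral_dominated_convergence[where w = "\<lambda>_. K powr r"])
    show "AE \<omega> in M. (\<lambda>N. \<psi> (X N \<omega>)) \<longlonglongrightarrow> \<psi> (Zq q Y \<omega>)"
      using Zae by eventually_elim (auto intro: isCont_tendsto_compose[OF \<psi>c])
  qed (use \<psi>K in auto)
  also have "(\<integral>\<omega>. \<psi> (Zq q Y \<omega>) \<partial>M) = (\<integral>\<omega>. \<bar>Zq q Y \<omega>\<bar> powr r \<partial>M)" using Zcong(2) by simp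
  \<comment> \<open>\<open>X N\<close> uses the moduli of the coefficients in reverse order; neither
    change affects the average over signs.\<close>
  also have "(\<lambda>N. \<integral>\<omega>. \<psi> (X N \<omega>) \<partial>M) = (\<lambda>N. walk_avg N a (\<lambda>y. min \<bar>y / \<sigma> N\<bar> K powr r) 0)"
  proof
    fix N
    have "(\<integral>\<omega>. \<psi> (X N \<omega>) \<partial>M) = walk_avg N (c N) \<psi> 0"
      using expectation_walk(2)[OF \<psi>m, of 0 "c N" N] by (simp add: X_def)
    also have "\<dots> = walk_avg N (\<lambda>j. 1 / \<sigma> N * \<bar>a (N - Suc j)\<bar>) \<psi> 0"
      by (rule walk_avg_cong_coeffs) (simp add: c_def)
    also have "\<dots> = walk_avg N (\<lambda>j. \<bar>a (N - Suc j)\<bar>) (\<lambda>y. \<psi> (1 / \<sigma> N * y)) 0"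
      using walk_avg_scale[of N "1 / \<sigma> N" "\<lambda>j. \<bar>a (N - Suc j)\<bar>" \<psi> 0] by simp
    also have "\<dots> = walk_avg N a (\<lambda>y. \<psi> (1 / \<sigma> N * y)) 0"
      using walk_avg_rev[of N "\<lambda>j. \<bar>a j\<bar>"] by (simp add: walk_avg_abs)
    finally show "(\<integral>\<omega>. \<psi> (X N \<omega>) \<partial>M) = walk_avg N a (\<lambda>y. min \<bar>y / \<sigma> N\<bar> K powr r) 0"
      by (simp add: \<psi>_def)
  qed
  finally have lim: "(\<lambda>N. walk_avg N a (\<lambda>y. min \<bar>y / \<sigma> N\<bar> K powr r) 0) \<longlonglongrightarrow> (\<integral>\<omega>. \<bar>Zq q Y \<omega>\<bar> powr r \<partial>M)" .
  have "\<forall>\<^sub>F N in sequentially. D N < 1" using D0 by (rule order_tendstoD) simp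
  then have "\<forall>\<^sub>F N in sequentially. (\<Sum>m<N. \<bar>a m\<bar>) \<le> K * \<sigma> N"
    using eventually_ge_at_top[of N0]
  proof eventually_elim
    case (elim N)
    have "(\<Sum>m<N. \<bar>a m\<bar>) = (\<Sum>j<N. \<bar>a (N - Suc j)\<bar>)"
      by (rule sum.nat_diff_reindex[symmetric])
    then have "(\<Sum>m<N. \<bar>a m\<bar>) / \<sigma> N = (\<Sum>j<N. c N j)" by (simp add: c_def sum_divide_distrib)
    also have "\<dots> \<le> (\<Sum>j<N. d j + \<bar>c N j - d j\<bar>)" by (intro sum_mono) auto
    also have "\<dots> \<le> (\<Sum>j. d j + \<bar>c N j - d j\<bar>)"
      using ds cds[OF elim(2)] d0 by (intro sum_le_suminf summable_add) auto
    also have "\<dots> = suminf d + D N" using ds cds[OF elim(2)] by (simp add: suminf_add D_def)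
    also have "\<dots> \<le> K" using elim by (simp add: K_def)
    finally show ?case using \<sigma>[of N] by (simp add: divide_le_eq)
  qed
  then show "\<exists>K>0. (\<forall>\<^sub>F N in sequentially. (\<Sum>m<N. \<bar>a m\<bar>) \<le> K * \<sigma> N) \<and>
       (\<lambda>N. walk_avg N a (\<lambda>y. min \<bar>y / \<sigma> N\<bar> K powr r) 0) \<longlonglongrightarrow> (\<integral>\<omega>. \<bar>Zq q Y \<omega>\<bar> powr r \<partial>M)"
    using K lim by blast
qed

end

section \<open>Variation of the Takagi functions\<close>

lemma ssq_eq_sum_squares: "ssq \<alpha> n = (\<Sum>m<n. (\<alpha> m * 2 ^ m)\<^sup>2)"
proof -
  have "(4::real) ^ m = (2 ^ m)\<^sup>2" for m by (simp add: power2_eq_square flip: power_mult_distrib)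
  then show ?thesis by (simp add: ssq_def power_mult_distrib)
qed

section \<open>Total variation as the limit of dyadic sums\<close>

lemma dyadic_abs_increments_walk:
  assumes "summable (\<lambda>m. \<bar>\<alpha> m\<bar>)"
  shows "(\<Sum>k<2 ^ n. \<bar>takagi_fun \<alpha> (real (k + 1) / 2 ^ n) - takagi_fun \<alpha> (real k / 2 ^ n)\<bar>)
    = walk_avg n (\<lambda>m. \<alpha> m * 2 ^ m) abs 0"
proof -
  have "walk_avg n (\<lambda>m. \<alpha> m * 2 ^ m) (\<lambda>y. \<bar>y / 2 ^ n\<bar>) 0 = 1 / 2 ^ n * walk_avg n (\<lambda>m. \<alpha> m * 2 ^ m) abs 0"
    by (subst walk_avg_cmult[symmetric]) simp
  then show ?thesis using sum_takagi_increments[OF assms, where H = abs and b = 0 and n = n] by simp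
qed

lemma sum_abs_increments_mono_le:
  fixes F :: "nat \<Rightarrow> real"
  assumes "\<And>i. i < n \<Longrightarrow> e i \<le> e (Suc i)"
  shows "(\<Sum>i<n. \<bar>F (e (Suc i)) - F (e i)\<bar>) \<le> (\<Sum>k\<in>{e 0..<e n}. \<bar>F (Suc k) - F k\<bar>) \<and> e 0 \<le> e n"
  using assms
proof (induction n)
  case (Suc n)
  then have IH: "(\<Sum>i<n. \<bar>F (e (Suc i)) - F (e i)\<bar>) \<le> (\<Sum>k\<in>{e 0..<e n}. \<bar>F (Suc k) - F k\<bar>)" "e 0 \<le> e n"
    and le: "e n \<le> e (Suc n)" by auto
  have "\<bar>F (e (Suc n)) - F (e n)\<bar> = \<bar>\<Sum>k\<in>{e n..<e (Suc n)}. F (Suc k) - F k\<bar>"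
    by (simp add: sum_Suc_diff'[OF le])
  also have "\<dots> \<le> (\<Sum>k\<in>{e n..<e (Suc n)}. \<bar>F (Suc k) - F k\<bar>)" by (rule sum_abs)
  finally have "(\<Sum>i<Suc n. \<bar>F (e (Suc i)) - F (e i)\<bar>)
     \<le> (\<Sum>k\<in>{e 0..<e n}. \<bar>F (Suc k) - F k\<bar>) + (\<Sum>k\<in>{e n..<e (Suc n)}. \<bar>F (Suc k) - F k\<bar>)"
    using IH by simp
  also have "\<dots> = (\<Sum>k\<in>{e 0..<e (Suc n)}. \<bar>F (Suc k) - F k\<bar>)"
    using IH(2) le by (rule sum.atLeastLessThan_concat)
  finally show ?case using IH(2) le by auto
qed simp

lemma dyadic_sum_in_variation_sums:
  "(\<Sum>k<2 ^ N. \<bar>f (real (k + 1) / 2 ^ N) - f (real k / 2 ^ N)\<bar>) \<in> variation_sums f 0 1"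
  unfolding variation_sums_def
  by (intro CollectI exI[of _ "2 ^ N"] exI[of _ "\<lambda>k. real k / 2 ^ N"]) (auto simp: divide_strict_right_mono)

text \<open>Rounding the partition points down to the dyadic grid gives sums that converge by
  continuity and that the triangle inequality bounds by the full dyadic sum. Rounded points may
  coincide, hence the merely weakly increasing indices \<open>e N i\<close>.\<close>

lemma variation_sums_le_dyadic_limit:
  assumes cont: "continuous_on {0..1} f"
    and L: "(\<lambda>N. \<Sum>k<2 ^ N. \<bar>f (real (k + 1) / 2 ^ N) - f (real k / 2 ^ N)\<bar>) \<longlonglongrightarrow> L"
    and x: "x \<in> variation_sums f 0 1"
  shows "x \<le> L"
proof -
  obtain n p where p: "p 0 = 0" "p n = 1" "\<And>i. i < n \<Longrightarrow> p i < p (Suc i)"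
    and x: "x = (\<Sum>i<n. \<bar>f (p (Suc i)) - f (p i)\<bar>)"
    using x unfolding variation_sums_def by blast
  have pm: "p i \<le> p j" if "i \<le> j" "j \<le> n" for i j
    using that
  proof (induction j rule: dec_induct)
    case (step m)
    then show ?case using p(3)[of m] by simp
  qed simp
  have p01: "p i \<in> {0..1}" if "i \<le> n" for i using pm[of 0 i] pm[of i n] p that by auto
  define e where "e N i = nat \<lfloor>p i * 2 ^ N\<rfloor>" for N i
  define d where "d N i = real (e N i) / 2 ^ N" for N i
  have d: "0 \<le> d N i \<and> d N i \<le> p i \<and> p i - 1 / 2 ^ N \<le> d N i" if "i \<le> n" for N i
  proof -
    have "real (e N i) \<le> p i * 2 ^ N" "p i * 2 ^ N < real (e N i) + 1"
      using p01[OF that] unfolding e_def by (auto simp: of_nat_nat)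
    moreover have "p i - 1 / 2 ^ N = (p i * 2 ^ N - 1) / 2 ^ N" by (simp add: field_simps)
    ultimately show ?thesis by (simp add: d_def divide_le_eq divide_right_mono)
  qed
  have dlim: "(\<lambda>N. d N i) \<longlonglongrightarrow> p i" if "i \<le> n" for i
  proof (rule tendsto_sandwich)
    have "(\<lambda>N. p i - 1 / 2 ^ N) \<longlonglongrightarrow> p i - 0" by (intro tendsto_diff tendsto_const) real_asymp
    then show "(\<lambda>N. p i - 1 / 2 ^ N) \<longlonglongrightarrow> p i" by simp
  qed (use d[OF that] in auto)
  have fl: "(\<lambda>N. f (d N i)) \<longlonglongrightarrow> f (p i)" if "i \<le> n" for i
    by (rule continuous_on_tendsto_compose[OF cont dlim[OF that] p01[OF that]])
       (use d[OF that] p01[OF that] in \<open>auto intro!: always_eventually intro: order_trans\<close>)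
  have "(\<lambda>N. \<Sum>i<n. \<bar>f (d N (Suc i)) - f (d N i)\<bar>) \<longlonglongrightarrow> x"
    unfolding x by (intro tendsto_sum tendsto_rabs tendsto_diff fl) auto
  moreover have "(\<Sum>i<n. \<bar>f (d N (Suc i)) - f (d N i)\<bar>) \<le> (\<Sum>k<2 ^ N. \<bar>f (real (k + 1) / 2 ^ N) - f (real k / 2 ^ N)\<bar>)" for N
  proof -
    have "e N i \<le> e N (Suc i)" if "i < n" for i
      unfolding e_def using p(3)[OF that] by (intro nat_mono floor_mono mult_right_mono) auto
    from sum_abs_increments_mono_le[of n "e N" "\<lambda>k. f (real k / 2 ^ N)", OF this]
    have "(\<Sum>i<n. \<bar>f (d N (Suc i)) - f (d N i)\<bar>) \<le> (\<Sum>k\<in>{e N 0..<e N n}. \<bar>f (real (Suc k) / 2 ^ N) - f (real k / 2 ^ N)\<bar>)"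
      by (simp add: d_def)
    moreover have "e N 0 = 0" by (simp add: e_def p(1))
    moreover have "e N n = 2 ^ N"
    proof -
      have "\<lfloor>(2::real) ^ N\<rfloor> = 2 ^ N" by (metis floor_of_int of_int_numeral of_int_power)
      then show ?thesis by (simp add: e_def p(2) nat_power_eq)
    qed
    ultimately show ?thesis by (simp add: lessThan_atLeast0)
  qed
  ultimately show ?thesis using L by (intro LIMSEQ_le) auto
qed

lemma total_variation_dyadic_limit:
  assumes "continuous_on {0..1} f"
    and L: "(\<lambda>N. \<Sum>k<2 ^ N. \<bar>f (real (k + 1) / 2 ^ N) - f (real k / 2 ^ N)\<bar>) \<longlonglongrightarrow> L"
  shows "bounded_variation f 0 1" "total_variation f 0 1 = L"
proof -
  note le = variation_sums_le_dyadic_limit[OF assms]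
  show bv: "bounded_variation f 0 1" unfolding bounded_variation_def using le by (rule bdd_aboveI)
  show "total_variation f 0 1 = L" unfolding total_variation_def
  proof (rule antisym)
    show "Sup (variation_sums f 0 1) \<le> L"
      by (rule cSup_least) (use dyadic_sum_in_variation_sums le in auto)
    show "L \<le> Sup (variation_sums f 0 1)"
      by (rule LIMSEQ_le_const2[OF L])
         (use bv dyadic_sum_in_variation_sums in \<open>auto intro!: exI cSup_upper simp: bounded_variation_def\<close>)
  qed
qed

text \<open>By the Cauchy-Schwarz inequality the square of the range is at most \<open>N\<close>
  times the variance. \<open>g N\<close> and \<open>2 * N\<close> are both eventually at most
  \<open>2 powr (\<kappa> * N)\<close>, which uses up the margin \<open>2 * \<kappa>\<close> in the
  square.\<close>

lemma walk_range_growth: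
  assumes rv: "regularly_varying g \<rho>"
    and v: "(\<lambda>N. (\<Sum>m<N. (a m)\<^sup>2) / (2 powr (2 * q * real N) * g (real N))) \<longlonglongrightarrow> 1"
    and \<kappa>: "\<kappa> > 0"
  shows "\<forall>\<^sub>F N in sequentially. (\<Sum>m<N. \<bar>a m\<bar>) \<le> 2 powr ((q + \<kappa>) * real N)"
proof -
  have pos: "g (real N) > 0" for N using rv by (simp add: regularly_varying_def)
  have "(\<lambda>N. 2 * real N / 2 powr (\<kappa> * real N)) \<longlonglongrightarrow> 0" using \<kappa> by real_asymp
  then have e1: "\<forall>\<^sub>F N in sequentially. 2 * real N / 2 powr (\<kappa> * real N) < 1" by (rule order_tendstoD) simp
  have e2: "\<forall>\<^sub>F N in sequentially. (\<Sum>m<N. (a m)\<^sup>2) / (2 powr (2 * q * real N) * g (real N)) < 2"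
    using v by (rule order_tendstoD) simp
  have e3: "\<forall>\<^sub>F N in sequentially. \<bar>ln (g (real N))\<bar> \<le> \<kappa> * ln 2 * real N"
    by (intro eventually_nat_real rv_log_sublinear[OF rv]) (use \<kappa> in simp)
  show ?thesis using e1 e2 e3
  proof eventually_elim
    case (elim N)
    have "g (real N) = exp (ln (g (real N)))" using pos[of N] by simp
    also have "\<dots> \<le> exp (\<kappa> * ln 2 * real N)" using elim(3) by simp
    also have "\<dots> = 2 powr (\<kappa> * real N)" by (simp add: powr_def mult_ac)
    finally have gN: "g (real N) \<le> 2 powr (\<kappa> * real N)" .
    have "(\<Sum>m<N. \<bar>a m\<bar>)\<^sup>2 \<le> (\<Sum>m<N. (a m)\<^sup>2) * real N"
      using sum_squared_le_sum_of_squares[of "\<lambda>m. \<bar>a m\<bar>" "{..<N}"] by simp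
    also have "\<dots> \<le> 2 * (2 powr (2 * q * real N) * g (real N)) * real N"
      using elim(2) pos[of N] by (intro mult_right_mono) (auto simp: pos_divide_less_eq)
    also have "\<dots> \<le> 2 * (2 powr (2 * q * real N) * 2 powr (\<kappa> * real N)) * real N"
      using gN by (intro mult_right_mono mult_left_mono) auto
    also have "\<dots> = 2 powr (2 * q * real N) * 2 powr (\<kappa> * real N) * (2 * real N)" by simp
    also have "\<dots> \<le> 2 powr (2 * q * real N) * 2 powr (\<kappa> * real N) * 2 powr (\<kappa> * real N)"
      using elim(1) by (intro mult_left_mono) (auto simp: divide_less_eq)
    also have "\<dots> = (2 powr ((q + \<kappa>) * real N))\<^sup>2"
      by (simp add: power2_eq_square algebra_simps flip: powr_add)
    finally show ?case by (rule power2_le_imp_le) simp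
  qed
qed

text \<open>The factor \<open>sqrt (g N)\<close> eventually destroys at most half of the exponential
  rate \<open>q\<close>.\<close>

lemma normalizer_at_top:
  assumes rv: "regularly_varying g \<rho>" and q: "q > 0"
  shows "filterlim (\<lambda>N. 2 powr (q * real N) * sqrt (g (real N))) at_top sequentially"
proof (rule filterlim_at_top_mono)
  show "filterlim (\<lambda>N. 2 powr (q / 2 * real N)) at_top sequentially" using q by real_asymp
  have pos: "g (real N) > 0" for N using rv by (simp add: regularly_varying_def)
  have "\<forall>\<^sub>F N in sequentially. \<bar>ln (g (real N))\<bar> \<le> q * ln 2 * real N"
    by (intro eventually_nat_real rv_log_sublinear[OF rv]) (use q in simp)
  then show "\<forall>\<^sub>F N in sequentially. 2 powr (q / 2 * real N) \<le> 2 powr (q * real N) * sqrt (g (real N))"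
  proof eventually_elim
    case (elim N)
    have "2 powr (q / 2 * real N) = exp (q * real N * ln 2 - q * ln 2 * real N / 2)"
      by (simp add: powr_def algebra_simps)
    also have "\<dots> \<le> exp (q * real N * ln 2 + ln (g (real N)) / 2)"
      unfolding exp_le_cancel_iff using elim by linarith
    also have "\<dots> = 2 powr (q * real N) * sqrt (g (real N))"
    proof -
      have "sqrt (g (real N)) = exp (ln (g (real N)) / 2)"
        using pos[of N] by (metis exp_ln ln_sqrt real_sqrt_gt_zero less_imp_le)
      then show ?thesis by (simp add: powr_def exp_add)
    qed
    finally show ?case .
  qed
qed

text \<open>Truncation factors the map through the compact interval \<open>{0..K}\<close>, on which
  a continuous power is uniformly continuous.\<close>

lemma uniformly_continuous_min_powr:
  assumes "K > 0" "r > 0"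
  shows "uniformly_continuous_on UNIV (\<lambda>x::real. min \<bar>x\<bar> K powr r)"
proof -
  have u: "uniformly_continuous_on UNIV (\<lambda>x::real. min \<bar>x\<bar> K)"
    unfolding uniformly_continuous_on_def
  proof (intro allI impI)
    fix e :: real assume "e > 0"
    then show "\<exists>d>0. \<forall>x\<in>UNIV. \<forall>x'\<in>UNIV. dist x' x < d \<longrightarrow> dist (min \<bar>x'\<bar> K) (min \<bar>x\<bar> K) < e"
      by (intro exI[of _ e]) (auto simp: dist_real_def min_def)
  qed
  have "range (\<lambda>x::real. min \<bar>x\<bar> K) \<subseteq> {0..K}" using assms by auto
  moreover have "x = min \<bar>x\<bar> K" if "x \<in> {0..K}" for x using that by auto
  ultimately have "range (\<lambda>x::real. min \<bar>x\<bar> K) = {0..K}" by blast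
  then have "uniformly_continuous_on (range (\<lambda>x::real. min \<bar>x\<bar> K)) (\<lambda>x. x powr r)"
    using assms by (simp only:) (intro compact_uniformly_continuous continuous_on_powr' continuous_intros; auto)
  from uniformly_continuous_on_compose[OF u this] show ?thesis by (simp add: comp_def)
qed

section \<open>Bounded variation and the two variation formulas\<close>

context rademacher begin

text \<open>A dyadic sum is itself a variation sum and equals the first absolute moment of the walk.
  Khintchine's inequality turns a bound on it into a bound on the increasing sequence
  \<open>ssq\<close>; conversely, if \<open>ssq\<close> converges, the dyadic sums tend to the
  moment of the series.\<close>

lemma bounded_variation_iff_convergent:
  assumes sm: "summable (\<lambda>m. \<bar>\<alpha> m\<bar>)"
  shows "bounded_variation (takagi_fun \<alpha>) 0 1 \<longleftrightarrow> convergent (ssq \<alpha>)"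
    and "convergent (ssq \<alpha>) \<Longrightarrow> AE \<omega> in M. summable (\<lambda>m. \<alpha> m * 2 ^ m * Y (m + 1) \<omega>)"
    and "convergent (ssq \<alpha>) \<Longrightarrow> integrable M (\<lambda>\<omega>. \<bar>Ztilde \<alpha> Y \<omega>\<bar>)"
    and "convergent (ssq \<alpha>) \<Longrightarrow> total_variation (takagi_fun \<alpha>) 0 1 = (\<integral>\<omega>. \<bar>Ztilde \<alpha> Y \<omega>\<bar> \<partial>M)"
proof -
  define a where "a m = \<alpha> m * 2 ^ m" for m
  have as: "summable (\<lambda>m. (a m)\<^sup>2)" if "convergent (ssq \<alpha>)"
    using that by (simp add: summable_iff_convergent ssq_eq_sum_squares[abs_def] a_def)
  have Z: "Ztilde \<alpha> Y \<omega> = (\<Sum>m. a m * Y (Suc m) \<omega>)" for \<omega> by (simp add: Ztilde_def a_def)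
  have c: "continuous_on {0..1} (takagi_fun \<alpha>)" by (rule continuous_on_takagi[OF sm])
  have lim: "(\<lambda>N. \<Sum>k<2 ^ N. \<bar>takagi_fun \<alpha> (real (k + 1) / 2 ^ N) - takagi_fun \<alpha> (real k / 2 ^ N)\<bar>)
     \<longlonglongrightarrow> (\<integral>\<omega>. \<bar>Ztilde \<alpha> Y \<omega>\<bar> \<partial>M)" if "convergent (ssq \<alpha>)"
    unfolding dyadic_abs_increments_walk[OF sm] Z
    using expectation_series_signs(2)[OF as[OF that]] by (simp add: a_def[abs_def])
  show "convergent (ssq \<alpha>) \<Longrightarrow> AE \<omega> in M. summable (\<lambda>m. \<alpha> m * 2 ^ m * Y (m + 1) \<omega>)"
    using AE_summable_signs[OF as] by (simp add: a_def)
  show "convergent (ssq \<alpha>) \<Longrightarrow> integrable M (\<lambda>\<omega>. \<bar>Ztilde \<alpha> Y \<omega>\<bar>)"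
    unfolding Z by (rule expectation_series_signs(1)[OF as])
  show "convergent (ssq \<alpha>) \<Longrightarrow> total_variation (takagi_fun \<alpha>) 0 1 = (\<integral>\<omega>. \<bar>Ztilde \<alpha> Y \<omega>\<bar> \<partial>M)"
    by (rule total_variation_dyadic_limit(2)[OF c lim])
  show "bounded_variation (takagi_fun \<alpha>) 0 1 \<longleftrightarrow> convergent (ssq \<alpha>)"
  proof
    assume "convergent (ssq \<alpha>)"
    then show "bounded_variation (takagi_fun \<alpha>) 0 1" by (rule total_variation_dyadic_limit(1)[OF c lim])
  next
    assume "bounded_variation (takagi_fun \<alpha>) 0 1"
    then obtain C where C: "\<And>x. x \<in> variation_sums (takagi_fun \<alpha>) 0 1 \<Longrightarrow> x \<le> C"
      unfolding bounded_variation_def bdd_above_def by blast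
    have "ssq \<alpha> n \<le> (16 / 9 * C)\<^sup>2" for n
    proof -
      have "9 / 16 * sqrt (ssq \<alpha> n) \<le> walk_avg n a (\<lambda>y. \<bar>y\<bar>) 0"
        using walk_avg_abs_lower[of a n] by (simp add: ssq_eq_sum_squares a_def)
      also have "\<dots> \<le> C"
        using C[OF dyadic_sum_in_variation_sums[where N = n]]
        unfolding dyadic_abs_increments_walk[OF sm] by (simp add: a_def[abs_def])
      finally have "sqrt (ssq \<alpha> n) \<le> 16 / 9 * C" by simp
      then show ?thesis by (rule sqrt_le_D)
    qed
    moreover have "incseq (ssq \<alpha>)"
      unfolding ssq_def[abs_def] by (intro incseq_SucI) simp
    ultimately obtain L where "ssq \<alpha> \<longlonglongrightarrow> L"
      using incseq_convergent by metis
    then show "convergent (ssq \<alpha>)" by (rule convergentI)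
  qed
qed

lemma dyadic_variation_index_zero:
  assumes sm: "summable (\<lambda>m. \<bar>\<alpha> m\<bar>)" and rv: "regularly_varying g \<rho>"
    and g: "(\<lambda>n. ssq \<alpha> n / g (real n)) \<longlonglongrightarrow> 1"
    and inf: "filterlim (ssq \<alpha>) at_top sequentially"
  shows "has_dyadic_variation (Phi 0 g) (takagi_fun \<alpha>) (\<lambda>t. sqrt (2 / pi) * t)"
proof -
  define a where "a m = \<alpha> m * 2 ^ m" for m
  define v where "v N = (\<Sum>m<N. (a m)\<^sup>2)" for N
  define \<sigma> where "\<sigma> N = sqrt (g (real N))" for N
  have pos: "g (real N) > 0" for N using rv by (simp add: regularly_varying_def)
  have \<sigma>: "\<sigma> N > 0" "(\<sigma> N)\<^sup>2 = g (real N)" for N using pos[of N] by (simp_all add: \<sigma>_def)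
  have v: "ssq \<alpha> = v" by (simp add: ssq_eq_sum_squares[abs_def] v_def[abs_def] a_def)
  have vg: "(\<lambda>N. v N / (2 powr (2 * 0 * real N) * g (real N))) \<longlonglongrightarrow> 1" using g by (simp add: v)
  have ratio: "(\<lambda>N. v (Suc N) / v N) \<longlonglongrightarrow> 1" and vpos: "\<forall>\<^sub>F N in sequentially. v N > 0"
    using normalizer_ratio_Suc[OF rv vg] by simp_all
  \<comment> \<open>Since \<open>v (Suc N) - v N = (a N)\<^sup>2\<close>, the ratio limit 1 says
    that single steps are negligible; this is where \<open>q = 0\<close> enters.\<close>
  have "(\<lambda>N. v (Suc N) / v N - 1) \<longlonglongrightarrow> 1 - 1" by (intro tendsto_diff ratio tendsto_const)
  moreover have "\<forall>\<^sub>F N in sequentially. v (Suc N) / v N - 1 = (a N)\<^sup>2 / v N"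
    using vpos by eventually_elim (simp add: v_def field_simps)
  ultimately have small: "(\<lambda>N. (a N)\<^sup>2 / v N) \<longlonglongrightarrow> 1 - 1" by (rule Lim_transform_eventually)
  have clt: "(\<lambda>N. walk_avg N a (\<lambda>y. \<bar>y / sqrt (v N)\<bar>) 0) \<longlonglongrightarrow> sqrt (2 / pi)"
    using walk_abs_clt[of a] inf small unfolding v v_def by simp
  \<comment> \<open>The central limit theorem normalizes by \<open>sqrt (v N)\<close>, but
    \<open>Phi\<close> by \<open>\<sigma> N\<close>; homogeneity of the absolute value permits the
    exchange.\<close>
  have "(\<lambda>N. sqrt (v N / g (real N))) \<longlonglongrightarrow> sqrt 1" using vg by (intro tendsto_real_sqrt) simp
  then have vs: "(\<lambda>N. sqrt (v N) / \<sigma> N) \<longlonglongrightarrow> 1" by (simp add: \<sigma>_def real_sqrt_divide)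
  have "(\<lambda>N. sqrt (v N) / \<sigma> N * walk_avg N a (\<lambda>y. \<bar>y / sqrt (v N)\<bar>) 0) \<longlonglongrightarrow> 1 * sqrt (2 / pi)"
    by (intro tendsto_mult vs clt)
  moreover have "\<forall>\<^sub>F N in sequentially. sqrt (v N) / \<sigma> N * walk_avg N a (\<lambda>y. \<bar>y / sqrt (v N)\<bar>) 0 = walk_avg N a (\<lambda>y. \<bar>y / \<sigma> N\<bar>) 0"
    using vpos
  proof eventually_elim
    case (elim N)
    have "sqrt (v N) / \<sigma> N * \<bar>y / sqrt (v N)\<bar> = \<bar>y / \<sigma> N\<bar>" for y
      using elim \<sigma>(1)[of N] by (simp add: abs_mult)
    then show ?case by (simp flip: walk_avg_cmult)
  qed
  ultimately have L: "(\<lambda>N. walk_avg N a (\<lambda>y. \<bar>y / \<sigma> N\<bar>) 0) \<longlonglongrightarrow> 1 * sqrt (2 / pi)"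
    by (rule Lim_transform_eventually)
  have "filterlim (\<lambda>N. g (real N)) at_top sequentially"
  proof (rule filterlim_at_top_mono)
    show "filterlim (\<lambda>N. 1 / 2 * v N) at_top sequentially"
      using inf unfolding v by (intro filterlim_tendsto_pos_mult_at_top[OF tendsto_const]) auto
    have "\<forall>\<^sub>F N in sequentially. v N / g (real N) < 2" using g unfolding v by (rule order_tendstoD) simp
    then show "\<forall>\<^sub>F N in sequentially. 1 / 2 * v N \<le> g (real N)"
      by eventually_elim (use pos in \<open>simp add: pos_divide_less_eq\<close>)
  qed
  then have \<sigma>top: "filterlim \<sigma> at_top sequentially"
    unfolding \<sigma>_def by (rule filterlim_compose[OF sqrt_at_top])
  show ?thesis
  proof (rule dyadic_variation_limit[OF sm \<sigma>top])
    show "uniformly_continuous_on UNIV (\<lambda>x::real. \<bar>x\<bar>)"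
      by (intro uniformly_continuous_on_norm[of _ "\<lambda>x::real. x", simplified] uniformly_continuous_on_id)
    show "(\<lambda>N. walk_avg N (\<lambda>m. \<alpha> m * 2 ^ m) (\<lambda>y. \<bar>y / \<sigma> N\<bar>) 0) \<longlonglongrightarrow> sqrt (2 / pi)"
      using L by (simp add: a_def[abs_def])
    fix e :: real assume e: "e > 0"
    have "\<forall>\<^sub>F N in sequentially. \<forall>y. \<bar>y\<bar> \<le> (\<Sum>m<N. \<bar>a m\<bar>) \<longrightarrow>
     \<bar>2 ^ N * Phi 0 g (\<bar>y\<bar> / 2 ^ N) - \<bar>y / (2 powr (0 * real N) * sqrt (g (real N)))\<bar> powr (1 / (1 - 0))\<bar>
       \<le> e * (1 + \<bar>y / (2 powr (0 * real N) * sqrt (g (real N)))\<bar> powr (1 / (1 - 0)))"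
      by (rule Phi_asymptotic[OF rv _ _ walk_range_growth[OF rv vg[unfolded v_def]] e]) auto
    then show "\<forall>\<^sub>F N in sequentially. \<forall>y. \<bar>y\<bar> \<le> (\<Sum>m<N. \<bar>\<alpha> m * 2 ^ m\<bar>) \<longrightarrow>
       \<bar>2 ^ N * Phi 0 g (\<bar>y\<bar> / 2 ^ N) - \<bar>y / \<sigma> N\<bar>\<bar> \<le> e * (1 + \<bar>y / \<sigma> N\<bar>)"
      by (simp add: a_def \<sigma>_def)
  qed (auto simp: Phi_nonneg)
qed

lemma dyadic_variation_index_pos:
  assumes sm: "summable (\<lambda>m. \<bar>\<alpha> m\<bar>)" and rv: "regularly_varying g \<rho>"
    and q: "0 < q" "q < 1"
    and g: "(\<lambda>n. ssq \<alpha> n / (2 powr (2 * q * real n) * g (real n))) \<longlonglongrightarrow> 1"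
  shows "integrable M (\<lambda>\<omega>. \<bar>Zq q Y \<omega>\<bar> powr (1 / (1 - q)))"
    and "has_dyadic_variation (Phi q g) (takagi_fun \<alpha>)
          (\<lambda>t. (\<integral>\<omega>. \<bar>Zq q Y \<omega>\<bar> powr (1 / (1 - q)) \<partial>M) * t)"
proof -
  define a where "a m = \<alpha> m * 2 ^ m" for m
  define r where "r = 1 / (1 - q)"
  define \<sigma> where "\<sigma> N = 2 powr (q * real N) * sqrt (g (real N))" for N
  have r: "r > 0" using q by (simp add: r_def)
  have pos: "g (real N) > 0" for N using rv by (simp add: regularly_varying_def)
  have \<sigma>: "\<sigma> N > 0" for N using pos[of N] by (simp add: \<sigma>_def)
  have \<sigma>2: "(\<sigma> N)\<^sup>2 = 2 powr (2 * q * real N) * g (real N)" for N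
  proof -
    have "(2 powr (q * real N))\<^sup>2 = 2 powr (real 2 * (q * real N))" by (rule powr_power) simp
    then show ?thesis using pos[of N] by (simp add: \<sigma>_def power_mult_distrib mult.assoc)
  qed
  have vg: "(\<lambda>N. (\<Sum>m<N. (a m)\<^sup>2) / (2 powr (2 * q * real N) * g (real N))) \<longlonglongrightarrow> 1"
    using g by (simp add: ssq_eq_sum_squares a_def)
  note geo = walk_geometric_limit[of q r \<sigma> a, OF q(1) r \<sigma> vg[folded \<sigma>2] normalizer_ratio_Suc[OF rv vg]]
  show "integrable M (\<lambda>\<omega>. \<bar>Zq q Y \<omega>\<bar> powr (1 / (1 - q)))" using geo(1) by (simp add: r_def)
  obtain K where K: "K > 0" "\<forall>\<^sub>F N in sequentially. (\<Sum>m<N. \<bar>a m\<bar>) \<le> K * \<sigma> N"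
    "(\<lambda>N. walk_avg N a (\<lambda>y. min \<bar>y / \<sigma> N\<bar> K powr r) 0) \<longlonglongrightarrow> (\<integral>\<omega>. \<bar>Zq q Y \<omega>\<bar> powr r \<partial>M)"
    using geo(2) by blast
  have \<sigma>top: "filterlim \<sigma> at_top sequentially"
    unfolding \<sigma>_def by (rule normalizer_at_top[OF rv q(1)])
  have "has_dyadic_variation (Phi q g) (takagi_fun \<alpha>) (\<lambda>t. (\<integral>\<omega>. \<bar>Zq q Y \<omega>\<bar> powr r \<partial>M) * t)"
  proof (rule dyadic_variation_limit[OF sm \<sigma>top uniformly_continuous_min_powr[OF K(1) r]])
    show "(\<lambda>N. walk_avg N (\<lambda>m. \<alpha> m * 2 ^ m) (\<lambda>y. min \<bar>y / \<sigma> N\<bar> K powr r) 0) \<longlonglongrightarrow> (\<integral>\<omega>. \<bar>Zq q Y \<omega>\<bar> powr r \<partial>M)"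
      using K(3) by (simp add: a_def[abs_def])
    fix e :: real assume e: "e > 0"
    have "\<forall>\<^sub>F N in sequentially. \<forall>y. \<bar>y\<bar> \<le> (\<Sum>m<N. \<bar>a m\<bar>) \<longrightarrow>
      \<bar>2 ^ N * Phi q g (\<bar>y\<bar> / 2 ^ N) - \<bar>y / \<sigma> N\<bar> powr r\<bar> \<le> e * (1 + \<bar>y / \<sigma> N\<bar> powr r)"
      unfolding \<sigma>_def r_def
      by (rule Phi_asymptotic[OF rv _ q(2) walk_range_growth[OF rv vg] e]) (use q in auto)
    \<comment> \<open>On the range of the walk \<open>\<bar>y / \<sigma> N\<bar>\<close> is at most
      \<open>K\<close>, so the truncated power coincides with the full one.\<close>
    then show "\<forall>\<^sub>F N in sequentially. \<forall>y. \<bar>y\<bar> \<le> (\<Sum>m<N. \<bar>\<alpha> m * 2 ^ m\<bar>) \<longrightarrow>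
       \<bar>2 ^ N * Phi q g (\<bar>y\<bar> / 2 ^ N) - min \<bar>y / \<sigma> N\<bar> K powr r\<bar> \<le> e * (1 + min \<bar>y / \<sigma> N\<bar> K powr r)"
      using K(2)
    proof eventually_elim
      case (elim N)
      show ?case
      proof (intro allI impI)
        fix y assume y: "\<bar>y\<bar> \<le> (\<Sum>m<N. \<bar>\<alpha> m * 2 ^ m\<bar>)"
        then have "\<bar>y\<bar> \<le> K * \<sigma> N" using elim(2) by (simp add: a_def)
        then have "\<bar>y / \<sigma> N\<bar> \<le> K" using \<sigma>[of N] by (simp add: pos_divide_le_eq)
        then have "min \<bar>y / \<sigma> N\<bar> K = \<bar>y / \<sigma> N\<bar>" by (rule min_absorb1)
        then show "\<bar>2 ^ N * Phi q g (\<bar>y\<bar> / 2 ^ N) - min \<bar>y / \<sigma> N\<bar> K powr r\<bar> \<le> e * (1 + min \<bar>y / \<sigma> N\<bar> K powr r)"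
          using elim(1) y by (simp only: a_def)
      qed
    qed
  qed (auto simp: Phi_nonneg)
  then show "has_dyadic_variation (Phi q g) (takagi_fun \<alpha>)
          (\<lambda>t. (\<integral>\<omega>. \<bar>Zq q Y \<omega>\<bar> powr (1 / (1 - q)) \<partial>M) * t)" by (simp add: r_def)
qed

end

text \<open>As \<open>ssq \<alpha>\<close> is increasing, \<open>convergent (ssq \<alpha>)\<close>
  expresses that its limit is finite. Summability and integrability are asserted next to the
  formulas, because \<open>suminf\<close> and the integral would otherwise return default
  values.\<close>

theorem theorem3p3:
  fixes \<alpha> :: "nat \<Rightarrow> real" and q \<rho> :: real and g :: "real \<Rightarrow> real"
    and M :: "'w measure" and Y :: "nat \<Rightarrow> 'w \<Rightarrow> real"
  assumes "summable (\<lambda>m. \<bar>\<alpha> m\<bar>)"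
    and "0 \<le> q" and "q < 1"
    and "regularly_varying g \<rho>" and "bounded_on_compacts g"
    and "(\<lambda>n. ssq \<alpha> n / (2 powr (2 * q * real n) * g (real n))) \<longlonglongrightarrow> 1"
    and "prob_space M" and "iid_symmetric_signs M Y"
  shows
    "(bounded_variation (takagi_fun \<alpha>) 0 1 \<longleftrightarrow> convergent (ssq \<alpha>)) \<and>
     (bounded_variation (takagi_fun \<alpha>) 0 1 \<longrightarrow>
        (AE \<omega> in M. summable (\<lambda>m. \<alpha> m * 2 ^ m * Y (m + 1) \<omega>)) \<and>
        integrable M (\<lambda>\<omega>. \<bar>Ztilde \<alpha> Y \<omega>\<bar>) \<and>
        total_variation (takagi_fun \<alpha>) 0 1 = (\<integral>\<omega>. \<bar>Ztilde \<alpha> Y \<omega>\<bar> \<partial>M)) \<and>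
     (filterlim (ssq \<alpha>) at_top sequentially \<and> q = 0 \<longrightarrow>
        has_dyadic_variation (Phi 0 g) (takagi_fun \<alpha>) (\<lambda>t. sqrt (2 / pi) * t)) \<and>
     (0 < q \<longrightarrow>
        (AE \<omega> in M. summable (\<lambda>m. 2 powr (- q * real (m + 1)) * Y (m + 1) \<omega>)) \<and>
        integrable M (\<lambda>\<omega>. \<bar>Zq q Y \<omega>\<bar> powr (1 / (1 - q))) \<and>
        has_dyadic_variation (Phi q g) (takagi_fun \<alpha>)
          (\<lambda>t. (\<integral>\<omega>. \<bar>Zq q Y \<omega>\<bar> powr (1 / (1 - q)) \<partial>M) * t))"
proof -
  interpret rademacher M Y
    using assms(7,8) by (simp add: rademacher_def rademacher_axioms_def)
  note bv = bounded_variation_iff_convergent[OF assms(1)]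
  show ?thesis
  proof (intro conjI impI)
    assume "bounded_variation (takagi_fun \<alpha>) 0 1"
    then have c: "convergent (ssq \<alpha>)" using bv(1) by blast
    show "AE \<omega> in M. summable (\<lambda>m. \<alpha> m * 2 ^ m * Y (m + 1) \<omega>)"
      "integrable M (\<lambda>\<omega>. \<bar>Ztilde \<alpha> Y \<omega>\<bar>)"
      "total_variation (takagi_fun \<alpha>) 0 1 = (\<integral>\<omega>. \<bar>Ztilde \<alpha> Y \<omega>\<bar> \<partial>M)"
      using bv(2-4)[OF c] by blast+
  next
    assume "filterlim (ssq \<alpha>) at_top sequentially \<and> q = 0"
    then show "has_dyadic_variation (Phi 0 g) (takagi_fun \<alpha>) (\<lambda>t. sqrt (2 / pi) * t)"
      using dyadic_variation_index_zero[OF assms(1,4)] assms(6) by simp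
  next
    assume q: "0 < q"
    show "AE \<omega> in M. summable (\<lambda>m. 2 powr (- q * real (m + 1)) * Y (m + 1) \<omega>)"
      by (rule AE_summable_Zq[OF q])
    show "integrable M (\<lambda>\<omega>. \<bar>Zq q Y \<omega>\<bar> powr (1 / (1 - q)))"
      "has_dyadic_variation (Phi q g) (takagi_fun \<alpha>)
          (\<lambda>t. (\<integral>\<omega>. \<bar>Zq q Y \<omega>\<bar> powr (1 / (1 - q)) \<partial>M) * t)"
      using dyadic_variation_index_pos[OF assms(1,4) q assms(3,6)] by blast+
  qed (rule bv(1))
qed

end
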